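(* Let $\Gamma$ be a countable discrete group and let $A$ denote either $C_\lambda^*(\Gamma)$ or $C_u^*(\Gamma)$. Then $\Gamma$ is amenable if and only if one of the following equivalent conditions holds: (i) The identity lies in the closure of $\bigcup_{p\in[1,2)}\mathbf S_p(\Gamma)$ with respect to the strong operator topology on $B(A)$. (ii) For each finite subset $F$ of $\Gamma$, $$\delta^{(F,p)}:=\min_{M\in\mathbf X_p(\Gamma)}\|M_{\mathbf 1_{\mathrm{Tube}(F)}}-r_F(M)\|$$ converges to zero as $p\in[1,2)$ converges to $2$. In this case, for any sequence of finite sets $F_n\uparrow\Gamma$, there exist $p_n\in[1,2)$ such that the minimizers $M^{(F_n,p_n)}$ in the definition of $\delta^{(F_n,p_n)}$ converge, as $n\to\infty$, to the identity with respect to the strong operator topology on $B(A)$.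
   Context: $\{\delta_x\}_{x\in\Gamma}$ is the canonical orthonormal basis of $\ell^2(\Gamma)$; for $T\in B(\ell^2(\Gamma))$ put $T(x,y)=\langle\delta_x,T\delta_y\rangle$. For finite $F\subset\Gamma$, $\mathrm{Tube}(F)=\{(x,y)\in\Gamma\times\Gamma:xy^{-1}\in F\}$. $T$ has finite propagation if $\{(x,y):T(x,y)\neq0\}\subset\mathrm{Tube}(F)$ for some finite $F$. The uniform Roe algebra $C_u^*(\Gamma)$ is the norm closure in $B(\ell^2(\Gamma))$ of the finite propagation operators; the reduced group $C^*$-algebra $C_\lambda^*(\Gamma)\subset B(\ell^2(\Gamma))$ is generated by the left regular representation $(\lambda(s)f)(x)=f(s^{-1}x)$. For $k\in\ell^\infty(\Gamma\times\Gamma)$, the Schur multiplier $M_k$ (when well defined) is $T\mapsto[k(x,y)T(x,y)]_{x,y\in\Gamma}$ on $B(\ell^2(\Gamma))$. For $\varphi:\Gamma\to\mathbb C$, $M_\varphi:=M_{k_\varphi}$ with $k_\varphi(x,y)=\varphi(xy^{-1})$; it restricts to a bounded operator on $C_u^*(\Gamma)$ and on $C_\lambda^*(\Gamma)$, also denoted $M_\varphi$. For finite $F\subset\Gamma$, the cut-off of a Schur multiplier $M_k$ outside $\mathrm{Tube}(F)$ is $r_F(M_k):=M_{k\mathbf 1_{\mathrm{Tube}(F)}}$. All multipliers in the statement are regarded as operators on $A$ and $\|\cdot\|$ is the operator norm of $B(A)$. The strong operator topology on $B(A)$ is induced by the seminorms $M\mapsto\|M(T)\|$, $T\in A$. For $f\in\ell^2(\Gamma)$,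 $\Phi(f)(s)=\sum_{t\in\Gamma}f(t)\overline{f(ts)}$; $M_{\Phi(f)}$ is well defined. $\mathcal M_p(\Gamma)=\{f:\Gamma\to[0,1]:\|f\|_p=1\}$, $\mathcal M_p^{\le1}(\Gamma)=\{f:\Gamma\to[0,1]:\|f\|_p\le1\}$. $\mathbf S_p(\Gamma)=\{M_{\Phi(f)}:f\in\mathcal M_p(\Gamma)\}$. The orbit of $f$ is $\widetilde f=\{f(s^{-1}\cdot):s\in\Gamma\}$; $\Phi(f)$ depends only on $\widetilde f$. $\widetilde{\mathcal X}_p(\Gamma)$ is the set of all empty, finite or countable collections (with multiplicity) $\xi=\{\widetilde\alpha_i\}_{i\in I}$, $I\subset\mathbb N$, with $\alpha_i\in\mathcal M_p^{\le1}(\Gamma)$ and $\sum_i\|\alpha_i\|_p^p\le1$; $M_\xi=\sum_{\widetilde\alpha\in\xi}M_{\Phi(\alpha)}$ (norm-convergent), and $\mathbf X_p(\Gamma)=\{M_\xi:\xi\in\widetilde{\mathcal X}_p(\Gamma)\}$. $F_n\uparrow\Gamma$ means $F_1\subset F_2\subset\cdots$ with $\bigcup_nF_n=\Gamma$. $\Gamma$ is amenable if there is a left-translation-invariant mean (state) on $\ell^\infty(\Gamma)$. *)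

theory Defs
  imports "HOL-Analysis.Analysis"
begin

text \<open>
  The discrete group is a type of class \<open>group_add\<close>, which is not assumed commutative.
  It is written additively: \<open>x - y\<close> is \<open>x y\<inverse>\<close>, \<open>- s + x\<close> is \<open>s\<inverse> x\<close>, \<open>t + s\<close> is \<open>t s\<close>.
\<close>

section \<open>The Hilbert space of square-summable functions\<close>

typedef 'g ell2 = "{f :: 'g \<Rightarrow> complex. (\<lambda>x. (cmod (f x))\<^sup>2) summable_on UNIV}"
  morphisms ell2_fun Abs_ell2
  by (rule exI[of _ "\<lambda>_. 0"]) simp

setup_lifting type_definition_ell2

lemma ell2_prod_abs_summable:
  fixes f g :: "'g \<Rightarrow> complex"
  assumes "(\<lambda>x. (cmod (f x))\<^sup>2) summable_on UNIV" "(\<lambda>x. (cmod (g x))\<^sup>2) summable_on UNIV"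
  shows "(\<lambda>x. norm (cnj (f x) * g x)) summable_on UNIV"
proof (rule summable_on_comparison_test)
  show "(\<lambda>x. (cmod (f x))\<^sup>2 + (cmod (g x))\<^sup>2) summable_on UNIV"
    using assms by (rule summable_on_add)
  show "norm (cnj (f x) * g x) \<le> (cmod (f x))\<^sup>2 + (cmod (g x))\<^sup>2" for x
  proof -
    have "norm (cnj (f x) * g x) \<le> 2 * cmod (f x) * cmod (g x)"
      by (simp add: norm_mult)
    also have "\<dots> \<le> (cmod (f x))\<^sup>2 + (cmod (g x))\<^sup>2"
      by (rule sum_squares_bound)
    finally show ?thesis .
  qed
qed auto

lemma ell2_add_closed:
  fixes f g :: "'g \<Rightarrow> complex"
  assumes "(\<lambda>x. (cmod (f x))\<^sup>2) summable_on UNIV" "(\<lambda>x. (cmod (g x))\<^sup>2) summable_on UNIV"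
  shows "(\<lambda>x. (cmod (f x + g x))\<^sup>2) summable_on UNIV"
proof (rule summable_on_comparison_test)
  show "(\<lambda>x. 2 * (cmod (f x))\<^sup>2 + 2 * (cmod (g x))\<^sup>2) summable_on UNIV"
    using assms by (intro summable_on_add summable_on_cmult_right)
  show "(cmod (f x + g x))\<^sup>2 \<le> 2 * (cmod (f x))\<^sup>2 + 2 * (cmod (g x))\<^sup>2" for x
  proof -
    have "(cmod (f x + g x))\<^sup>2 \<le> (cmod (f x) + cmod (g x))\<^sup>2"
      by (intro power_mono norm_triangle_ineq) auto
    also have "\<dots> \<le> 2 * (cmod (f x))\<^sup>2 + 2 * (cmod (g x))\<^sup>2"
      using sum_squares_bound[of "cmod (f x)" "cmod (g x)"] by (simp add: power2_sum)
    finally show ?thesis .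
  qed
qed auto

lemma ell2_scale_closed:
  fixes f :: "'g \<Rightarrow> complex"
  assumes "(\<lambda>x. (cmod (f x))\<^sup>2) summable_on UNIV"
  shows "(\<lambda>x. (cmod (c * f x))\<^sup>2) summable_on UNIV"
  using summable_on_cmult_right[OF assms, of "(cmod c)\<^sup>2"]
  by (simp add: norm_mult power_mult_distrib)

lift_definition ell2_cscale :: "complex \<Rightarrow> 'g ell2 \<Rightarrow> 'g ell2" is "\<lambda>c f x. c * f x"
  by (rule ell2_scale_closed)

text \<open>Linear in the second argument.\<close>
definition cinner :: "'g ell2 \<Rightarrow> 'g ell2 \<Rightarrow> complex" where
  "cinner f g = (\<Sum>\<^sub>\<infinity>x. cnj (ell2_fun f x) * ell2_fun g x)"

instantiation ell2 :: (type) real_vector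
begin

lift_definition zero_ell2 :: "'a ell2" is "\<lambda>_. 0" by simp
lift_definition plus_ell2 :: "'a ell2 \<Rightarrow> 'a ell2 \<Rightarrow> 'a ell2" is "\<lambda>f g x. f x + g x"
  by (rule ell2_add_closed)
lift_definition uminus_ell2 :: "'a ell2 \<Rightarrow> 'a ell2" is "\<lambda>f x. - f x" by simp
lift_definition minus_ell2 :: "'a ell2 \<Rightarrow> 'a ell2 \<Rightarrow> 'a ell2" is "\<lambda>f g x. f x - g x"
  subgoal for f g using ell2_add_closed[of f "\<lambda>x. - g x"] by simp
  done
lift_definition scaleR_ell2 :: "real \<Rightarrow> 'a ell2 \<Rightarrow> 'a ell2" is "\<lambda>r f x. complex_of_real r * f x"
  by (rule ell2_scale_closed)

instance
  by intro_classes (transfer; auto simp: algebra_simps fun_eq_iff)+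

end

lemma ell2_inner_summable:
  "(\<lambda>x. cnj (ell2_fun f x) * ell2_fun g x) summable_on UNIV"
  by (rule abs_summable_summable, rule ell2_prod_abs_summable) (use ell2_fun in auto)

lemma cinner_add_left: "cinner (f + g) h = cinner f h + cinner g h"
  unfolding cinner_def plus_ell2.rep_eq
  by (simp add: ring_distribs infsum_add ell2_inner_summable)

lemma cinner_commute: "cinner f g = cnj (cinner g f)"
  unfolding cinner_def by (simp flip: infsum_cnj add: mult.commute)

lemma cinner_self: "cinner f f = complex_of_real (\<Sum>\<^sub>\<infinity>x. (cmod (ell2_fun f x))\<^sup>2)"
proof -
  have "cinner f f = (\<Sum>\<^sub>\<infinity>x. complex_of_real ((cmod (ell2_fun f x))\<^sup>2))"
    unfolding cinner_def
    by (intro infsum_cong) (simp only: complex_norm_square mult.commute)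
  also have "\<dots> = complex_of_real (\<Sum>\<^sub>\<infinity>x. (cmod (ell2_fun f x))\<^sup>2)"
    using infsumI[OF has_sum_of_real[OF has_sum_infsum]] ell2_fun[of f] by blast
  finally show ?thesis .
qed

instantiation ell2 :: (type) real_inner
begin

definition inner_ell2 :: "'a ell2 \<Rightarrow> 'a ell2 \<Rightarrow> real" where
  "inner_ell2 f g = Re (cinner f g)"
definition norm_ell2 :: "'a ell2 \<Rightarrow> real" where
  "norm_ell2 f = sqrt (\<Sum>\<^sub>\<infinity>x. (cmod (ell2_fun f x))\<^sup>2)"
definition dist_ell2 :: "'a ell2 \<Rightarrow> 'a ell2 \<Rightarrow> real" where
  "dist_ell2 f g = norm (f - g)"
definition sgn_ell2 :: "'a ell2 \<Rightarrow> 'a ell2" where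
  "sgn_ell2 f = f /\<^sub>R norm f"
definition uniformity_ell2 :: "('a ell2 \<times> 'a ell2) filter" where
  "uniformity_ell2 = (INF e\<in>{0<..}. principal {(x, y). dist x y < e})"
definition open_ell2 :: "'a ell2 set \<Rightarrow> bool" where
  "open_ell2 U = (\<forall>x\<in>U. eventually (\<lambda>(x', y). x' = x \<longrightarrow> y \<in> U) uniformity)"

instance
proof
  fix f g h :: "'a ell2" and r :: real
  show "inner f g = inner g f"
    unfolding inner_ell2_def by (subst cinner_commute) simp
  show "inner (f + g) h = inner f h + inner g h"
    by (simp add: inner_ell2_def cinner_add_left)
  show "inner (r *\<^sub>R f) g = r * inner f g"
  proof -
    have "cinner (r *\<^sub>R f) g = complex_of_real r * cinner f g"
      unfolding cinner_def scaleR_ell2.rep_eq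
      by (simp add: mult.assoc infsum_cmult_right')
    then show ?thesis by (simp add: inner_ell2_def)
  qed
  show "0 \<le> inner f f"
    by (simp add: inner_ell2_def cinner_self infsum_nonneg)
  show "inner f f = 0 \<longleftrightarrow> f = 0"
  proof
    assume "inner f f = 0"
    then have "(\<Sum>\<^sub>\<infinity>x. (cmod (ell2_fun f x))\<^sup>2) = 0"
      by (simp add: inner_ell2_def cinner_self)
    then have "(cmod (ell2_fun f x))\<^sup>2 = 0" for x
      using ell2_fun[of f] by (intro nonneg_infsum_le_0D[of _ UNIV]) auto
    then show "f = 0" by (simp add: zero_ell2.rep_eq fun_eq_iff flip: ell2_fun_inject)
  qed (simp add: inner_ell2_def cinner_self zero_ell2.rep_eq)
  show "norm f = sqrt (inner f f)"
    by (simp add: inner_ell2_def cinner_self norm_ell2_def)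
qed (fact dist_ell2_def sgn_ell2_def uniformity_ell2_def open_ell2_def[rule_format])+

end

lift_definition delta :: "'g \<Rightarrow> 'g ell2" is "\<lambda>x y. if y = x then 1 else 0"
proof -
  fix x :: 'g
  have "(\<lambda>y. (cmod (if y = x then 1 else 0))\<^sup>2) summable_on {x}" by simp
  then show "(\<lambda>y. (cmod (if y = x then 1 else 0))\<^sup>2) summable_on UNIV"
    by (rule summable_on_cong_neutral[THEN iffD1, rotated -1]) auto
qed

section \<open>Operators on the Hilbert space and their matrices\<close>

text \<open>
  Only real-linear bounded operators come with a library type; the complex-linear ones are
  singled out by \<open>bop\<close>, so that \<open>bop\<close> is the algebra of all bounded operators, and
  the norm of \<open>'g op\<close> restricts to its operator norm.
\<close>
type_synonym 'g op = "'g ell2 \<Rightarrow>\<^sub>L 'g ell2"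

definition bop :: "'g op set" where
  "bop = {T :: 'g op. \<forall>c f. T (ell2_cscale c f) = ell2_cscale c (T f)}"

lift_definition cscale_op :: "complex \<Rightarrow> 'g op" is "\<lambda>c f. ell2_cscale c f"
proof
  fix c :: complex and f g :: "'g ell2" and r :: real
  show "ell2_cscale c (f + g) = ell2_cscale c f + ell2_cscale c g"
    by transfer (auto simp: algebra_simps)
  show "ell2_cscale c (r *\<^sub>R f) = r *\<^sub>R ell2_cscale c f"
    by transfer (auto simp: algebra_simps)
  show "\<exists>K. \<forall>f. norm (ell2_cscale c f) \<le> norm (f :: 'g ell2) * K"
    by (rule exI[of _ "cmod c"])
      (simp add: norm_ell2_def ell2_cscale.rep_eq norm_mult power_mult_distrib
        infsum_cmult_right' real_sqrt_mult mult.commute)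
qed

definition entry :: "'g op \<Rightarrow> 'g \<Rightarrow> 'g \<Rightarrow> complex" where
  "entry T x y = cinner (delta x) (T (delta y))"

definition tube :: "'g::group_add set \<Rightarrow> ('g \<times> 'g) set" where
  "tube F = {(x, y). x - y \<in> F}"

definition finite_propagation :: "'g::group_add op \<Rightarrow> bool" where
  "finite_propagation T \<longleftrightarrow> (\<exists>F. finite F \<and> {(x, y). entry T x y \<noteq> 0} \<subseteq> tube F)"

definition uniform_Roe_algebra :: "'g::group_add op set" where
  "uniform_Roe_algebra = closure {T \<in> bop. finite_propagation T}"

lift_definition translate :: "'g::group_add \<Rightarrow> 'g ell2 \<Rightarrow> 'g ell2" is "\<lambda>s f x. f (- s + x)"
proof -
  fix s :: 'g and f :: "'g \<Rightarrow> complex"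
  assume "(\<lambda>x. (cmod (f x))\<^sup>2) summable_on UNIV"
  moreover have "bij (\<lambda>x. - s + x)"
    by (rule bij_betw_byWitness[of _ "\<lambda>x. s + x"]) (auto simp flip: add.assoc)
  ultimately show "(\<lambda>x. (cmod (f (- s + x)))\<^sup>2) summable_on UNIV"
    by (subst summable_on_reindex_bij_betw)
qed

lift_definition left_regular :: "'g::group_add \<Rightarrow> 'g op" is translate
proof
  fix s :: 'g and f g :: "'g ell2" and r :: real
  show "translate s (f + g) = translate s f + translate s g" by transfer simp
  show "translate s (r *\<^sub>R f) = r *\<^sub>R translate s f" by transfer simp
  have "bij (\<lambda>x. - s + x)"
    by (rule bij_betw_byWitness[of _ "\<lambda>x. s + x"]) (auto simp flip: add.assoc)
  then have "norm (translate s f) = norm f" for f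
    unfolding norm_ell2_def translate.rep_eq by (subst infsum_reindex_bij_betw) auto
  then show "\<exists>K. \<forall>f. norm (translate s f) \<le> norm f * K" by (intro exI[of _ 1]) simp
qed

definition is_adjoint :: "'g op \<Rightarrow> 'g op \<Rightarrow> bool" where
  "is_adjoint S T \<longleftrightarrow> (\<forall>f g. cinner (S f) g = cinner f (T g))"

definition Cstar_subalgebra :: "'g op set \<Rightarrow> bool" where
  "Cstar_subalgebra B \<longleftrightarrow> B \<subseteq> bop \<and> closed B \<and> 0 \<in> B
    \<and> (\<forall>S\<in>B. \<forall>T\<in>B. S + T \<in> B)
    \<and> (\<forall>c. \<forall>T\<in>B. cscale_op c o\<^sub>L T \<in> B)
    \<and> (\<forall>S\<in>B. \<forall>T\<in>B. S o\<^sub>L T \<in> B)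
    \<and> (\<forall>T\<in>B. \<exists>S\<in>B. is_adjoint S T)"

definition reduced_group_Cstar :: "'g::group_add op set" where
  "reduced_group_Cstar = \<Inter>{B. Cstar_subalgebra B \<and> range left_regular \<subseteq> B}"

section \<open>Bounded operators on an operator algebra\<close>

text \<open>
  \<open>A\<close> is a set rather than a type, so an operator on \<open>A\<close> is a function that is \<open>undefined\<close>
  outside \<open>A\<close>.
\<close>
definition BL :: "'g op set \<Rightarrow> ('g op \<Rightarrow> 'g op) set" where
  "BL A = {M \<in> A \<rightarrow>\<^sub>E A.
     (\<forall>S\<in>A. \<forall>T\<in>A. M (S + T) = M S + M T)
     \<and> (\<forall>c. \<forall>T\<in>A. M (cscale_op c o\<^sub>L T) = cscale_op c o\<^sub>L M T)
     \<and> (\<exists>C. \<forall>T\<in>A. norm (M T) \<le> C * norm T)}"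

definition opnorm_on :: "'g op set \<Rightarrow> ('g op \<Rightarrow> 'g op) \<Rightarrow> real" where
  "opnorm_on A M = (SUP T\<in>{T \<in> A. norm T \<le> 1}. norm (M T))"

text \<open>The open balls of the seminorms \<open>M \<mapsto> norm (M T)\<close> as a subbase.\<close>
definition SOT :: "'g op set \<Rightarrow> ('g op \<Rightarrow> 'g op) topology" where
  "SOT A = topology_generated_by
     {{N \<in> BL A. norm (N T - M T) < e} | M T e. M \<in> BL A \<and> T \<in> A \<and> 0 < e}"

definition identity_on :: "'g op set \<Rightarrow> 'g op \<Rightarrow> 'g op" where
  "identity_on A = (\<lambda>T\<in>A. T)"

section \<open>Schur multipliers\<close>

definition is_schur_product :: "('g \<times> 'g \<Rightarrow> complex) \<Rightarrow> 'g op \<Rightarrow> 'g op \<Rightarrow> bool" where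
  "is_schur_product k T S \<longleftrightarrow> S \<in> bop \<and> (\<forall>x y. entry S x y = k (x, y) * entry T x y)"

text \<open>\<open>k\<close> is bounded and \<open>M_k\<close> is well defined on all bounded operators.\<close>
definition schur_symbol :: "('g \<times> 'g \<Rightarrow> complex) \<Rightarrow> bool" where
  "schur_symbol k \<longleftrightarrow> bounded (range k) \<and> (\<forall>T\<in>bop. \<exists>S. is_schur_product k T S)"

definition schur :: "'g op set \<Rightarrow> ('g \<times> 'g \<Rightarrow> complex) \<Rightarrow> 'g op \<Rightarrow> 'g op" where
  "schur A k = (\<lambda>T\<in>A. THE S. is_schur_product k T S)"

definition kernel_of :: "('g::group_add \<Rightarrow> complex) \<Rightarrow> 'g \<times> 'g \<Rightarrow> complex" where
  "kernel_of \<phi> = (\<lambda>(x, y). \<phi> (x - y))"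

text \<open>
  If \<open>A\<close> contains all \<open>left_regular s\<close>, then \<open>M = schur A k\<close> has at most one solution
  \<open>k\<close> among the Schur symbols, because the \<open>(x, y)\<close> entry of \<open>left_regular (x - y)\<close> is \<open>1\<close>.
\<close>
definition cutoff ::
    "'g::group_add op set \<Rightarrow> 'g set \<Rightarrow> ('g op \<Rightarrow> 'g op) \<Rightarrow> 'g op \<Rightarrow> 'g op" where
  "cutoff A F M =
     (let k = (THE k. schur_symbol k \<and> M = schur A k)
      in schur A (\<lambda>xy. k xy * indicator (tube F) xy))"

section \<open>The classes of multipliers\<close>

definition Phi :: "('g::group_add \<Rightarrow> complex) \<Rightarrow> 'g \<Rightarrow> complex" where
  "Phi f s = (\<Sum>\<^sub>\<infinity>t. f t * cnj (f (t + s)))"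

definition lp_norm :: "real \<Rightarrow> ('g \<Rightarrow> real) \<Rightarrow> real" where
  "lp_norm p f = (\<Sum>\<^sub>\<infinity>x. \<bar>f x\<bar> powr p) powr (1 / p)"

text \<open>
  \<open>lp_norm\<close> has the junk value \<open>0\<close> on functions that are not \<open>p\<close>-summable, hence the
  explicit summability.
\<close>
definition unit_p :: "real \<Rightarrow> ('g \<Rightarrow> real) set" where
  "unit_p p = {f. range f \<subseteq> {0..1} \<and> (\<lambda>x. \<bar>f x\<bar> powr p) summable_on UNIV \<and> lp_norm p f = 1}"

definition subunit_p :: "real \<Rightarrow> ('g \<Rightarrow> real) set" where
  "subunit_p p = {f. range f \<subseteq> {0..1} \<and> (\<lambda>x. \<bar>f x\<bar> powr p) summable_on UNIV \<and> lp_norm p f \<le> 1}"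

definition Phi_multiplier :: "'g::group_add op set \<Rightarrow> ('g \<Rightarrow> real) \<Rightarrow> 'g op \<Rightarrow> 'g op" where
  "Phi_multiplier A f = schur A (kernel_of (Phi (\<lambda>x. complex_of_real (f x))))"

definition S_class :: "'g::group_add op set \<Rightarrow> real \<Rightarrow> ('g op \<Rightarrow> 'g op) set" where
  "S_class A p = {Phi_multiplier A f | f. f \<in> unit_p p}"

definition orbit :: "('g::group_add \<Rightarrow> real) \<Rightarrow> ('g \<Rightarrow> real) set" where
  "orbit f = {\<lambda>x. f (- s + x) | s. True}"

text \<open>
  A collection with multiplicity is a family of orbits whose index set, the domain of a partial
  map, is an arbitrary subset of \<open>\<nat>\<close>. The indexing is immaterial for \<open>M_xi\<close>.
\<close>
definition orbit_collections :: "real \<Rightarrow> (nat \<rightharpoonup> ('g::group_add \<Rightarrow> real) set) set" where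
  "orbit_collections p = {\<xi>. \<exists>\<alpha>.
     (\<forall>i\<in>dom \<xi>. \<alpha> i \<in> subunit_p p \<and> \<xi> i = Some (orbit (\<alpha> i)))
     \<and> (\<lambda>i. lp_norm p (\<alpha> i) powr p) summable_on dom \<xi>
     \<and> (\<Sum>\<^sub>\<infinity>i\<in>dom \<xi>. lp_norm p (\<alpha> i) powr p) \<le> 1}"

text \<open>\<open>Phi\<close> is constant on orbits, so any representative of an orbit will do.\<close>
definition orbit_multiplier :: "'g::group_add op set \<Rightarrow> ('g \<Rightarrow> real) set \<Rightarrow> 'g op \<Rightarrow> 'g op" where
  "orbit_multiplier A w = Phi_multiplier A (SOME \<alpha>. \<alpha> \<in> w)"

text \<open>The sum converges in the norm of \<open>BL A\<close>.\<close>
definition M_xi ::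
    "'g::group_add op set \<Rightarrow> (nat \<rightharpoonup> ('g \<Rightarrow> real) set) \<Rightarrow> 'g op \<Rightarrow> 'g op" where
  "M_xi A \<xi> = (THE M. M \<in> BL A \<and>
     ((\<lambda>J. opnorm_on A (\<lambda>T. M T - (\<Sum>i\<in>J. orbit_multiplier A (the (\<xi> i)) T))) \<longlongrightarrow> 0)
       (finite_subsets_at_top (dom \<xi>)))"

definition X_class :: "'g::group_add op set \<Rightarrow> real \<Rightarrow> ('g op \<Rightarrow> 'g op) set" where
  "X_class A p = {M_xi A \<xi> | \<xi>. \<xi> \<in> orbit_collections p}"

definition tube_defect :: "'g::group_add op set \<Rightarrow> 'g set \<Rightarrow> ('g op \<Rightarrow> 'g op) \<Rightarrow> real" where
  "tube_defect A F M = opnorm_on A (\<lambda>T. schur A (indicator (tube F)) T - cutoff A F M T)"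

definition is_minimizer ::
    "'g::group_add op set \<Rightarrow> 'g set \<Rightarrow> real \<Rightarrow> ('g op \<Rightarrow> 'g op) \<Rightarrow> bool" where
  "is_minimizer A F p M \<longleftrightarrow> is_arg_min (tube_defect A F) (\<lambda>N. N \<in> X_class A p) M"

definition min_defect :: "'g::group_add op set \<Rightarrow> 'g set \<Rightarrow> real \<Rightarrow> real" where
  "min_defect A F p = (INF M\<in>X_class A p. tube_defect A F M)"

section \<open>Amenability\<close>

text \<open>A mean is a state on the bounded complex functions; its values elsewhere are irrelevant.\<close>
definition is_mean :: "(('g \<Rightarrow> complex) \<Rightarrow> complex) \<Rightarrow> bool" where
  "is_mean m \<longleftrightarrow>
     (\<forall>f g. bounded (range f) \<longrightarrow> bounded (range g) \<longrightarrow> m (\<lambda>x. f x + g x) = m f + m g)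
     \<and> (\<forall>c f. bounded (range f) \<longrightarrow> m (\<lambda>x. c * f x) = c * m f)
     \<and> (\<forall>f. bounded (range f) \<longrightarrow> range f \<subseteq> \<real>\<^sub>\<ge>\<^sub>0 \<longrightarrow> m f \<in> \<real>\<^sub>\<ge>\<^sub>0)
     \<and> m (\<lambda>_. 1) = 1"

definition amenable :: "'g::group_add itself \<Rightarrow> bool" where
  "amenable _ \<longleftrightarrow> (\<exists>m :: ('g \<Rightarrow> complex) \<Rightarrow> complex. is_mean m \<and>
     (\<forall>s f. bounded (range f) \<longrightarrow> m (\<lambda>x. f (- s + x)) = m f))"

end

theory Submission
  imports Defs "HOL-Complex_Analysis.Great_Picard"
begin

text \<open>
  Everything reduces to functions on the group. Each multiplier in the statement is \<open>M_\<phi>\<close> for a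
  function \<open>\<phi>\<close> on the group, and the elements of \<open>X_p\<close> are exactly the \<open>M_\<phi>\<close> whose symbol is a
  correlation \<open>\<phi> s = (\<Sum>x. g x * g (x s))\<close>, where \<open>g\<close> is a function with values in \<open>[0, 1]\<close> and
  \<open>(\<Sum>x. g x powr p) \<le> 1\<close> on countably many disjoint copies of the group (a \<^emph>\<open>profile\<close>; each orbit
  of a collection occupies one copy, and \<open>S_p\<close> uses a single copy). This is \<open>X_class_eq\<close>. Such a
  kernel is a Gram kernel, \<open>\<phi> (x - y) = (\<Sum>u. g_u x * g_u y)\<close>, and so \<open>M_\<phi> T\<close> is the sum of the
  operators \<open>D_u T D_u\<close> with diagonal \<open>D_u\<close>; Cauchy-Schwarz bounds its norm by
  \<open>(\<Sum>x. (g x)\<^sup>2) * norm T \<le> norm T\<close>.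

  Applied to \<open>left_regular s\<close>, a multiplier returns \<open>\<phi> s\<close> times that unitary, and a symbol
  supported on a finite set gives an operator of norm at most the sum of its absolute values.
  Hence the defect on the tube of \<open>F\<close> is small exactly if \<open>\<phi>\<close> is close to 1 on \<open>F\<close>. As profiles
  give contractions and operators of finite propagation are dense in both algebras, convergence of
  the multipliers to the identity in the strong operator topology is pointwise convergence of the
  symbols to 1 (\<open>profiles_limitin_identity\<close>).

  It remains to compare amenability with the existence of profiles whose correlation is close to 1
  on a given finite set. If there is an invariant mean, then there are Folner sets: otherwise
  finite sets grow by a factor 2 under a fixed bounded displacement, Hall's theorem produces a
  two-to-one matching of bounded displacement, and an invariant mean of total mass 1 rules that
  out (\<open>amenable_imp_Folner\<close>). The normalised indicator function of a Folner set \<open>E\<close> is a unit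
  vector for the \<open>p\<close>-norm, with correlation tending to \<open>card (E \<inter> E s\<inverse>) / card E\<close> as \<open>p\<close> tends to
  2. Conversely, a profile with correlation close to 1 is almost invariant in the 2-norm, its
  square is an almost invariant density, and a cluster point of such densities is an invariant
  mean (\<open>almost_invariant_profiles_imp_amenable\<close>).

  That the minimum is attained is a concentration-compactness argument (\<open>profiles_compact\<close>). List
  the points of the domain of each profile of a sequence by decreasing value. After passing to a
  subsequence the values converge, and any two points of the list either have an eventually
  constant relative position or drift apart. The points that stay together form the fibres of a
  limit profile. Mass may be lost in the limit, but only in the \<open>p\<close>-norm: since \<open>p < 2\<close>, small
  values contribute little to the 2-norm, uniformly, and so the correlations converge to that of
  the limit.
\<close>

section \<open>Vectors and bounded operators\<close>

lemma summable_on_of_bounded_sums: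
  fixes f :: "'a \<Rightarrow> real"
  assumes "\<And>x. 0 \<le> f x" "\<And>F. finite F \<Longrightarrow> sum f F \<le> C"
  shows "f summable_on UNIV" "infsum f UNIV \<le> C"
proof -
  show s: "f summable_on UNIV"
    by (rule nonneg_bdd_above_summable_on) (use assms in \<open>auto intro!: bdd_aboveI[of _ C]\<close>)
  show "infsum f UNIV \<le> C"
    by (rule infsum_le_finite_sums[OF s]) (use assms in auto)
qed

lemma le_of_square_le:
  fixes x c :: real
  assumes "0 \<le> x" "0 \<le> c" "x * x \<le> x * c"
  shows "x \<le> c"
  using assms by (cases "x = 0") (auto simp: mult_le_cancel_left)

text \<open>
  The bound on finite partial sums gives summability of the product as well.
\<close>
lemma real_Cauchy_Schwarz_infsum:
  fixes f g :: "'a \<Rightarrow> real"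
  assumes "(\<lambda>x. (f x)\<^sup>2) summable_on UNIV" "(\<lambda>x. (g x)\<^sup>2) summable_on UNIV"
  shows "(\<lambda>x. \<bar>f x * g x\<bar>) summable_on UNIV" "(\<lambda>x. f x * g x) summable_on UNIV"
    "(\<Sum>\<^sub>\<infinity>x. \<bar>f x * g x\<bar>) \<le> sqrt (\<Sum>\<^sub>\<infinity>x. (f x)\<^sup>2) * sqrt (\<Sum>\<^sub>\<infinity>x. (g x)\<^sup>2)"
proof -
  let ?A = "\<Sum>\<^sub>\<infinity>x. (f x)\<^sup>2" and ?B = "\<Sum>\<^sub>\<infinity>x. (g x)\<^sup>2"
  have fin: "(\<Sum>x\<in>F. \<bar>f x * g x\<bar>) \<le> sqrt ?A * sqrt ?B" if F: "finite F" for F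
  proof -
    have "(\<Sum>x\<in>F. \<bar>f x * g x\<bar>) \<le> L2_set f F * L2_set g F"
      using L2_set_mult_ineq[of f g F] by (simp add: abs_mult)
    also have "\<dots> \<le> sqrt ?A * sqrt ?B"
      unfolding L2_set_def
      by (intro mult_mono real_sqrt_le_mono finite_sum_le_infsum assms F)
        (auto intro: sum_nonneg infsum_nonneg)
    finally show ?thesis .
  qed
  show s: "(\<lambda>x. \<bar>f x * g x\<bar>) summable_on UNIV" "(\<Sum>\<^sub>\<infinity>x. \<bar>f x * g x\<bar>) \<le> sqrt ?A * sqrt ?B"
    by (rule summable_on_of_bounded_sums[OF _ fin]; simp)+
  show "(\<lambda>x. f x * g x) summable_on UNIV"
    by (rule abs_summable_summable) (use s in simp)
qed

lemma infsum_Cauchy_Schwarz: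
  fixes f g :: "'a \<Rightarrow> complex"
  assumes "(\<lambda>x. (cmod (f x))\<^sup>2) summable_on UNIV" "(\<lambda>x. (cmod (g x))\<^sup>2) summable_on UNIV"
  shows "(\<lambda>x. f x * g x) summable_on UNIV"
    "(cmod (\<Sum>\<^sub>\<infinity>x. f x * g x))\<^sup>2 \<le> (\<Sum>\<^sub>\<infinity>x. (cmod (f x))\<^sup>2) * (\<Sum>\<^sub>\<infinity>x. (cmod (g x))\<^sup>2)"
proof -
  let ?A = "\<Sum>\<^sub>\<infinity>x. (cmod (f x))\<^sup>2" and ?B = "\<Sum>\<^sub>\<infinity>x. (cmod (g x))\<^sup>2"
  have AB: "0 \<le> ?A" "0 \<le> ?B" by (auto intro: infsum_nonneg)
  have n: "\<bar>cmod (f x) * cmod (g x)\<bar> = cmod (f x * g x)" for x by (simp add: norm_mult)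
  note r = real_Cauchy_Schwarz_infsum(1,3)[OF assms, unfolded n]
  show "(\<lambda>x. f x * g x) summable_on UNIV" using r(1) by (rule abs_summable_summable)
  have "cmod (\<Sum>\<^sub>\<infinity>x. f x * g x) \<le> sqrt ?A * sqrt ?B"
    using norm_infsum_bound[OF r(1)] r(2) by (rule order_trans)
  from power_mono[OF this norm_ge_zero, of 2]
  show "(cmod (\<Sum>\<^sub>\<infinity>x. f x * g x))\<^sup>2 \<le> ?A * ?B" using AB by (simp add: power_mult_distrib)
qed

lemma ell2_summable: "(\<lambda>x. (cmod (ell2_fun f x))\<^sup>2) summable_on UNIV"
  using ell2_fun[of f] by simp

lemma norm_ell2_sq: "(norm f)\<^sup>2 = (\<Sum>\<^sub>\<infinity>x. (cmod (ell2_fun f x))\<^sup>2)"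
  unfolding norm_ell2_def by (simp add: infsum_nonneg)

lemma sum_le_norm_ell2: "finite F \<Longrightarrow> (\<Sum>x\<in>F. (cmod (ell2_fun f x))\<^sup>2) \<le> (norm f)\<^sup>2"
  unfolding norm_ell2_sq by (rule finite_sum_le_infsum) (auto simp: ell2_summable)

lemma norm_ell2_le:
  assumes "\<And>F. finite F \<Longrightarrow> (\<Sum>x\<in>F. (cmod (ell2_fun f x))\<^sup>2) \<le> C"
  shows "(norm f)\<^sup>2 \<le> C"
  unfolding norm_ell2_sq by (rule summable_on_of_bounded_sums[OF _ assms]) auto

lemma cmod_ell2_le: "cmod (ell2_fun f x) \<le> norm f"
  using sum_le_norm_ell2[of "{x}" f] by (auto intro: power2_le_imp_le)

lemma ell2_eqI: "(\<And>x. ell2_fun f x = ell2_fun g x) \<Longrightarrow> f = g"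
  by (simp add: fun_eq_iff flip: ell2_fun_inject)

lemma ell2_fun_Abs:
  assumes "\<And>F. finite F \<Longrightarrow> (\<Sum>x\<in>F. (cmod (h x))\<^sup>2) \<le> C"
  shows "ell2_fun (Abs_ell2 h) = h"
  by (rule Abs_ell2_inverse) (use summable_on_of_bounded_sums(1)[OF _ assms] in simp)

lemma ell2_fun_sum: "ell2_fun (sum h F) x = (\<Sum>i\<in>F. ell2_fun (h i) x)"
  by (induction F rule: infinite_finite_induct) (auto simp: zero_ell2.rep_eq plus_ell2.rep_eq)

lemma cinner_delta: "cinner (delta x) f = ell2_fun f x"
proof -
  have "cinner (delta x) f = (\<Sum>\<^sub>\<infinity>y\<in>{x}. ell2_fun f y)"
    unfolding cinner_def by (rule infsum_cong_neutral) (auto simp: delta.rep_eq)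
  then show ?thesis by simp
qed

lemma entry_eq: "entry T x y = ell2_fun (T (delta y)) x"
  by (simp add: entry_def cinner_delta)

lemma norm_delta: "norm (delta x) = 1"
proof -
  have "(norm (delta x))\<^sup>2 = (\<Sum>\<^sub>\<infinity>y\<in>{x}. 1)"
    unfolding norm_ell2_sq by (rule infsum_cong_neutral) (auto simp: delta.rep_eq)
  then show ?thesis using power2_eq_imp_eq[of "norm (delta x)" 1] by simp
qed

lemma cmod_entry_le: "cmod (entry T x y) \<le> norm T"
  using cmod_ell2_le[of "T (delta y)" x] norm_blinfun[of T "delta y"]
  by (simp add: entry_eq norm_delta)

lemma cscale_op_apply [simp]: "cscale_op c f = ell2_cscale c f"
  by (simp add: cscale_op.rep_eq)

lemma norm_ell2_cscale: "norm (ell2_cscale c f) = cmod c * norm f"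
  by (simp add: norm_ell2_def ell2_cscale.rep_eq norm_mult power_mult_distrib
        infsum_cmult_right' real_sqrt_mult)

lemma ell2_cscale_simps:
  "ell2_cscale c (f + g) = ell2_cscale c f + ell2_cscale c g"
  "ell2_cscale c (f - g) = ell2_cscale c f - ell2_cscale c g"
  "ell2_cscale c 0 = 0"
  "ell2_cscale c (sum h F) = (\<Sum>i\<in>F. ell2_cscale c (h i))"
  "ell2_cscale c (ell2_cscale d f) = ell2_cscale (c * d) f"
  "ell2_cscale (of_real r) f = r *\<^sub>R f"
  by (rule ell2_eqI, simp add: ell2_cscale.rep_eq plus_ell2.rep_eq minus_ell2.rep_eq
      zero_ell2.rep_eq scaleR_ell2.rep_eq ell2_fun_sum algebra_simps sum_distrib_left)+

lemma ell2_approx_finite_support: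
  assumes "0 < e"
  shows "\<exists>F. finite F \<and> norm (f - (\<Sum>x\<in>F. ell2_cscale (ell2_fun f x) (delta x))) < e"
proof -
  have "0 < e\<^sup>2 / 4" using assms by simp
  from infsum_finite_approximation[OF ell2_summable[of f] this]
  obtain F where F: "finite F"
      "dist (\<Sum>x\<in>F. (cmod (ell2_fun f x))\<^sup>2) (\<Sum>\<^sub>\<infinity>x. (cmod (ell2_fun f x))\<^sup>2) \<le> e\<^sup>2 / 4"
    by blast
  let ?g = "f - (\<Sum>x\<in>F. ell2_cscale (ell2_fun f x) (delta x))"
  have g: "ell2_fun ?g x = (if x \<in> F then 0 else ell2_fun f x)" for x
    using F(1) by (simp add: minus_ell2.rep_eq ell2_fun_sum ell2_cscale.rep_eq delta.rep_eq
        if_distrib[of "\<lambda>u. _ * u"] sum.delta cong: if_cong)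
  have "(norm ?g)\<^sup>2 \<le> e\<^sup>2 / 4"
  proof (rule norm_ell2_le)
    fix G :: "'a set" assume G: "finite G"
    have "(\<Sum>x\<in>G. (cmod (ell2_fun ?g x))\<^sup>2) = (\<Sum>x\<in>G - F. (cmod (ell2_fun f x))\<^sup>2)"
      unfolding g using G by (intro sum.mono_neutral_cong_right) auto
    moreover have "(\<Sum>x\<in>G - F. (cmod (ell2_fun f x))\<^sup>2) + (\<Sum>x\<in>F. (cmod (ell2_fun f x))\<^sup>2)
        = (\<Sum>x\<in>(G - F) \<union> F. (cmod (ell2_fun f x))\<^sup>2)"
      using G F by (intro sum.union_disjoint[symmetric]) auto
    moreover have "(\<Sum>x\<in>(G - F) \<union> F. (cmod (ell2_fun f x))\<^sup>2) \<le> (norm f)\<^sup>2"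
      using G F by (intro sum_le_norm_ell2) auto
    moreover have "(norm f)\<^sup>2 - (\<Sum>x\<in>F. (cmod (ell2_fun f x))\<^sup>2) \<le> e\<^sup>2 / 4"
      using F(2) by (simp only: dist_real_def norm_ell2_sq)
    ultimately show "(\<Sum>x\<in>G. (cmod (ell2_fun ?g x))\<^sup>2) \<le> e\<^sup>2 / 4"
      by linarith
  qed
  also have "\<dots> < e\<^sup>2" using assms by simp
  finally have "norm ?g < e" using assms by (simp add: power2_less_imp_less)
  with F(1) show ?thesis by blast
qed

text \<open>
  Finitely supported vectors are dense; this is the form in which density is used below.
\<close>
lemma ell2_closed_induct:
  assumes "closed S" "\<And>F c. finite F \<Longrightarrow> (\<Sum>x\<in>F. ell2_cscale (c x) (delta x)) \<in> S"
  shows "f \<in> S"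
proof -
  have "f \<in> closure S"
    unfolding closure_approachable
  proof safe
    fix e :: real assume "0 < e"
    from ell2_approx_finite_support[OF this, of f] obtain F where F: "finite F"
      "norm (f - (\<Sum>x\<in>F. ell2_cscale (ell2_fun f x) (delta x))) < e" by blast
    then show "\<exists>y\<in>S. dist y f < e"
      using assms(2)[OF F(1)] by (metis dist_commute dist_norm)
  qed
  then show ?thesis using assms(1) by simp
qed

lemma bopD: "T \<in> bop \<Longrightarrow> T (ell2_cscale c f) = ell2_cscale c (T f)"
  by (auto simp: bop_def)

lemma bop_ext:
  assumes S: "S \<in> bop" and T: "T \<in> bop" and "\<And>x y. entry S x y = entry T x y"
  shows "S = T"
proof (rule blinfun_eqI)
  fix f
  have cl: "closed {f. S f = T f}"
    by (intro closed_Collect_eq continuous_intros)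
  have eq: "S (delta y) = T (delta y)" for y
    using assms(3) by (auto intro!: ell2_eqI simp: entry_eq)
  have "f \<in> {f. S f = T f}"
    by (rule ell2_closed_induct[OF cl]) (simp add: blinfun.sum_right bopD[OF S] bopD[OF T] eq)
  then show "S f = T f" by simp
qed

lemma bop_0: "0 \<in> bop"
  by (simp add: bop_def ell2_cscale_simps)

lemma bop_add: "S \<in> bop \<Longrightarrow> T \<in> bop \<Longrightarrow> S + T \<in> bop"
  by (simp add: bop_def blinfun.add_left ell2_cscale_simps)

lemma bop_diff: "S \<in> bop \<Longrightarrow> T \<in> bop \<Longrightarrow> S - T \<in> bop"
  by (simp add: bop_def blinfun.diff_left ell2_cscale_simps)

lemma bop_compose: "S \<in> bop \<Longrightarrow> T \<in> bop \<Longrightarrow> S o\<^sub>L T \<in> bop"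
  by (simp add: bop_def)

lemma bop_cscale_op: "cscale_op c \<in> bop"
  by (simp add: bop_def ell2_cscale_simps mult.commute)

lemma bop_sum: "(\<And>i. i \<in> I \<Longrightarrow> T i \<in> bop) \<Longrightarrow> sum T I \<in> bop"
  by (induction I rule: infinite_finite_induct) (auto intro: bop_0 bop_add)

lemma cscale_op_of_real: "cscale_op (of_real r) o\<^sub>L T = r *\<^sub>R T"
  by (rule blinfun_eqI) (simp add: ell2_cscale_simps blinfun.scaleR_left)

lemma bop_scaleR: "T \<in> bop \<Longrightarrow> r *\<^sub>R T \<in> bop"
  using bop_compose[OF bop_cscale_op[of "of_real r"]] by (simp add: cscale_op_of_real)

lemma norm_cscale_op_compose_le: "norm (cscale_op c o\<^sub>L T) \<le> cmod c * norm T"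
  by (rule norm_blinfun_bound)
    (auto simp: norm_ell2_cscale mult.assoc intro!: mult_left_mono norm_blinfun)

lemma closed_bop: "closed (bop :: 'g op set)"
proof -
  have "closed {T :: 'g op. T (ell2_cscale c f) = ell2_cscale c (T f)}" for c f
    unfolding cscale_op_apply[symmetric] by (intro closed_Collect_eq continuous_intros)
  moreover have "(bop :: 'g op set) = (\<Inter>c. \<Inter>f. {T :: 'g op. T (ell2_cscale c f) = ell2_cscale c (T f)})"
    by (auto simp: bop_def)
  ultimately show ?thesis by (metis (no_types, lifting) closed_INT)
qed

lemma entry_simps:
  "entry (S + T) x y = entry S x y + entry T x y"
  "entry (S - T) x y = entry S x y - entry T x y"
  "entry 0 x y = 0"
  "entry (cscale_op c o\<^sub>L T) x y = c * entry T x y"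
  "entry (r *\<^sub>R T) x y = of_real r * entry T x y"
  by (simp_all add: entry_eq blinfun.add_left blinfun.diff_left plus_ell2.rep_eq minus_ell2.rep_eq
      zero_ell2.rep_eq ell2_cscale.rep_eq blinfun.scaleR_left scaleR_ell2.rep_eq)

lemma entry_sum: "entry (sum T I) x y = (\<Sum>i\<in>I. entry (T i) x y)"
  by (simp add: entry_eq blinfun.sum_left ell2_fun_sum)

lemma is_adjoint_iff_inner:
  assumes S: "S \<in> bop" and T: "T \<in> bop"
  shows "is_adjoint S T \<longleftrightarrow> (\<forall>f g. inner (S f) g = inner f (T g))"
proof
  assume *: "\<forall>f g. inner (S f) g = inner f (T g)"
  have im: "Im (cinner f g) = inner (ell2_cscale \<i> f) g" for f g :: "'a ell2"
  proof -
    have "cinner (ell2_cscale \<i> f) g = - \<i> * cinner f g"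
      unfolding cinner_def ell2_cscale.rep_eq
      by (subst infsum_cmult_right'[symmetric]) (simp add: mult.assoc)
    then show ?thesis by (simp add: inner_ell2_def)
  qed
  show "is_adjoint S T"
    unfolding is_adjoint_def
  proof (intro allI complex_eqI)
    fix f g
    show "Re (cinner (S f) g) = Re (cinner f (T g))"
      using * by (simp add: inner_ell2_def)
    show "Im (cinner (S f) g) = Im (cinner f (T g))"
      unfolding im using * by (simp flip: bopD[OF S])
  qed
qed (simp add: is_adjoint_def inner_ell2_def)

text \<open>
  The identity \<open>(norm (S g))\<^sup>2 = inner (T (S g)) g\<close> suffices. It makes taking adjoints continuous,
  which is needed to see that the closure of the group ring is closed under adjoints.
\<close>
lemma norm_le_of_inner_adjoint:
  fixes S T :: "'g op"
  assumes "\<And>f g. inner (T f) g = inner f (S g)"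
  shows "norm S \<le> norm T"
proof (rule norm_blinfun_bound)
  fix g
  have "(norm (S g))\<^sup>2 = inner (T (S g)) g" by (simp add: assms power2_norm_eq_inner)
  also have "\<dots> \<le> norm (T (S g)) * norm g" by (rule norm_cauchy_schwarz)
  also have "\<dots> \<le> norm T * norm (S g) * norm g" by (intro mult_right_mono norm_blinfun) auto
  finally have "norm (S g) * norm (S g) \<le> norm (S g) * (norm T * norm g)"
    by (simp add: power2_eq_square ac_simps)
  then show "norm (S g) \<le> norm T * norm g"
    by (rule le_of_square_le[rotated 2]) auto
qed simp

text \<open>
  Completeness of the Hilbert space in the form in which it is needed: a linear family of
  coordinate functions with a uniform bound on finite partial sums is an operator.
\<close>
lemma operator_of_coordinates:
  fixes s :: "'g ell2 \<Rightarrow> 'g \<Rightarrow> complex"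
  assumes add: "\<And>g h x. s (g + h) x = s g x + s h x"
    and scale: "\<And>c h x. s (ell2_cscale c h) x = c * s h x"
    and bd: "\<And>F h. finite F \<Longrightarrow> (\<Sum>x\<in>F. (cmod (s h x))\<^sup>2) \<le> (c * norm h)\<^sup>2" and c: "0 \<le> c"
  obtains S where "S \<in> bop" "\<And>h x. ell2_fun (blinfun_apply S h) x = s h x" "norm S \<le> c"
proof -
  have sf: "ell2_fun (Abs_ell2 (s h)) = s h" for h by (rule ell2_fun_Abs[OF bd])
  have le: "norm (Abs_ell2 (s h)) \<le> c * norm h" for h
  proof (rule power2_le_imp_le)
    show "(norm (Abs_ell2 (s h)))\<^sup>2 \<le> (c * norm h)\<^sup>2" by (rule norm_ell2_le) (simp only: sf bd)
  qed (use c in simp)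
  have lin: "bounded_linear (\<lambda>h. Abs_ell2 (s h))"
  proof (rule bounded_linear_intro)
    fix g h :: "'g ell2" and r :: real
    show "Abs_ell2 (s (g + h)) = Abs_ell2 (s g) + Abs_ell2 (s h)"
      by (rule ell2_eqI) (simp add: sf plus_ell2.rep_eq add)
    show "Abs_ell2 (s (r *\<^sub>R h)) = r *\<^sub>R Abs_ell2 (s h)"
      by (rule ell2_eqI) (simp add: sf scale ell2_cscale.rep_eq flip: ell2_cscale_simps(6))
    show "norm (Abs_ell2 (s h)) \<le> norm h * c" using le by (simp only: mult.commute)
  qed
  define S where "S = Blinfun (\<lambda>h. Abs_ell2 (s h))"
  have S: "blinfun_apply S h = Abs_ell2 (s h)" for h
    unfolding S_def by (simp add: bounded_linear_Blinfun_apply[OF lin])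
  show thesis
  proof (rule that)
    show "S \<in> bop" by (auto simp: bop_def S sf scale ell2_cscale.rep_eq intro!: ell2_eqI)
    show "ell2_fun (blinfun_apply S h) x = s h x" for h x by (simp add: S sf)
    show "norm S \<le> c" using c le by (intro norm_blinfun_bound) (auto simp: S)
  qed
qed

text \<open>
  The value of the adjoint at \<open>g\<close> has to be \<open>x \<mapsto> cinner (T (delta x)) g\<close>. This function is
  square-summable by duality: pairing \<open>g\<close> with the image under \<open>T\<close> of a finite truncation \<open>h\<close> of
  it gives \<open>(norm h)\<^sup>2 \<le> norm T * norm h * norm g\<close>.
\<close>
lemma exists_adjoint:
  assumes T: "T \<in> bop"
  shows "\<exists>S\<in>bop. is_adjoint T S"
proof -
  define s where "s g x = cinner (T (delta x)) g" for g x
  have cs: "cmod (s g x) \<le> norm (T (delta x)) * norm g" for g x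
  proof -
    have "(cmod (s g x))\<^sup>2 \<le> (norm (T (delta x)))\<^sup>2 * (norm g)\<^sup>2"
      unfolding s_def cinner_def norm_ell2_sq
      using infsum_Cauchy_Schwarz(2)[of "\<lambda>y. cnj (ell2_fun (T (delta x)) y)" "ell2_fun g"]
      by (simp add: ell2_summable)
    then have "(cmod (s g x))\<^sup>2 \<le> (norm (T (delta x)) * norm g)\<^sup>2"
      by (simp only: power_mult_distrib)
    then show ?thesis by (rule power2_le_imp_le) simp
  qed
  have cinner_cscale_left: "cinner (ell2_cscale c f) g = cnj c * cinner f g" for c and f g :: "'a ell2"
    unfolding cinner_def ell2_cscale.rep_eq by (simp add: mult.assoc flip: infsum_cmult_right')
  have cinner_cscale_right: "cinner f (ell2_cscale c g) = c * cinner f g" for c and f g :: "'a ell2"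
    by (subst (1 2) cinner_commute) (simp add: cinner_cscale_left)
  have cinner_zero_left: "cinner 0 g = 0" for g :: "'a ell2"
    by (simp add: cinner_def zero_ell2.rep_eq)
  have cinner_sum_left: "cinner (sum h F) g = (\<Sum>i\<in>F. cinner (h i) g)"
    for h :: "'a \<Rightarrow> 'a ell2" and F and g :: "'a ell2"
    by (induction F rule: infinite_finite_induct) (auto simp: cinner_add_left cinner_zero_left)
  have cinner_add_right: "cinner f (g + h) = cinner f g + cinner f h" for f g h :: "'a ell2"
    by (subst (1 2 3) cinner_commute) (simp add: cinner_add_left)
  have bd: "(\<Sum>x\<in>F. (cmod (s g x))\<^sup>2) \<le> (norm T * norm g)\<^sup>2" if F: "finite F" for F g
  proof -
    define h where "h = (\<Sum>x\<in>F. ell2_cscale (s g x) (delta x))"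
    have hx: "ell2_fun h x = (if x \<in> F then s g x else 0)" for x
      using F by (simp add: h_def ell2_fun_sum ell2_cscale.rep_eq delta.rep_eq
        if_distrib[of "\<lambda>u. _ * u"] sum.delta cong: if_cong)
    have nh: "(norm h)\<^sup>2 = (\<Sum>x\<in>F. (cmod (s g x))\<^sup>2)"
    proof -
      have "(norm h)\<^sup>2 = (\<Sum>\<^sub>\<infinity>x\<in>F. (cmod (s g x))\<^sup>2)"
        unfolding norm_ell2_sq by (rule infsum_cong_neutral) (auto simp: hx)
      then show ?thesis using F by simp
    qed
    have "cinner (T h) g = (\<Sum>x\<in>F. cnj (s g x) * s g x)"
      unfolding h_def by (simp add: blinfun.sum_right bopD[OF T] cinner_sum_left cinner_cscale_left
        s_def[symmetric])
    also have "\<dots> = of_real ((norm h)\<^sup>2)"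
      unfolding nh by (simp add: complex_norm_square mult.commute del: of_real_power)
    finally have "(norm h)\<^sup>2 = inner (T h) g" by (simp add: inner_ell2_def)
    also have "\<dots> \<le> norm (T h) * norm g" by (rule norm_cauchy_schwarz)
    also have "\<dots> \<le> norm T * norm h * norm g" by (intro mult_right_mono norm_blinfun) auto
    finally have "norm h * norm h \<le> norm h * (norm T * norm g)"
      by (simp add: power2_eq_square ac_simps)
    then have "norm h \<le> norm T * norm g"
      by (rule le_of_square_le[rotated 2]) auto
    then show ?thesis unfolding nh[symmetric] by (intro power_mono) auto
  qed
  obtain S where S: "S \<in> bop" "\<And>g x. ell2_fun (blinfun_apply S g) x = s g x"
    by (rule operator_of_coordinates[OF _ _ bd]) (auto simp: s_def cinner_add_right cinner_cscale_right)
  have "inner (T f) g = inner f (S g)" for f g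
  proof -
    have cl: "closed {f. inner (T f) g = inner f (S g)}"
      by (intro closed_Collect_eq continuous_intros)
    have "f \<in> {f. inner (T f) g = inner f (S g)}"
      by (rule ell2_closed_induct[OF cl])
        (simp add: inner_ell2_def blinfun.sum_right bopD[OF T] cinner_sum_left cinner_cscale_left
          cinner_delta S(2) s_def[symmetric])
    then show ?thesis by simp
  qed
  then have "is_adjoint T S" using is_adjoint_iff_inner[OF T S(1)] by blast
  with S(1) show ?thesis by blast
qed

section \<open>Schur products with Gram kernels\<close>

lemma infsum_finite_sum:
  fixes f :: "'i \<Rightarrow> 'a \<Rightarrow> real"
  assumes "finite I" "\<And>i. i \<in> I \<Longrightarrow> f i summable_on A"
  shows "(\<lambda>x. \<Sum>i\<in>I. f i x) summable_on A" "infsum (\<lambda>x. \<Sum>i\<in>I. f i x) A = (\<Sum>i\<in>I. infsum (f i) A)"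
proof -
  have "(\<lambda>x. \<Sum>i\<in>I. f i x) summable_on A \<and> infsum (\<lambda>x. \<Sum>i\<in>I. f i x) A = (\<Sum>i\<in>I. infsum (f i) A)"
    using assms by (induction I) (auto simp: infsum_add summable_on_add)
  then show "(\<lambda>x. \<Sum>i\<in>I. f i x) summable_on A"
    "infsum (\<lambda>x. \<Sum>i\<in>I. f i x) A = (\<Sum>i\<in>I. infsum (f i) A)" by auto
qed

text \<open>
  The Schur product with a Gram kernel is \<open>(\<Sum>u. A_u T B_u)\<close>, where \<open>A_u\<close> and \<open>B_u\<close> are the
  diagonal operators with entries \<open>a u x\<close> and \<open>b u y\<close>. Defining its value at \<open>h\<close> coordinatewise
  avoids any question of convergence in the operator norm: for a fixed coordinate \<open>x\<close> the sum over
  \<open>u\<close> converges by Cauchy-Schwarz, and the squares of the coordinates add up to at most \<open>Ca\<close> times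
  \<open>(\<Sum>u. (norm (T (B_u h)))\<^sup>2) \<le> (norm T)\<^sup>2 * Cb * (norm h)\<^sup>2\<close>.
\<close>
lemma gram_schur_product:
  fixes a b :: "'i \<Rightarrow> 'g \<Rightarrow> complex"
  assumes a: "\<And>x. (\<lambda>u. (cmod (a u x))\<^sup>2) summable_on UNIV" "\<And>x. (\<Sum>\<^sub>\<infinity>u. (cmod (a u x))\<^sup>2) \<le> Ca"
    and b: "\<And>y. (\<lambda>u. (cmod (b u y))\<^sup>2) summable_on UNIV" "\<And>y. (\<Sum>\<^sub>\<infinity>u. (cmod (b u y))\<^sup>2) \<le> Cb"
    and T: "T \<in> bop"
  shows "\<exists>S. is_schur_product (\<lambda>(x, y). \<Sum>\<^sub>\<infinity>u. a u x * b u y) T S \<and> norm S \<le> sqrt (Ca * Cb) * norm T"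
proof -
  have Ca0: "0 \<le> Ca" using a(2)[of undefined] by (meson infsum_nonneg order_trans zero_le_power2)
  have Cb0: "0 \<le> Cb" using b(2)[of undefined] by (meson infsum_nonneg order_trans zero_le_power2)
  have bU: "(\<Sum>u\<in>U. (cmod (b u y))\<^sup>2) \<le> Cb" if "finite U" for U y
    using finite_sum_le_infsum[OF b(1) that] b(2)[of y] by (meson order_trans zero_le_power2 subset_UNIV)
  have bsq: "(cmod (b u y))\<^sup>2 \<le> Cb" for u y using bU[of "{u}"] by simp
  \<comment> \<open>the diagonal operator \<open>B_u\<close>\<close>
  define D where "D u h = Abs_ell2 (\<lambda>y. b u y * ell2_fun h y)" for u h
  have Dbd: "(\<Sum>y\<in>F. (cmod (b u y * ell2_fun h y))\<^sup>2) \<le> Cb * (norm h)\<^sup>2" if F: "finite F" for F u h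
  proof -
    have "(\<Sum>y\<in>F. (cmod (b u y * ell2_fun h y))\<^sup>2) \<le> (\<Sum>y\<in>F. Cb * (cmod (ell2_fun h y))\<^sup>2)"
      by (intro sum_mono) (simp add: norm_mult power_mult_distrib mult_right_mono bsq)
    also have "\<dots> \<le> Cb * (norm h)\<^sup>2"
      unfolding sum_distrib_left[symmetric] by (intro mult_left_mono sum_le_norm_ell2 F Cb0)
    finally show ?thesis .
  qed
  have D: "ell2_fun (D u h) y = b u y * ell2_fun h y" for u h y
    unfolding D_def by (subst ell2_fun_Abs[OF Dbd]) auto
  have DU: "(\<Sum>u\<in>U. (norm (D u h))\<^sup>2) \<le> Cb * (norm h)\<^sup>2" if U: "finite U" for U h
  proof -
    have "(\<Sum>u\<in>U. (norm (D u h))\<^sup>2) = (\<Sum>\<^sub>\<infinity>y. \<Sum>u\<in>U. (cmod (ell2_fun (D u h) y))\<^sup>2)"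
      unfolding norm_ell2_sq using U by (subst infsum_finite_sum(2)) (auto simp: ell2_summable)
    also have "\<dots> \<le> (\<Sum>\<^sub>\<infinity>y. Cb * (cmod (ell2_fun h y))\<^sup>2)"
    proof (rule infsum_mono)
      show "(\<lambda>y. \<Sum>u\<in>U. (cmod (ell2_fun (D u h) y))\<^sup>2) summable_on UNIV"
        using U by (intro infsum_finite_sum ell2_summable)
      show "(\<lambda>y. Cb * (cmod (ell2_fun h y))\<^sup>2) summable_on UNIV"
        by (intro summable_on_cmult_right ell2_summable)
      show "(\<Sum>u\<in>U. (cmod (ell2_fun (D u h) y))\<^sup>2) \<le> Cb * (cmod (ell2_fun h y))\<^sup>2" for y
        by (simp add: D norm_mult power_mult_distrib mult_right_mono bU[OF U] flip: sum_distrib_right)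
    qed
    also have "\<dots> = Cb * (norm h)\<^sup>2" unfolding norm_ell2_sq by (rule infsum_cmult_right')
    finally show ?thesis .
  qed
  \<comment> \<open>the coordinates of \<open>T (B_u h)\<close>\<close>
  define E where "E u h x = ell2_fun (T (D u h)) x" for u h x
  have EU: "(\<Sum>u\<in>U. \<Sum>x\<in>X. (cmod (E u h x))\<^sup>2) \<le> Cb * (norm T * norm h)\<^sup>2"
    if U: "finite U" and X: "finite X" for U X h
  proof -
    have "(\<Sum>u\<in>U. \<Sum>x\<in>X. (cmod (E u h x))\<^sup>2) \<le> (\<Sum>u\<in>U. (norm T)\<^sup>2 * (norm (D u h))\<^sup>2)"
    proof (rule sum_mono)
      fix u
      have "(\<Sum>x\<in>X. (cmod (E u h x))\<^sup>2) \<le> (norm (T (D u h)))\<^sup>2"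
        unfolding E_def by (rule sum_le_norm_ell2[OF X])
      also have "\<dots> \<le> (norm T * norm (D u h))\<^sup>2"
        by (intro power_mono norm_blinfun) auto
      finally show "(\<Sum>x\<in>X. (cmod (E u h x))\<^sup>2) \<le> (norm T)\<^sup>2 * (norm (D u h))\<^sup>2"
        by (simp add: power_mult_distrib)
    qed
    also have "\<dots> \<le> (norm T)\<^sup>2 * (Cb * (norm h)\<^sup>2)"
      unfolding sum_distrib_left[symmetric] by (intro mult_left_mono DU U) auto
    finally show ?thesis by (simp add: power_mult_distrib ac_simps)
  qed
  have Es: "(\<lambda>u. (cmod (E u h x))\<^sup>2) summable_on UNIV" for h x
    by (rule summable_on_of_bounded_sums[where C = "Cb * (norm T * norm h)\<^sup>2"])
      (use EU[of _ "{x}"] in auto)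
  define s where "s h x = (\<Sum>\<^sub>\<infinity>u. a u x * E u h x)" for h x
  have cs: "(cmod (s h x))\<^sup>2 \<le> Ca * (\<Sum>\<^sub>\<infinity>u. (cmod (E u h x))\<^sup>2)" for h x
    using infsum_Cauchy_Schwarz(2)[OF a(1)[of x] Es[of h x]] a(2)[of x]
    unfolding s_def by (meson infsum_nonneg mult_right_mono order_trans zero_le_power2)
  have sums: "(\<lambda>u. a u x * E u h x) summable_on UNIV" for h x
    by (rule infsum_Cauchy_Schwarz(1)[OF a(1) Es])
  have bd: "(\<Sum>x\<in>X. (cmod (s h x))\<^sup>2) \<le> (sqrt (Ca * Cb) * norm T * norm h)\<^sup>2" if X: "finite X" for X h
  proof -
    have "(\<Sum>x\<in>X. (cmod (s h x))\<^sup>2) \<le> Ca * (\<Sum>x\<in>X. \<Sum>\<^sub>\<infinity>u. (cmod (E u h x))\<^sup>2)"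
      unfolding sum_distrib_left by (intro sum_mono cs)
    also have "(\<Sum>x\<in>X. \<Sum>\<^sub>\<infinity>u. (cmod (E u h x))\<^sup>2) = (\<Sum>\<^sub>\<infinity>u. \<Sum>x\<in>X. (cmod (E u h x))\<^sup>2)"
      using X by (subst infsum_finite_sum(2)) (auto simp: Es)
    also have "Ca * \<dots> \<le> Ca * (Cb * (norm T * norm h)\<^sup>2)"
      by (intro mult_left_mono summable_on_of_bounded_sums Ca0) (auto intro: EU X sum_nonneg)
    also have "\<dots> = (sqrt (Ca * Cb) * norm T * norm h)\<^sup>2"
      using Ca0 Cb0 by (simp add: power_mult_distrib)
    finally show ?thesis .
  qed
  have E_add: "E u (h + k) x = E u h x + E u k x" for u h k x
  proof -
    have "D u (h + k) = D u h + D u k"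
      by (rule ell2_eqI) (simp add: D plus_ell2.rep_eq algebra_simps)
    then show ?thesis by (simp add: E_def blinfun.add_right plus_ell2.rep_eq)
  qed
  have E_scale: "E u (ell2_cscale c h) x = c * E u h x" for u c h x
  proof -
    have "D u (ell2_cscale c h) = ell2_cscale c (D u h)"
      by (rule ell2_eqI) (simp add: D ell2_cscale.rep_eq)
    then show ?thesis by (simp add: E_def bopD[OF T] ell2_cscale.rep_eq)
  qed
  have s_add: "s (h + k) x = s h x + s k x" for h k x
    unfolding s_def E_add distrib_left by (rule infsum_add[OF sums sums])
  have s_scale: "s (ell2_cscale c h) x = c * s h x" for c h x
    unfolding s_def E_scale by (simp add: mult.left_commute infsum_cmult_right')
  obtain S where S: "S \<in> bop" "\<And>h x. ell2_fun (blinfun_apply S h) x = s h x"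
      "norm S \<le> sqrt (Ca * Cb) * norm T"
    by (rule operator_of_coordinates[OF s_add s_scale bd]) (use Ca0 Cb0 in auto)
  have "entry S x y = (\<Sum>\<^sub>\<infinity>u. a u x * b u y) * entry T x y" for x y
  proof -
    have "D u (delta y) = ell2_cscale (b u y) (delta y)" for u
      by (rule ell2_eqI) (simp add: D ell2_cscale.rep_eq delta.rep_eq)
    then have "E u (delta y) x = b u y * entry T x y" for u
      by (simp add: E_def bopD[OF T] ell2_cscale.rep_eq entry_eq)
    then show ?thesis
      by (simp add: entry_eq S(2) s_def infsum_cmult_left' flip: mult.assoc)
  qed
  then show ?thesis using S by (auto simp: is_schur_product_def)
qed

section \<open>Multipliers given by functions on the group\<close>

text \<open>
  A bound on all bounded operators, not only on the algebra under consideration: it is inherited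
  by every algebra, and it is what the well-definedness of a Schur multiplier requires.
\<close>
definition multiplier_bound :: "('g::group_add \<Rightarrow> complex) \<Rightarrow> real \<Rightarrow> bool" where
  "multiplier_bound \<phi> C \<longleftrightarrow> 0 \<le> C \<and>
     (\<forall>T\<in>bop. \<exists>S. is_schur_product (kernel_of \<phi>) T S \<and> norm S \<le> C * norm T)"

definition schur_mult :: "('g::group_add \<Rightarrow> complex) \<Rightarrow> 'g op \<Rightarrow> 'g op" where
  "schur_mult \<phi> T = (THE S. is_schur_product (kernel_of \<phi>) T S)"

lemma is_schur_product_unique:
  "is_schur_product k T S \<Longrightarrow> is_schur_product k T S' \<Longrightarrow> S = S'"
  by (auto simp: is_schur_product_def intro: bop_ext)

lemma multiplier_bound_nonneg: "multiplier_bound \<phi> C \<Longrightarrow> 0 \<le> C"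
  by (simp add: multiplier_bound_def)

lemma
  assumes "multiplier_bound \<phi> C" "T \<in> bop"
  shows schur_mult_bop: "schur_mult \<phi> T \<in> bop"
    and entry_schur_mult: "entry (schur_mult \<phi> T) x y = \<phi> (x - y) * entry T x y"
    and norm_schur_mult_le: "norm (schur_mult \<phi> T) \<le> C * norm T"
proof -
  obtain S where S: "is_schur_product (kernel_of \<phi>) T S" "norm S \<le> C * norm T"
    using assms by (auto simp: multiplier_bound_def)
  then have "schur_mult \<phi> T = S"
    unfolding schur_mult_def by (auto intro: is_schur_product_unique)
  with S show "schur_mult \<phi> T \<in> bop" "entry (schur_mult \<phi> T) x y = \<phi> (x - y) * entry T x y"
      "norm (schur_mult \<phi> T) \<le> C * norm T"
    by (auto simp: is_schur_product_def kernel_of_def)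
qed

lemma schur_mult_eqI:
  assumes "S \<in> bop" "\<And>x y. entry S x y = \<phi> (x - y) * entry T x y"
  shows "schur_mult \<phi> T = S"
  unfolding schur_mult_def
  by (rule the_equality)
    (use assms in \<open>auto simp: is_schur_product_def kernel_of_def intro!: bop_ext\<close>)

lemma multiplier_boundI:
  assumes "0 \<le> C"
    and "\<And>T. T \<in> bop \<Longrightarrow> \<exists>S\<in>bop. (\<forall>x y. entry S x y = \<phi> (x - y) * entry T x y) \<and> norm S \<le> C * norm T"
  shows "multiplier_bound \<phi> C"
  using assms by (fastforce simp: multiplier_bound_def is_schur_product_def kernel_of_def)

lemma multiplier_bound_add:
  assumes "multiplier_bound \<phi> C" "multiplier_bound \<psi> D"
  shows "multiplier_bound (\<lambda>s. \<phi> s + \<psi> s) (C + D)"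
proof (rule multiplier_boundI)
  show "0 \<le> C + D" using assms by (simp add: multiplier_bound_nonneg)
  fix T :: "'a op" assume T: "T \<in> bop"
  have "norm (schur_mult \<phi> T + schur_mult \<psi> T) \<le> (C + D) * norm T"
    using norm_schur_mult_le[OF assms(1) T] norm_schur_mult_le[OF assms(2) T]
    by (intro norm_triangle_le) (simp add: algebra_simps)
  then show "\<exists>S\<in>bop. (\<forall>x y. entry S x y = (\<phi> (x - y) + \<psi> (x - y)) * entry T x y)
      \<and> norm S \<le> (C + D) * norm T"
    using assms T by (intro bexI[of _ "schur_mult \<phi> T + schur_mult \<psi> T"])
      (auto simp: entry_simps entry_schur_mult algebra_simps intro: bop_add schur_mult_bop)
qed

lemma multiplier_bound_scale:
  assumes "multiplier_bound \<phi> C"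
  shows "multiplier_bound (\<lambda>s. c * \<phi> s) (cmod c * C)"
proof (rule multiplier_boundI)
  show "0 \<le> cmod c * C" using assms by (simp add: multiplier_bound_nonneg)
  fix T :: "'a op" assume T: "T \<in> bop"
  have "norm (cscale_op c o\<^sub>L schur_mult \<phi> T) \<le> cmod c * norm (schur_mult \<phi> T)"
    by (rule norm_cscale_op_compose_le)
  also have "\<dots> \<le> cmod c * C * norm T"
    using norm_schur_mult_le[OF assms T] by (simp add: mult.assoc mult_left_mono)
  finally show "\<exists>S\<in>bop. (\<forall>x y. entry S x y = c * \<phi> (x - y) * entry T x y)
      \<and> norm S \<le> cmod c * C * norm T"
    using assms T by (intro bexI[of _ "cscale_op c o\<^sub>L schur_mult \<phi> T"])
      (auto simp: entry_simps entry_schur_mult intro: bop_compose bop_cscale_op schur_mult_bop)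
qed

lemma multiplier_bound_0: "multiplier_bound (\<lambda>_. 0) 0"
  by (rule multiplier_boundI) (auto intro!: bexI[of _ 0] simp: entry_simps bop_0)

lemma multiplier_bound_sum:
  assumes "finite I" "\<And>i. i \<in> I \<Longrightarrow> multiplier_bound (\<phi> i) (C i)"
  shows "multiplier_bound (\<lambda>s. \<Sum>i\<in>I. \<phi> i s) (\<Sum>i\<in>I. C i)"
  using assms by (induction I) (auto intro: multiplier_bound_0 multiplier_bound_add)

lemma multiplier_bound_mono:
  assumes "multiplier_bound \<phi> C" "C \<le> D"
  shows "multiplier_bound \<phi> D"
proof (rule multiplier_boundI)
  show "0 \<le> D" using assms multiplier_bound_nonneg by fastforce
  fix T :: "'a op" assume T: "T \<in> bop"
  have "norm (schur_mult \<phi> T) \<le> D * norm T"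
    using norm_schur_mult_le[OF assms(1) T] mult_right_mono[OF assms(2), of "norm T"] by simp
  then show "\<exists>S\<in>bop. (\<forall>x y. entry S x y = \<phi> (x - y) * entry T x y) \<and> norm S \<le> D * norm T"
    using assms(1) T by (intro bexI[of _ "schur_mult \<phi> T"]) (auto simp: entry_schur_mult intro: schur_mult_bop)
qed

lemma has_sum_indicator_single:
  "((\<lambda>u. if u = x then (c :: 'b :: {comm_monoid_add, topological_space}) else 0) has_sum c) UNIV"
proof -
  have "((\<lambda>u. if u = x then c else 0) has_sum c) {x}"
    by (rule has_sum_finiteI) auto
  then show ?thesis
    by (rule has_sum_cong_neutral[THEN iffD1, rotated -1]) auto
qed

text \<open>
  The cut-off to a single diagonal is a Gram kernel over the group itself, with \<open>a u x\<close> and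
  \<open>b u y\<close> the indicators of \<open>u = x\<close> and \<open>u = d + y\<close>.
\<close>
lemma multiplier_bound_single: "multiplier_bound (\<lambda>s :: 'g::group_add. if s = d then 1 else 0) 1"
proof (rule multiplier_boundI)
  fix T :: "'g op" assume T: "T \<in> bop"
  define a :: "'g \<Rightarrow> 'g \<Rightarrow> complex" where "a u x = (if u = x then 1 else 0)" for u x
  have sq: "(cmod (a u x))\<^sup>2 = (if u = x then 1 else 0)" for u x by (simp add: a_def)
  have "((\<lambda>u. (cmod (a u x))\<^sup>2) has_sum 1) UNIV" for x
    unfolding sq by (rule has_sum_indicator_single)
  then have a: "(\<lambda>u. (cmod (a u x))\<^sup>2) summable_on UNIV" "(\<Sum>\<^sub>\<infinity>u. (cmod (a u x))\<^sup>2) \<le> 1" for x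
    by (auto simp: has_sum_iff)
  have "a u x * a u (d + y) = (if u = x then if x - y = d then 1 else 0 else 0)" for u x y
    by (auto simp: a_def diff_eq_eq)
  then have "(\<Sum>\<^sub>\<infinity>u. a u x * a u (d + y)) = (if x - y = d then 1 else 0)" for x y
    by (simp only: infsumI[OF has_sum_indicator_single])
  then obtain S where "S \<in> bop" "\<And>x y. entry S x y = (if x - y = d then 1 else 0) * entry T x y"
      "norm S \<le> norm T"
    using gram_schur_product[where a = a and b = "\<lambda>u y. a u (d + y)", OF a a T]
    by (auto simp: is_schur_product_def)
  then show "\<exists>S\<in>bop. (\<forall>x y. entry S x y = (if x - y = d then 1 else 0) * entry T x y)
      \<and> norm S \<le> 1 * norm T"
    by (intro bexI[of _ S]) simp_all
qed simp

lemma multiplier_bound_finite_support: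
  fixes \<phi> :: "'g::group_add \<Rightarrow> complex"
  assumes F: "finite F" and "\<And>s. s \<notin> F \<Longrightarrow> \<phi> s = 0"
  shows "multiplier_bound \<phi> (\<Sum>s\<in>F. cmod (\<phi> s))"
proof -
  have "multiplier_bound (\<lambda>s. \<Sum>d\<in>F. \<phi> d * (if s = d then 1 else 0)) (\<Sum>d\<in>F. cmod (\<phi> d) * 1)"
    by (intro multiplier_bound_sum multiplier_bound_scale multiplier_bound_single F)
  moreover have "(\<Sum>d\<in>F. \<phi> d * (if s = d then 1 else 0)) = \<phi> s" for s
    using assms by (simp add: if_distrib[of "\<lambda>u. _ * u"] cong: if_cong)
  ultimately show ?thesis by simp
qed

lemma translate_bij: "bij (\<lambda>x. s + x :: 'g::group_add)"
  by (rule bij_betw_byWitness[of _ "\<lambda>x. - s + x"]) (auto simp flip: add.assoc)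

lemma left_regular_apply: "ell2_fun (left_regular s f) x = ell2_fun f (- s + x)"
  by (simp add: left_regular.rep_eq translate.rep_eq)

lemma left_regular_bop: "left_regular s \<in> bop"
  by (auto simp: bop_def left_regular_apply ell2_cscale.rep_eq intro!: ell2_eqI)

lemma entry_left_regular: "entry (left_regular s) x y = (if x - y = s then 1 else 0)"
proof -
  have "- s + x = y \<longleftrightarrow> x - y = s"
    by (metis add_minus_cancel diff_eq_eq minus_add_cancel)
  then show ?thesis by (simp add: entry_eq left_regular_apply delta.rep_eq)
qed

lemma norm_left_regular_le: "norm (left_regular s :: 'g::group_add op) \<le> 1"
proof (rule norm_blinfun_bound)
  fix f :: "'g ell2"
  show "norm (left_regular s f) \<le> 1 * norm f"
    unfolding norm_ell2_def left_regular_apply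
    using infsum_reindex_bij_betw[OF translate_bij[of "- s"], of "\<lambda>x. (cmod (ell2_fun f x))\<^sup>2"]
    by simp
qed simp

text \<open>
  The matrix entries of \<open>left_regular s\<close> on its diagonal are 1, so the symbol can be read off
  there.
\<close>
lemma multiplier_bound_cmod:
  fixes \<phi> :: "'g::group_add \<Rightarrow> complex"
  assumes "multiplier_bound \<phi> C"
  shows "cmod (\<phi> s) \<le> C"
proof -
  have "\<phi> s = entry (schur_mult \<phi> (left_regular s)) s 0"
    by (simp add: entry_schur_mult[OF assms left_regular_bop] entry_left_regular)
  also have "cmod \<dots> \<le> C * norm (left_regular s :: 'g op)"
    by (rule order_trans[OF cmod_entry_le norm_schur_mult_le[OF assms left_regular_bop]])
  also have "\<dots> \<le> C * 1"
    by (intro mult_left_mono norm_left_regular_le multiplier_bound_nonneg[OF assms])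
  finally show ?thesis by simp
qed

section \<open>Correlations\<close>

text \<open>
  The set \<open>'g \<times> nat\<close> consists of countably many copies of the group, each with the right
  translation action. A function on it encodes a sequence of functions on the group.
\<close>
definition shift :: "'g::group_add \<Rightarrow> 'g \<times> nat \<Rightarrow> 'g \<times> nat" where
  "shift s x = (fst x + s, snd x)"

definition corr :: "('g::group_add \<times> nat \<Rightarrow> real) \<Rightarrow> 'g \<Rightarrow> real" where
  "corr g s = (\<Sum>\<^sub>\<infinity>x. g x * g (shift s x))"

lemma bij_shift: "bij (shift s)"
  by (rule bij_betw_byWitness[of _ "shift (- s)"]) (auto simp: shift_def add.assoc)

lemma summable_shift:
  "(\<lambda>x. f (shift s x)) summable_on UNIV \<longleftrightarrow> f summable_on UNIV"
  by (rule summable_on_reindex_bij_betw[OF bij_shift])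

lemma infsum_shift: "(\<Sum>\<^sub>\<infinity>x. f (shift s x)) = infsum f UNIV"
  by (rule infsum_reindex_bij_betw[OF bij_shift])

lemma corr_summable:
  fixes g :: "'g::group_add \<times> nat \<Rightarrow> real"
  assumes "(\<lambda>x. (g x)\<^sup>2) summable_on UNIV"
  shows "(\<lambda>x. g x * g (shift s x)) summable_on UNIV"
  using assms summable_shift[of "\<lambda>x. (g x)\<^sup>2" s] by (intro real_Cauchy_Schwarz_infsum) auto

text \<open>
  Substituting \<open>u = (t, i)\<close> moved by \<open>- x\<close>, the kernel \<open>corr g (x - y)\<close> is the Gram kernel of the
  translates of \<open>g\<close>, all of which have the same 2-norm.
\<close>
lemma multiplier_bound_corr:
  fixes g :: "'g::group_add \<times> nat \<Rightarrow> real"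
  assumes g: "(\<lambda>x. (g x)\<^sup>2) summable_on UNIV"
  shows "multiplier_bound (\<lambda>s. of_real (corr g s)) (\<Sum>\<^sub>\<infinity>x. (g x)\<^sup>2)"
proof (rule multiplier_boundI)
  let ?C = "\<Sum>\<^sub>\<infinity>x. (g x)\<^sup>2"
  show C: "0 \<le> ?C" by (rule infsum_nonneg) simp
  fix T :: "'g op" assume T: "T \<in> bop"
  define a :: "'g \<times> nat \<Rightarrow> 'g \<Rightarrow> complex" where "a u x = of_real (g (shift (- x) u))" for u x
  have sq: "(cmod (a u x))\<^sup>2 = (g (shift (- x) u))\<^sup>2" for u x by (simp add: a_def)
  have a: "(\<lambda>u. (cmod (a u x))\<^sup>2) summable_on UNIV" "(\<Sum>\<^sub>\<infinity>u. (cmod (a u x))\<^sup>2) \<le> ?C" for x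
    unfolding sq using summable_on_reindex_bij_betw[OF bij_shift[of "- x"], of "\<lambda>u. (g u)\<^sup>2"] g
      infsum_reindex_bij_betw[OF bij_shift[of "- x"], of "\<lambda>u. (g u)\<^sup>2"] by auto
  have "(\<Sum>\<^sub>\<infinity>u. a u x * a u y) = of_real (corr g (x - y))" for x y
  proof -
    have "(\<Sum>\<^sub>\<infinity>u. a u x * a u y)
        = (\<Sum>\<^sub>\<infinity>u. of_real (g (shift (- x) u) * g (shift (x - y) (shift (- x) u))))"
      by (simp add: a_def shift_def add.assoc add_diff_eq)
    also have "\<dots> = (\<Sum>\<^sub>\<infinity>u. of_real (g u * g (shift (x - y) u)))"
      by (rule infsum_reindex_bij_betw[OF bij_shift])
    also have "\<dots> = of_real (corr g (x - y))"
      unfolding corr_def using g by (intro infsumI has_sum_of_real has_sum_infsum corr_summable)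
    finally show ?thesis .
  qed
  then show "\<exists>S\<in>bop. (\<forall>x y. entry S x y = of_real (corr g (x - y)) * entry T x y)
      \<and> norm S \<le> ?C * norm T"
    using gram_schur_product[where a = a and b = a, OF a a T] C
    by (auto simp: is_schur_product_def)
qed

section \<open>Algebras that are invariant under multipliers\<close>

lemma schur_mult_diff_right:
  assumes "multiplier_bound \<phi> C" "S \<in> bop" "T \<in> bop"
  shows "schur_mult \<phi> (S - T) = schur_mult \<phi> S - schur_mult \<phi> T"
  by (rule schur_mult_eqI)
    (use assms in \<open>auto simp: entry_simps entry_schur_mult algebra_simps intro: bop_diff schur_mult_bop\<close>)

lemma schur_mult_add_right:
  assumes "multiplier_bound \<phi> C" "S \<in> bop" "T \<in> bop"
  shows "schur_mult \<phi> (S + T) = schur_mult \<phi> S + schur_mult \<phi> T"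
  by (rule schur_mult_eqI)
    (use assms in \<open>auto simp: entry_simps entry_schur_mult algebra_simps intro: bop_add schur_mult_bop\<close>)

lemma schur_mult_cscale_right:
  assumes "multiplier_bound \<phi> C" "T \<in> bop"
  shows "schur_mult \<phi> (cscale_op c o\<^sub>L T) = cscale_op c o\<^sub>L schur_mult \<phi> T"
  by (rule schur_mult_eqI)
    (use assms in \<open>auto simp: entry_simps entry_schur_mult intro: bop_compose bop_cscale_op schur_mult_bop\<close>)

lemma schur_mult_diff_left:
  assumes "multiplier_bound \<phi> C" "multiplier_bound \<psi> D" "T \<in> bop"
  shows "schur_mult (\<lambda>s. \<phi> s - \<psi> s) T = schur_mult \<phi> T - schur_mult \<psi> T"
  by (rule schur_mult_eqI)
    (use assms in \<open>auto simp: entry_simps entry_schur_mult algebra_simps intro: bop_diff schur_mult_bop\<close>)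

lemma schur_mult_sum_left:
  assumes "\<And>i. i \<in> I \<Longrightarrow> multiplier_bound (\<phi> i) (C i)" "T \<in> bop"
  shows "schur_mult (\<lambda>s. \<Sum>i\<in>I. \<phi> i s) T = (\<Sum>i\<in>I. schur_mult (\<phi> i) T)"
  by (rule schur_mult_eqI)
    (use assms in \<open>auto simp: entry_sum sum_distrib_right intro!: sum.cong entry_schur_mult intro: bop_sum schur_mult_bop\<close>)

lemma schur_mult_left_regular:
  "multiplier_bound \<phi> C \<Longrightarrow> schur_mult \<phi> (left_regular s) = cscale_op (\<phi> s) o\<^sub>L left_regular s"
  by (rule schur_mult_eqI)
    (auto simp: entry_simps entry_left_regular intro: bop_compose bop_cscale_op left_regular_bop)

text \<open>
  The properties that the reduced group algebra and the uniform Roe algebra share and that the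
  rest of the argument uses.
\<close>
locale multiplier_algebra =
  fixes A :: "'g::group_add op set"
  assumes A_bop: "A \<subseteq> bop"
    and left_regular_A: "left_regular s \<in> A"
    and add_A: "S \<in> A \<Longrightarrow> T \<in> A \<Longrightarrow> S + T \<in> A"
    and cscale_A: "T \<in> A \<Longrightarrow> cscale_op c o\<^sub>L T \<in> A"
    and finite_propagation_dense:
      "T \<in> A \<Longrightarrow> 0 < e \<Longrightarrow> \<exists>S\<in>A. finite_propagation S \<and> norm (S - T) < e"
    and schur_mult_A: "multiplier_bound \<phi> C \<Longrightarrow> T \<in> A \<Longrightarrow> schur_mult \<phi> T \<in> A"

text \<open>
  Both algebras are closures of an algebra of operators of finite propagation, and multipliers,
  being bounded, extend to the closure.
\<close>
lemma multiplier_algebra_closure: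
  fixes V :: "'g::group_add op set"
  assumes V: "V \<subseteq> bop" and lr: "\<And>s. left_regular s \<in> V"
    and add: "\<And>S T. S \<in> V \<Longrightarrow> T \<in> V \<Longrightarrow> S + T \<in> V"
    and scale: "\<And>c T. T \<in> V \<Longrightarrow> cscale_op c o\<^sub>L T \<in> V"
    and fp: "\<And>T. T \<in> V \<Longrightarrow> finite_propagation T"
    and schur_mult: "\<And>\<phi> C T. multiplier_bound \<phi> C \<Longrightarrow> T \<in> V \<Longrightarrow> schur_mult \<phi> T \<in> V"
  shows "multiplier_algebra (closure V)"
proof
  show bop: "closure V \<subseteq> bop" using V closed_bop by (rule closure_minimal)
  show "left_regular s \<in> closure V" for s using lr closure_subset by blast
  show "S + T \<in> closure V" if "S \<in> closure V" "T \<in> closure V" for S T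
  proof -
    from that obtain X Y where "\<And>n. X n \<in> V" "X \<longlonglongrightarrow> S" "\<And>n. Y n \<in> V" "Y \<longlonglongrightarrow> T"
      unfolding closure_sequential by blast
    then show ?thesis
      unfolding closure_sequential by (intro exI[of _ "\<lambda>n. X n + Y n"]) (simp add: add tendsto_add)
  qed
  show "cscale_op c o\<^sub>L T \<in> closure V" if "T \<in> closure V" for c T
  proof -
    from that obtain X where X: "\<And>n. X n \<in> V" "X \<longlonglongrightarrow> T" unfolding closure_sequential by blast
    have "(\<lambda>n. cscale_op c o\<^sub>L X n) \<longlonglongrightarrow> (cscale_op c o\<^sub>L T)"
      by (intro bounded_bilinear.tendsto[OF bounded_bilinear_blinfun_compose] tendsto_const X)
    with X(1) show ?thesis
      unfolding closure_sequential by (intro exI[of _ "\<lambda>n. cscale_op c o\<^sub>L X n"]) (simp add: scale)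
  qed
  show "\<exists>S\<in>closure V. finite_propagation S \<and> norm (S - T) < e" if "T \<in> closure V" "0 < e" for T e
  proof -
    from that obtain S where "S \<in> V" "dist S T < e" unfolding closure_approachable by blast
    then show ?thesis using fp closure_subset by (auto simp: dist_norm)
  qed
  show "schur_mult \<phi> T \<in> closure V" if b: "multiplier_bound \<phi> C" and T: "T \<in> closure V" for \<phi> C T
  proof -
    from T obtain X where X: "\<And>n. X n \<in> V" "X \<longlonglongrightarrow> T" unfolding closure_sequential by blast
    have "(\<lambda>n. schur_mult \<phi> (X n)) \<longlonglongrightarrow> schur_mult \<phi> T"
    proof (rule tendsto_dist_iff[THEN iffD2])
      have "norm (schur_mult \<phi> (X n) - schur_mult \<phi> T) \<le> C * norm (X n - T)" for n
        using X(1)[of n] V bop T b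
        by (subst schur_mult_diff_right[symmetric, OF b]) (auto intro!: norm_schur_mult_le bop_diff)
      moreover have "(\<lambda>n. C * norm (X n - T)) \<longlonglongrightarrow> C * 0"
        using X(2) by (intro tendsto_intros) (simp add: LIM_zero tendsto_norm_zero)
      ultimately show "(\<lambda>n. dist (schur_mult \<phi> (X n)) (schur_mult \<phi> T)) \<longlonglongrightarrow> 0"
        by (auto intro: Lim_null_comparison[where g = "\<lambda>n. C * norm (X n - T)"] simp: dist_norm)
    qed
    with X(1) show ?thesis
      unfolding closure_sequential by (intro exI[of _ "\<lambda>n. schur_mult \<phi> (X n)"]) (simp add: schur_mult[OF b])
  qed
qed

lemma finite_propagation_add:
  assumes "finite_propagation S" "finite_propagation T"
  shows "finite_propagation (S + T)"
proof -
  obtain F G where "finite F" "{(x, y). entry S x y \<noteq> 0} \<subseteq> tube F"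
    "finite G" "{(x, y). entry T x y \<noteq> 0} \<subseteq> tube G"
    using assms unfolding finite_propagation_def by blast
  then have "finite (F \<union> G)" "{(x, y). entry (S + T) x y \<noteq> 0} \<subseteq> tube (F \<union> G)"
    by (simp, auto simp: tube_def entry_simps subset_iff) (metis add.right_neutral add_0)
  then show ?thesis unfolding finite_propagation_def by blast
qed

lemma finite_propagation_times:
  assumes "finite_propagation T" "\<And>x y. entry S x y = k x y * entry T x y"
  shows "finite_propagation S"
proof -
  have "{(x, y). entry S x y \<noteq> 0} \<subseteq> {(x, y). entry T x y \<noteq> 0}" using assms(2) by auto
  with assms(1) show ?thesis unfolding finite_propagation_def by (meson order_trans)
qed

lemma finite_propagation_left_regular: "finite_propagation (left_regular s)"
  unfolding finite_propagation_def
  by (intro exI[of _ "{s}"]) (auto simp: tube_def entry_left_regular split: if_splits)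

lemma multiplier_algebra_Roe: "multiplier_algebra (uniform_Roe_algebra :: 'g::group_add op set)"
  unfolding uniform_Roe_algebra_def
proof (rule multiplier_algebra_closure)
  show "cscale_op c o\<^sub>L T \<in> {T \<in> bop. finite_propagation T}"
    if "T \<in> {T \<in> bop. finite_propagation T}" for c and T :: "'g op"
    using that finite_propagation_times[of T "cscale_op c o\<^sub>L T" "\<lambda>x y. c"]
    by (auto simp: entry_simps intro: bop_compose bop_cscale_op)
  show "schur_mult \<phi> T \<in> {T \<in> bop. finite_propagation T}"
    if "multiplier_bound \<phi> C" "T \<in> {T \<in> bop. finite_propagation T}" for \<phi> C and T :: "'g op"
    using that finite_propagation_times[of T "schur_mult \<phi> T" "\<lambda>x y. \<phi> (x - y)"]
    by (auto simp: entry_schur_mult intro: schur_mult_bop)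
qed (auto intro: left_regular_bop finite_propagation_left_regular bop_add finite_propagation_add)

section \<open>The reduced group algebra\<close>

text \<open>
  The real span suffices, as the generators are closed under complex multiples.
\<close>
definition group_ring :: "'g::group_add op set" where
  "group_ring = span (range (\<lambda>(c, s). cscale_op c o\<^sub>L left_regular s))"

lemma group_ring_add: "S \<in> group_ring \<Longrightarrow> T \<in> group_ring \<Longrightarrow> S + T \<in> group_ring"
  unfolding group_ring_def by (rule span_add)

lemma group_ring_generator: "cscale_op c o\<^sub>L left_regular s \<in> group_ring"
  unfolding group_ring_def by (rule span_base) auto

lemma group_ring_induct [consumes 1, case_names zero add scale generator]:
  assumes "T \<in> group_ring" "P 0" "\<And>S T. P S \<Longrightarrow> P T \<Longrightarrow> P (S + T)" "\<And>r T. P T \<Longrightarrow> P (r *\<^sub>R T)"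
    "\<And>c s. P (cscale_op c o\<^sub>L left_regular s)"
  shows "P T"
  using assms(1) unfolding group_ring_def
proof (rule span_induct)
  show "subspace {T. P T}" using assms by (auto intro!: subspaceI)
qed (use assms(5) in auto)

lemma group_ring_0: "0 \<in> group_ring" and group_ring_scaleR: "T \<in> group_ring \<Longrightarrow> r *\<^sub>R T \<in> group_ring"
  unfolding group_ring_def by (auto intro: span_zero span_scale)

lemma cscale_op_mult: "cscale_op c o\<^sub>L (cscale_op d o\<^sub>L T) = cscale_op (c * d) o\<^sub>L T"
  by (rule blinfun_eqI) (simp add: ell2_cscale_simps)

lemma left_regular_compose: "left_regular s o\<^sub>L left_regular t = left_regular (s + t)"
  by (intro blinfun_eqI ell2_eqI) (simp add: left_regular_apply minus_add flip: add.assoc)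

lemma blinfun_compose_scaleR_right: "S o\<^sub>L (r *\<^sub>R T) = r *\<^sub>R (S o\<^sub>L T)"
  by (rule blinfun_eqI) (simp add: blinfun.scaleR_left blinfun.scaleR_right)

lemma blinfun_compose_scaleR_left: "(r *\<^sub>R S) o\<^sub>L T = r *\<^sub>R (S o\<^sub>L T)"
  by (rule blinfun_eqI) (simp add: blinfun.scaleR_left)

lemma blinfun_compose_add:
  "S o\<^sub>L (T + T') = (S o\<^sub>L T) + (S o\<^sub>L T')" "(S + S') o\<^sub>L T = (S o\<^sub>L T) + (S' o\<^sub>L T)"
  by (auto intro!: blinfun_eqI simp: blinfun.add_left blinfun.add_right)

lemma group_ring_cscale: "T \<in> group_ring \<Longrightarrow> cscale_op c o\<^sub>L T \<in> group_ring"
  by (induction rule: group_ring_induct)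
    (auto simp: blinfun_compose_add blinfun_compose_scaleR_right cscale_op_mult
      intro: group_ring_0 group_ring_add group_ring_scaleR group_ring_generator)

lemma group_ring_bop: "T \<in> group_ring \<Longrightarrow> T \<in> bop"
  by (induction rule: group_ring_induct)
    (auto intro: bop_0 bop_add bop_scaleR bop_compose bop_cscale_op left_regular_bop)

lemma group_ring_left_regular: "left_regular s \<in> group_ring"
proof -
  have "cscale_op 1 o\<^sub>L left_regular s = left_regular s"
    using cscale_op_of_real[of 1 "left_regular s"] by simp
  then show ?thesis by (metis group_ring_generator)
qed

lemma group_ring_compose:
  assumes "S \<in> group_ring" "T \<in> group_ring"
  shows "S o\<^sub>L T \<in> group_ring"
  using assms(1)
proof (induction rule: group_ring_induct)
  case (generator c s)
  have "left_regular s o\<^sub>L T \<in> group_ring"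
    using assms(2)
  proof (induction rule: group_ring_induct)
    case (generator d t)
    have "left_regular s o\<^sub>L (cscale_op d o\<^sub>L left_regular t) = cscale_op d o\<^sub>L left_regular (s + t)"
      by (rule blinfun_eqI) (simp add: bopD[OF left_regular_bop] flip: left_regular_compose)
    then show ?case by (simp add: group_ring_generator)
  qed (auto simp: blinfun_compose_add blinfun_compose_scaleR_right
      intro: group_ring_0 group_ring_add group_ring_scaleR)
  then have "cscale_op c o\<^sub>L (left_regular s o\<^sub>L T) \<in> group_ring" by (rule group_ring_cscale)
  moreover have "cscale_op c o\<^sub>L (left_regular s o\<^sub>L T) = (cscale_op c o\<^sub>L left_regular s) o\<^sub>L T"
    by (rule blinfun_eqI) simp
  ultimately show ?case by simp
qed (auto simp: blinfun_compose_add blinfun_compose_scaleR_left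
      intro: group_ring_0 group_ring_add group_ring_scaleR)

lemma cinner_cscale_left: "cinner (ell2_cscale c f) g = cinner f (ell2_cscale (cnj c) g)"
  unfolding cinner_def ell2_cscale.rep_eq by (simp add: mult_ac)

lemma is_adjoint_generator:
  "is_adjoint (cscale_op c o\<^sub>L left_regular s) (cscale_op (cnj c) o\<^sub>L left_regular (- s))"
  unfolding is_adjoint_def
proof (intro allI)
  fix f g :: "'a ell2"
  have "cinner (left_regular s f) h = cinner f (left_regular (- s) h)" for h
    unfolding cinner_def left_regular_apply
    using infsum_reindex_bij_betw[OF translate_bij[of "- s"],
        of "\<lambda>x. cnj (ell2_fun f x) * ell2_fun h (s + x)"]
    by (simp add: add.assoc[symmetric])
  then show "cinner ((cscale_op c o\<^sub>L left_regular s) f) g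
      = cinner f ((cscale_op (cnj c) o\<^sub>L left_regular (- s)) g)"
    by (simp add: cinner_cscale_left bopD[OF left_regular_bop])
qed

lemma group_ring_adjoint:
  assumes "T \<in> group_ring"
  shows "\<exists>S\<in>group_ring. \<forall>f g. inner (T f) g = inner f (S g)"
  using assms
proof (induction rule: group_ring_induct)
  case zero
  show ?case by (rule bexI[of _ 0]) (auto simp: group_ring_0)
next
  case (add T T')
  then obtain S S' where "S \<in> group_ring" "S' \<in> group_ring"
    "\<forall>f g. inner (T f) g = inner f (S g)" "\<forall>f g. inner (T' f) g = inner f (S' g)" by blast
  then show ?case
    by (intro bexI[of _ "S + S'"])
      (auto simp: blinfun.add_left inner_add_left inner_add_right intro: group_ring_add)
next
  case (scale r T)
  then obtain S where "S \<in> group_ring" "\<forall>f g. inner (T f) g = inner f (S g)" by blast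
  then show ?case
    by (intro bexI[of _ "r *\<^sub>R S"]) (auto simp: blinfun.scaleR_left intro: group_ring_scaleR)
next
  case (generator c s)
  show ?case
    using is_adjoint_generator[of c s]
    by (intro bexI[OF _ group_ring_generator[of "cnj c" "- s"]]) (simp add: is_adjoint_def inner_ell2_def)
qed

lemma multiplier_algebra_group_ring: "multiplier_algebra (closure group_ring :: 'g::group_add op set)"
proof (rule multiplier_algebra_closure)
  show "finite_propagation T" if "T \<in> group_ring" for T :: "'g op"
    using that
  proof (induction rule: group_ring_induct)
    case zero
    show ?case by (auto simp: finite_propagation_def entry_simps)
  next
    case (scale r T)
    then show ?case by (rule finite_propagation_times[where k = "\<lambda>x y. of_real r"]) (simp add: entry_simps)
  next
    case (generator c s)
    show ?case
      by (rule finite_propagation_times[where k = "\<lambda>x y. c", OF finite_propagation_left_regular[of s]])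
        (simp add: entry_simps)
  qed (rule finite_propagation_add)
  show "schur_mult \<phi> T \<in> group_ring" if b: "multiplier_bound \<phi> C" and T: "T \<in> group_ring"
    for \<phi> C and T :: "'g op"
  proof -
    have "T \<in> bop \<and> schur_mult \<phi> T \<in> group_ring"
      using T
    proof (induction rule: group_ring_induct)
      case zero
      have "schur_mult \<phi> 0 = 0" by (rule schur_mult_eqI) (auto simp: entry_simps bop_0)
      then show ?case by (simp add: bop_0 group_ring_0)
    next
      case (add S T)
      then show ?case by (simp add: schur_mult_add_right[OF b] bop_add group_ring_add)
    next
      case (scale r T)
      then have "schur_mult \<phi> (r *\<^sub>R T) = r *\<^sub>R schur_mult \<phi> T"
        using schur_mult_cscale_right[OF b, of T "of_real r"] by (simp add: cscale_op_of_real)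
      with scale show ?case by (simp add: bop_scaleR group_ring_scaleR)
    next
      case (generator c s)
      show ?case
        by (simp add: schur_mult_cscale_right[OF b left_regular_bop] schur_mult_left_regular[OF b]
          group_ring_cscale group_ring_generator bop_compose bop_cscale_op left_regular_bop)
    qed
    then show ?thesis by simp
  qed
qed (auto intro: group_ring_bop group_ring_left_regular group_ring_add group_ring_cscale)

lemma Cstar_subalgebra_group_ring: "Cstar_subalgebra (closure group_ring :: 'g::group_add op set)"
proof -
  interpret multiplier_algebra "closure group_ring :: 'g op set" by (rule multiplier_algebra_group_ring)
  show ?thesis
    unfolding Cstar_subalgebra_def
  proof (intro conjI ballI allI)
    show "0 \<in> closure (group_ring :: 'g op set)" using group_ring_0 closure_subset by blast
    fix S T :: "'g op"
    assume S: "S \<in> closure group_ring" and T: "T \<in> closure group_ring"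
    show "S o\<^sub>L T \<in> closure group_ring"
    proof -
      obtain X Y where "\<And>n. X n \<in> group_ring" "X \<longlonglongrightarrow> S" "\<And>n. Y n \<in> group_ring" "Y \<longlonglongrightarrow> T"
        using S T unfolding closure_sequential by blast
      then have "\<And>n. X n o\<^sub>L Y n \<in> group_ring" "(\<lambda>n. X n o\<^sub>L Y n) \<longlonglongrightarrow> (S o\<^sub>L T)"
        by (auto intro!: group_ring_compose bounded_bilinear.tendsto[OF bounded_bilinear_blinfun_compose])
      then show ?thesis unfolding closure_sequential by (intro exI[of _ "\<lambda>n. X n o\<^sub>L Y n"]) blast
    qed
  next
    fix T :: "'g op"
    assume T: "T \<in> closure group_ring"
    then have Tb: "T \<in> bop" using A_bop by blast
    obtain X where X: "\<And>n. X n \<in> group_ring" "X \<longlonglongrightarrow> T"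
      using T unfolding closure_sequential by blast
    obtain S where S: "S \<in> bop" "is_adjoint T S" using exists_adjoint[OF Tb] by blast
    have "\<exists>Y. \<forall>n. Y n \<in> group_ring \<and> (\<forall>f g. inner (X n f) g = inner f (Y n g))"
      using group_ring_adjoint[OF X(1)] by (intro choice) blast
    then obtain Y where Y: "\<And>n. Y n \<in> group_ring" "\<And>n f g. inner (X n f) g = inner f (Y n g)"
      by blast
    have "norm (Y n - S) \<le> norm (X n - T)" for n
      using is_adjoint_iff_inner[OF Tb S(1)] S(2) Y(2)
      by (intro norm_le_of_inner_adjoint) (simp add: blinfun.diff_left inner_diff_left inner_diff_right)
    moreover have "(\<lambda>n. norm (X n - T)) \<longlonglongrightarrow> 0"
      using X(2) by (simp add: LIM_zero tendsto_norm_zero)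
    ultimately have "(\<lambda>n. Y n - S) \<longlonglongrightarrow> 0"
      by (auto intro: Lim_null_comparison[where g = "\<lambda>n. norm (X n - T)"])
    then have "Y \<longlonglongrightarrow> S" by (rule LIM_zero_cancel)
    with Y(1) have "S \<in> closure group_ring" unfolding closure_sequential by blast
    moreover have "is_adjoint S T"
      using S(2) unfolding is_adjoint_iff_inner[OF Tb S(1)] is_adjoint_iff_inner[OF S(1) Tb]
      by (metis inner_commute)
    ultimately show "\<exists>S\<in>closure group_ring. is_adjoint S T" by blast
  qed (use A_bop add_A cscale_A in auto)
qed

text \<open>
  The closure of the group ring is itself one of the algebras in the intersection, and it is
  contained in all others.
\<close>
lemma reduced_group_Cstar_eq: "reduced_group_Cstar = (closure group_ring :: 'g::group_add op set)"
proof (rule antisym)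
  show "reduced_group_Cstar \<subseteq> (closure group_ring :: 'g op set)"
    unfolding reduced_group_Cstar_def
    using Cstar_subalgebra_group_ring group_ring_left_regular closure_subset by blast
  show "(closure group_ring :: 'g op set) \<subseteq> reduced_group_Cstar"
    unfolding reduced_group_Cstar_def
  proof (rule Inter_greatest)
    fix B :: "'g op set"
    assume "B \<in> {B. Cstar_subalgebra B \<and> range left_regular \<subseteq> B}"
    then have B: "Cstar_subalgebra B" and lr: "left_regular s \<in> B" for s by auto
    have "T \<in> B" if "T \<in> group_ring" for T
      using that
    proof (induction rule: group_ring_induct)
      case (scale r T)
      then have "cscale_op (of_real r) o\<^sub>L T \<in> B" using B unfolding Cstar_subalgebra_def by blast
      then show ?case by (simp only: cscale_op_of_real)
    qed (use B lr in \<open>auto simp: Cstar_subalgebra_def\<close>)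
    moreover have "closed B" using B by (simp add: Cstar_subalgebra_def)
    ultimately show "closure group_ring \<subseteq> B" by (intro closure_minimal) auto
  qed
qed

lemma multiplier_algebra_reduced: "multiplier_algebra reduced_group_Cstar"
  unfolding reduced_group_Cstar_eq by (rule multiplier_algebra_group_ring)

section \<open>The defect of a symbol on a tube\<close>

context multiplier_algebra begin

lemma A_bopD: "T \<in> A \<Longrightarrow> T \<in> bop" using A_bop by blast

lemma scaleR_A: "T \<in> A \<Longrightarrow> r *\<^sub>R T \<in> A"
  using cscale_A[of T "of_real r"] by (simp add: cscale_op_of_real)

lemma zero_A: "0 \<in> A"
  using scaleR_A[OF left_regular_A, of 0] by simp

lemma schur_eq: "schur A (kernel_of \<phi>) = restrict (schur_mult \<phi>) A"
  by (rule ext) (simp add: schur_def schur_mult_def restrict_def)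

lemma opnorm_on_le:
  assumes "0 \<le> C" "\<And>T. T \<in> A \<Longrightarrow> norm (M T) \<le> C * norm T"
  shows "opnorm_on A M \<le> C"
  unfolding opnorm_on_def
proof (rule cSUP_least)
  fix T assume T: "T \<in> {T \<in> A. norm T \<le> 1}"
  then have "norm (M T) \<le> C * norm T" using assms(2) by simp
  also have "\<dots> \<le> C * 1" using T assms(1) by (intro mult_left_mono) auto
  finally show "norm (M T) \<le> C" by simp
qed (use zero_A in auto)

lemma norm_le_opnorm_on:
  assumes "\<And>T. T \<in> A \<Longrightarrow> norm (M T) \<le> C * norm T" "T \<in> A" "norm T \<le> 1"
  shows "norm (M T) \<le> opnorm_on A M"
  unfolding opnorm_on_def
proof (rule cSUP_upper)
  show "bdd_above ((\<lambda>T. norm (M T)) ` {T \<in> A. norm T \<le> 1})"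
  proof (rule bdd_aboveI2)
    fix T assume T: "T \<in> {T \<in> A. norm T \<le> 1}"
    then have "norm (M T) \<le> C * norm T" using assms(1) by simp
    also have "\<dots> \<le> \<bar>C\<bar> * 1" using T by (intro mult_mono) auto
    finally show "norm (M T) \<le> \<bar>C\<bar>" by simp
  qed
qed (use assms in auto)

text \<open>
  A supremum of an unbounded set of reals is unspecified, hence the bound in the hypothesis.
\<close>
lemma opnorm_on_nonneg:
  assumes "\<And>T. T \<in> A \<Longrightarrow> norm (M T) \<le> C * norm T"
  shows "0 \<le> opnorm_on A M"
proof -
  have "0 \<le> norm (M 0)" by simp
  also have "\<dots> \<le> opnorm_on A M" by (rule norm_le_opnorm_on[OF assms zero_A]) auto
  finally show ?thesis .
qed

lemma opnorm_on_cong: "(\<And>T. T \<in> A \<Longrightarrow> M T = N T) \<Longrightarrow> opnorm_on A M = opnorm_on A N"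
  unfolding opnorm_on_def by (intro SUP_cong) auto

lemma schur_BL:
  assumes "multiplier_bound \<phi> C"
  shows "schur A (kernel_of \<phi>) \<in> BL A"
  using norm_schur_mult_le[OF assms] A_bopD
  by (auto simp: BL_def schur_eq schur_mult_A[OF assms] add_A cscale_A schur_mult_add_right[OF assms]
      schur_mult_cscale_right[OF assms])

lemma schur_symbol_kernel_of:
  assumes "multiplier_bound \<phi> C"
  shows "schur_symbol (kernel_of \<phi>)"
  unfolding schur_symbol_def
proof
  show "bounded (range (kernel_of \<phi>))"
    by (rule boundedI[of _ C]) (auto simp: kernel_of_def multiplier_bound_cmod[OF assms])
  show "\<forall>T\<in>bop. \<exists>S. is_schur_product (kernel_of \<phi>) T S"
    using assms by (auto simp: multiplier_bound_def)
qed

lemma schur_injective: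
  assumes "schur_symbol k" "schur_symbol l" "schur A k = schur A l"
  shows "k = l"
proof (rule ext, safe)
  fix x y
  have e: "entry (schur A k (left_regular (x - y))) x y = k (x, y)" if k: "schur_symbol k" for k
  proof -
    obtain S where S: "is_schur_product k (left_regular (x - y)) S"
      using k left_regular_bop by (auto simp: schur_symbol_def)
    then have "schur A k (left_regular (x - y)) = S"
      unfolding schur_def using left_regular_A by (auto intro: is_schur_product_unique)
    with S show ?thesis by (simp add: is_schur_product_def entry_left_regular)
  qed
  show "k (x, y) = l (x, y)" using e[OF assms(1)] e[OF assms(2)] assms(3) by simp
qed

lemma kernel_of_indicator: "indicator (tube F) = kernel_of (indicator F)"
  by (auto simp: fun_eq_iff kernel_of_def tube_def indicator_def)

lemma cutoff_schur:
  assumes "multiplier_bound \<phi> C"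
  shows "cutoff A F (schur A (kernel_of \<phi>)) = schur A (kernel_of (\<lambda>s. \<phi> s * indicator F s))"
proof -
  have "(THE k. schur_symbol k \<and> schur A (kernel_of \<phi>) = schur A k) = kernel_of \<phi>"
    using schur_symbol_kernel_of[OF assms]
    by (intro the_equality) (auto intro: schur_injective)
  moreover have "(\<lambda>xy. kernel_of \<phi> xy * indicator (tube F) xy) = kernel_of (\<lambda>s. \<phi> s * indicator F s)"
    unfolding kernel_of_indicator by (auto simp: fun_eq_iff kernel_of_def)
  ultimately show ?thesis by (simp add: cutoff_def)
qed

text \<open>
  The norm that \<open>tube_defect\<close> measures, as a function of the symbol alone.
\<close>
definition defect :: "'g set \<Rightarrow> ('g \<Rightarrow> complex) \<Rightarrow> real" where
  "defect F \<phi> = opnorm_on A (schur_mult (\<lambda>s. indicator F s * (1 - \<phi> s)))"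

lemma multiplier_bound_on_finite:
  assumes "finite F"
  shows "multiplier_bound (\<lambda>s. indicator F s * \<phi> s) (\<Sum>s\<in>F. cmod (\<phi> s))"
  using multiplier_bound_finite_support[OF assms, of "\<lambda>s. indicator F s * \<phi> s"] by simp

lemma tube_defect_schur:
  assumes F: "finite F" and b: "multiplier_bound \<phi> C"
  shows "tube_defect A F (schur A (kernel_of \<phi>)) = defect F \<phi>"
proof -
  have b1: "multiplier_bound (indicator F) (\<Sum>s\<in>F. cmod 1)"
    using multiplier_bound_on_finite[OF F, of "\<lambda>_. 1"] by simp
  have b2: "multiplier_bound (\<lambda>s. \<phi> s * indicator F s) (\<Sum>s\<in>F. cmod (\<phi> s))"
    using multiplier_bound_on_finite[OF F, of \<phi>] by (simp add: mult.commute)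
  have "schur_mult (indicator F) T - schur_mult (\<lambda>s. \<phi> s * indicator F s) T
      = schur_mult (\<lambda>s. indicator F s * (1 - \<phi> s)) T" if "T \<in> A" for T
    using schur_mult_diff_left[OF b1 b2 A_bopD[OF that]] by (simp add: algebra_simps)
  then show ?thesis
    unfolding tube_defect_def cutoff_schur[OF b] defect_def
    unfolding kernel_of_indicator schur_eq
    by (intro opnorm_on_cong) simp
qed

lemma norm_schur_mult_on_finite_le:
  assumes "finite F" "T \<in> A"
  shows "norm (schur_mult (\<lambda>s. indicator F s * \<phi> s) T) \<le> (\<Sum>s\<in>F. cmod (\<phi> s)) * norm T"
  by (rule norm_schur_mult_le[OF multiplier_bound_on_finite[OF assms(1)] A_bopD[OF assms(2)]])

lemma defect_nonneg: "finite F \<Longrightarrow> 0 \<le> defect F \<phi>"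
  unfolding defect_def by (rule opnorm_on_nonneg) (rule norm_schur_mult_on_finite_le)

lemma defect_le: "finite F \<Longrightarrow> defect F \<phi> \<le> (\<Sum>s\<in>F. cmod (1 - \<phi> s))"
  unfolding defect_def by (rule opnorm_on_le) (auto intro: sum_nonneg norm_schur_mult_on_finite_le)

lemma le_defect:
  assumes "finite F" "s \<in> F"
  shows "cmod (1 - \<phi> s) \<le> defect F \<phi>"
proof -
  let ?M = "schur_mult (\<lambda>s. indicator F s * (1 - \<phi> s)) (left_regular s)"
  have "cmod (1 - \<phi> s) = cmod (entry ?M s 0)"
    using assms(2)
    by (simp add: entry_schur_mult[OF multiplier_bound_on_finite[OF assms(1)] left_regular_bop] entry_left_regular)
  also have "\<dots> \<le> norm ?M" by (rule cmod_entry_le)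
  also have "\<dots> \<le> defect F \<phi>"
    unfolding defect_def
    by (rule norm_le_opnorm_on[OF norm_schur_mult_on_finite_le[OF assms(1)] left_regular_A norm_left_regular_le])
  finally show ?thesis .
qed

text \<open>
  The defect depends continuously on finitely many values of the symbol, so compactness with
  respect to pointwise convergence is enough for a minimum to exist.
\<close>
lemma defect_lipschitz:
  assumes "finite F"
  shows "defect F \<phi> \<le> defect F \<psi> + (\<Sum>s\<in>F. cmod (\<phi> s - \<psi> s))"
  unfolding defect_def[of F \<phi>] opnorm_on_def
proof (rule cSUP_least)
  fix T assume T: "T \<in> {T \<in> A. norm T \<le> 1}"
  let ?m = "\<lambda>\<phi>. schur_mult (\<lambda>s. indicator F s * \<phi> s) T"
  note b = multiplier_bound_on_finite[OF assms]
  have "?m (\<lambda>s. 1 - \<phi> s) = ?m (\<lambda>s. 1 - \<psi> s) - ?m (\<lambda>s. \<phi> s - \<psi> s)"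
    using schur_mult_diff_left[OF b b A_bopD, of T "\<lambda>s. 1 - \<psi> s" "\<lambda>s. \<phi> s - \<psi> s"] T
    by (simp add: algebra_simps)
  also have "norm \<dots> \<le> norm (?m (\<lambda>s. 1 - \<psi> s)) + norm (?m (\<lambda>s. \<phi> s - \<psi> s))"
    by (rule norm_triangle_ineq4)
  also have "norm (?m (\<lambda>s. 1 - \<psi> s)) \<le> defect F \<psi>"
    unfolding defect_def using T by (intro norm_le_opnorm_on[OF norm_schur_mult_on_finite_le[OF assms]]) auto
  also have "norm (?m (\<lambda>s. \<phi> s - \<psi> s)) \<le> (\<Sum>s\<in>F. cmod (\<phi> s - \<psi> s)) * norm T"
    using T by (intro norm_schur_mult_on_finite_le assms) auto
  also have "\<dots> \<le> (\<Sum>s\<in>F. cmod (\<phi> s - \<psi> s)) * 1"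
    using T by (intro mult_left_mono sum_nonneg) auto
  finally show "norm (?m (\<lambda>s. 1 - \<phi> s)) \<le> defect F \<psi> + (\<Sum>s\<in>F. cmod (\<phi> s - \<psi> s))" by simp
qed (use zero_A in auto)

end

section \<open>Profiles\<close>

definition profiles :: "real \<Rightarrow> ('g \<times> nat \<Rightarrow> real) set" where
  "profiles p = {g. (\<forall>x. 0 \<le> g x \<and> g x \<le> 1) \<and> (\<lambda>x. g x powr p) summable_on UNIV
     \<and> (\<Sum>\<^sub>\<infinity>x. g x powr p) \<le> 1}"

lemma profilesI:
  assumes "\<And>x. 0 \<le> g x" "\<And>x. g x \<le> 1" "\<And>F. finite F \<Longrightarrow> (\<Sum>x\<in>F. g x powr p) \<le> 1"
  shows "g \<in> profiles p"
  using assms summable_on_of_bounded_sums[of "\<lambda>x. g x powr p" 1] by (auto simp: profiles_def)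

lemma profiles_sum_le:
  assumes "g \<in> profiles p" "finite F"
  shows "(\<Sum>x\<in>F. g x powr p) \<le> 1"
  using assms finite_sum_le_infsum[of "\<lambda>x. g x powr p" UNIV F] by (force simp: profiles_def)

text \<open>
  This inequality is where \<open>p \<le> 2\<close> and the bound 1 on the values enter: a profile lies in the unit
  ball of the 2-norm.
\<close>
lemma square_le_powr:
  fixes x p :: real
  assumes "0 \<le> x" "x \<le> 1" "p \<le> 2"
  shows "x\<^sup>2 \<le> x powr p"
proof (cases "x = 0")
  case False
  then have "x powr 2 \<le> x powr p" using assms by (intro powr_mono') auto
  then show ?thesis using False assms by (simp add: powr_numeral)
qed simp

lemma profiles_square:
  assumes g: "g \<in> profiles p" and p: "p \<le> 2"
  shows "(\<lambda>x. (g x)\<^sup>2) summable_on UNIV" "(\<Sum>\<^sub>\<infinity>x. (g x)\<^sup>2) \<le> 1"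
proof -
  have "(\<Sum>x\<in>F. (g x)\<^sup>2) \<le> 1" if "finite F" for F
  proof -
    have "(\<Sum>x\<in>F. (g x)\<^sup>2) \<le> (\<Sum>x\<in>F. g x powr p)"
      using g p by (intro sum_mono square_le_powr) (auto simp: profiles_def)
    then show ?thesis using profiles_sum_le[OF g that] by simp
  qed
  then show "(\<lambda>x. (g x)\<^sup>2) summable_on UNIV" "(\<Sum>\<^sub>\<infinity>x. (g x)\<^sup>2) \<le> 1"
    using summable_on_of_bounded_sums[OF zero_le_power2, of g 1] by auto
qed

definition corr_symbol :: "('g::group_add \<times> nat \<Rightarrow> real) \<Rightarrow> 'g \<Rightarrow> complex" where
  "corr_symbol g s = of_real (corr g s)"

lemma multiplier_bound_profile:
  assumes "g \<in> profiles p" "p \<le> 2"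
  shows "multiplier_bound (corr_symbol g) 1"
  unfolding corr_symbol_def
  by (rule multiplier_bound_mono[OF multiplier_bound_corr]) (use profiles_square[OF assms] in auto)

definition fibres :: "nat set \<Rightarrow> ('g \<times> nat \<Rightarrow> real) \<Rightarrow> 'g \<times> nat \<Rightarrow> real" where
  "fibres K g x = (if snd x \<in> K then g x else 0)"

lemma fibres_square_summable:
  assumes "(\<lambda>x. (g x)\<^sup>2) summable_on UNIV"
  shows "(\<lambda>x. (fibres K g x)\<^sup>2) summable_on UNIV"
  by (rule summable_on_comparison_test[OF assms]) (auto simp: fibres_def)

text \<open>
  Translation preserves the copies of the group, so distinct copies do not interact.
\<close>
lemma corr_fibres_Un:
  assumes "(\<lambda>x. (g x)\<^sup>2) summable_on UNIV" "K \<inter> L = {}"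
  shows "corr (fibres (K \<union> L) g) s = corr (fibres K g) s + corr (fibres L g) s"
proof -
  have "fibres (K \<union> L) g x * fibres (K \<union> L) g (shift s x)
    = fibres K g x * fibres K g (shift s x) + fibres L g x * fibres L g (shift s x)" for x
    using assms(2) by (auto simp: fibres_def shift_def)
  then show ?thesis
    unfolding corr_def using assms(1)
    by (simp add: infsum_add corr_summable fibres_square_summable)
qed

lemma corr_fibres_finite:
  assumes "(\<lambda>x. (g x)\<^sup>2) summable_on UNIV" "finite J"
  shows "corr (fibres J g) s = (\<Sum>i\<in>J. corr (fibres {i} g) s)"
  using assms(2)
proof (induction J)
  case empty
  show ?case by (simp add: corr_def fibres_def)
next
  case (insert i J)
  then show ?case using corr_fibres_Un[OF assms(1), of "{i}" J] by simp
qed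

lemma Phi_eq_corr:
  fixes f :: "'g::group_add \<Rightarrow> real"
  assumes "(\<lambda>t. (f t)\<^sup>2) summable_on UNIV"
  shows "Phi (\<lambda>x. complex_of_real (f x)) s = corr_symbol (\<lambda>x. if snd x = i then f (fst x) else 0) s"
proof -
  have inj: "inj (\<lambda>t :: 'g. (t, i))" by (simp add: inj_on_def)
  let ?g = "\<lambda>x. if snd x = i then f (fst x) else 0"
  have "(\<lambda>t. (f (t + s))\<^sup>2) summable_on UNIV"
    using assms
    by (subst summable_on_reindex_bij_betw[of "\<lambda>t. t + s" UNIV UNIV "\<lambda>t. (f t)\<^sup>2"])
      (auto intro!: bij_betw_byWitness[of _ "\<lambda>t. t - s"] simp: add.assoc)
  from real_Cauchy_Schwarz_infsum(2)[OF assms this]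
  have s: "(\<lambda>t. f t * f (t + s)) summable_on UNIV" .
  have "corr ?g s = (\<Sum>\<^sub>\<infinity>x\<in>range (\<lambda>t. (t, i)). ?g x * ?g (shift s x))"
    unfolding corr_def by (rule infsum_cong_neutral) (auto simp: shift_def)
  also have "\<dots> = (\<Sum>\<^sub>\<infinity>t. f t * f (t + s))"
    by (simp add: infsum_reindex[OF inj] o_def shift_def)
  finally show ?thesis
    unfolding Phi_def corr_symbol_def
    by (auto intro!: infsumI simp: has_sum_of_real_iff s simp flip: of_real_mult)
qed

lemma lp_norm_powr:
  assumes "1 \<le> p"
  shows "lp_norm p f powr p = (\<Sum>\<^sub>\<infinity>x. \<bar>f x\<bar> powr p)"
  using assms by (simp add: lp_norm_def powr_powr infsum_nonneg)

section \<open>Collections of orbits as profiles\<close>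

lemma subunit_p_square_summable:
  fixes f :: "'g \<Rightarrow> real"
  assumes "f \<in> subunit_p p" "p \<le> 2"
  shows "(\<lambda>t. (f t)\<^sup>2) summable_on UNIV"
proof (rule summable_on_comparison_test)
  show "(\<lambda>t. \<bar>f t\<bar> powr p) summable_on UNIV" using assms by (simp add: subunit_p_def)
  show "(f t)\<^sup>2 \<le> \<bar>f t\<bar> powr p" for t
    using assms square_le_powr[of "f t" p] by (auto simp: subunit_p_def image_subset_iff)
qed auto

lemma Phi_translate: "Phi (\<lambda>x. f (- s + x)) = Phi (f :: 'g::group_add \<Rightarrow> complex)"
proof (rule ext)
  fix r
  show "Phi (\<lambda>x. f (- s + x)) r = Phi f r"
    unfolding Phi_def
    using infsum_reindex_bij_betw[OF translate_bij[of "- s"], of "\<lambda>t. f t * cnj (f (t + r))"]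
    by (simp add: add.assoc)
qed

text \<open>
  The correlation is invariant under left translation, so the chosen representative is immaterial.
\<close>
lemma orbit_multiplier_orbit: "orbit_multiplier A (orbit \<alpha>) = Phi_multiplier A \<alpha>"
proof -
  have "\<exists>\<beta>. \<beta> \<in> orbit \<alpha>" by (auto simp: orbit_def)
  then have "(SOME \<beta>. \<beta> \<in> orbit \<alpha>) \<in> orbit \<alpha>" by (rule someI_ex)
  then obtain s where "(SOME \<beta>. \<beta> \<in> orbit \<alpha>) = (\<lambda>x. \<alpha> (- s + x))" by (auto simp: orbit_def)
  then show ?thesis
    unfolding orbit_multiplier_def Phi_multiplier_def
    using Phi_translate[of "\<lambda>x. complex_of_real (\<alpha> x)" s] by simp
qed

text \<open>
  The remainder of the series that defines \<open>M_xi\<close>: the multiplier of the omitted fibres has norm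
  at most their total square mass.
\<close>
lemma infsum_square_fibres_tendsto:
  assumes g: "(\<lambda>x. (g x)\<^sup>2) summable_on UNIV" and supp: "\<And>x. snd x \<notin> D \<Longrightarrow> g x = 0"
  shows "((\<lambda>J. \<Sum>\<^sub>\<infinity>x. (fibres (- J) g x)\<^sup>2) \<longlongrightarrow> 0) (finite_subsets_at_top D)"
proof (rule tendstoI)
  fix e :: real assume "0 < e"
  then have "0 < e / 2" by simp
  from infsum_finite_approximation[OF g this] obtain X where X: "finite X"
    "dist (\<Sum>x\<in>X. (g x)\<^sup>2) (\<Sum>\<^sub>\<infinity>x. (g x)\<^sup>2) \<le> e / 2" by blast
  have "dist (\<Sum>\<^sub>\<infinity>x. (fibres (- J) g x)\<^sup>2) 0 < e" if J: "snd ` X \<inter> D \<subseteq> J" for J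
  proof -
    have "(\<Sum>\<^sub>\<infinity>x. (fibres (- J) g x)\<^sup>2) \<le> e / 2"
    proof (rule summable_on_of_bounded_sums)
      fix F :: "('a \<times> nat) set" assume F: "finite F"
      have "(\<Sum>x\<in>F. (fibres (- J) g x)\<^sup>2) \<le> (\<Sum>x\<in>F. if x \<in> X then 0 else (g x)\<^sup>2)"
        using J supp by (intro sum_mono) (auto simp: fibres_def)
      also have "\<dots> = (\<Sum>x\<in>F - X. (g x)\<^sup>2)"
        using F by (intro sum.mono_neutral_cong_right) auto
      also have "\<dots> = (\<Sum>x\<in>(F - X) \<union> X. (g x)\<^sup>2) - (\<Sum>x\<in>X. (g x)\<^sup>2)"
        using F X(1) by (subst sum.union_disjoint) auto
      also have "\<dots> \<le> (\<Sum>\<^sub>\<infinity>x. (g x)\<^sup>2) - (\<Sum>x\<in>X. (g x)\<^sup>2)"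
        using F X(1) g by (intro diff_right_mono finite_sum_le_infsum) auto
      also have "\<dots> \<le> e / 2" using X(2) unfolding dist_real_def by linarith
      finally show "(\<Sum>x\<in>F. (fibres (- J) g x)\<^sup>2) \<le> e / 2" .
    qed simp
    moreover have "0 \<le> (\<Sum>\<^sub>\<infinity>x. (fibres (- J) g x)\<^sup>2)" by (rule infsum_nonneg) simp
    ultimately show ?thesis using \<open>0 < e\<close> by simp
  qed
  then show "\<forall>\<^sub>F J in finite_subsets_at_top D. dist (\<Sum>\<^sub>\<infinity>x. (fibres (- J) g x)\<^sup>2) 0 < e"
    using X(1) unfolding eventually_finite_subsets_at_top
    by (intro exI[of _ "snd ` X \<inter> D"]) auto
qed

definition profile_of :: "nat set \<Rightarrow> (nat \<Rightarrow> 'g \<Rightarrow> real) \<Rightarrow> 'g \<times> nat \<Rightarrow> real" where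
  "profile_of D \<alpha> x = (if snd x \<in> D then \<alpha> (snd x) (fst x) else 0)"

lemma profile_of_profiles:
  fixes \<alpha> :: "nat \<Rightarrow> 'g \<Rightarrow> real"
  assumes p: "1 \<le> p" and \<alpha>: "\<And>i. i \<in> D \<Longrightarrow> \<alpha> i \<in> subunit_p p"
    and s: "(\<lambda>i. lp_norm p (\<alpha> i) powr p) summable_on D" "(\<Sum>\<^sub>\<infinity>i\<in>D. lp_norm p (\<alpha> i) powr p) \<le> 1"
  shows "profile_of D \<alpha> \<in> profiles p"
proof (rule profilesI)
  have \<alpha>': "0 \<le> \<alpha> i t" "\<alpha> i t \<le> 1" if "i \<in> D" for i t
    using \<alpha>[OF that] by (auto simp: subunit_p_def image_subset_iff)
  show "0 \<le> profile_of D \<alpha> x" "profile_of D \<alpha> x \<le> 1" for x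
    using \<alpha>' by (auto simp: profile_of_def)
  fix F :: "('g \<times> nat) set" assume F: "finite F"
  have "(\<Sum>x\<in>F. profile_of D \<alpha> x powr p) \<le> (\<Sum>x\<in>fst ` F \<times> snd ` F. profile_of D \<alpha> x powr p)"
    using F subset_fst_snd[of F] by (intro sum_mono2) auto
  also have "\<dots> = (\<Sum>i\<in>snd ` F. \<Sum>t\<in>fst ` F. profile_of D \<alpha> (t, i) powr p)"
    by (subst sum.swap) (simp add: sum.cartesian_product case_prod_beta)
  also have "\<dots> = (\<Sum>i\<in>snd ` F \<inter> D. \<Sum>t\<in>fst ` F. \<bar>\<alpha> i t\<bar> powr p)"
    using F \<alpha>' p by (intro sum.mono_neutral_cong_right) (auto simp: profile_of_def)
  also have "\<dots> \<le> (\<Sum>i\<in>snd ` F \<inter> D. lp_norm p (\<alpha> i) powr p)"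
    unfolding lp_norm_powr[OF p]
    using F \<alpha> by (intro sum_mono finite_sum_le_infsum) (auto simp: subunit_p_def)
  also have "\<dots> \<le> (\<Sum>\<^sub>\<infinity>i\<in>D. lp_norm p (\<alpha> i) powr p)"
    using F s by (intro finite_sum_le_infsum) auto
  finally show "(\<Sum>x\<in>F. profile_of D \<alpha> x powr p) \<le> 1" using s by simp
qed

context multiplier_algebra begin

lemma BL_linear_bound:
  assumes "M \<in> BL A"
  shows "\<exists>C. \<forall>T\<in>A. norm (M T) \<le> C * norm T"
  using assms by (auto simp: BL_def)

lemma BL_ext:
  assumes M: "M \<in> BL A" and N: "N \<in> BL A"
    and eq: "\<And>T. T \<in> A \<Longrightarrow> norm T \<le> 1 \<Longrightarrow> M T = N T"
  shows "M = N"
proof (rule PiE_ext[of M A "\<lambda>_. A" N])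
  show "M \<in> A \<rightarrow>\<^sub>E A" "N \<in> A \<rightarrow>\<^sub>E A" using M N by (auto simp: BL_def)
  fix T assume T: "T \<in> A"
  \<comment> \<open>scaling by \<open>norm T + 1\<close> instead of \<open>norm T\<close> avoids the case \<open>T = 0\<close>\<close>
  define r where "r = norm T + 1"
  have r: "0 < r" by (simp add: r_def add_nonneg_pos)
  let ?T = "(1 / r) *\<^sub>R T"
  have "norm ?T \<le> 1" using r by (simp add: r_def)
  then have e: "M ?T = N ?T" using eq scaleR_A[OF T] by blast
  have sc: "L T = r *\<^sub>R L ?T" if "L \<in> BL A" for L
  proof -
    have "L (cscale_op (of_real r) o\<^sub>L ?T) = cscale_op (of_real r) o\<^sub>L L ?T"
      using that scaleR_A[OF T] by (simp add: BL_def)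
    then show ?thesis using r by (simp add: cscale_op_of_real)
  qed
  show "M T = N T" using sc[OF M] sc[OF N] e by simp
qed

text \<open>
  Operators on the algebra that are limits of the same net in the operator norm agree; boundedness
  of the partial sums is needed for \<open>opnorm_on\<close> to be a genuine supremum.
\<close>
lemma M_xi_unique:
  assumes "M \<in> BL A"
    and lim: "((\<lambda>J. opnorm_on A (\<lambda>T. M T - (\<Sum>i\<in>J. m i T))) \<longlongrightarrow> 0) (finite_subsets_at_top D)"
    and "N \<in> BL A"
    and lim': "((\<lambda>J. opnorm_on A (\<lambda>T. N T - (\<Sum>i\<in>J. m i T))) \<longlongrightarrow> 0) (finite_subsets_at_top D)"
    and m: "\<And>J. finite J \<Longrightarrow> J \<subseteq> D \<Longrightarrow> \<exists>C. \<forall>T\<in>A. norm (\<Sum>i\<in>J. m i T) \<le> C * norm T"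
  shows "M = N"
proof (rule BL_ext)
  fix T assume T: "T \<in> A" "norm T \<le> 1"
  have bd: "\<exists>C. \<forall>T\<in>A. norm (L T - (\<Sum>i\<in>J. m i T)) \<le> C * norm T"
    if L: "L \<in> BL A" and J: "finite J" "J \<subseteq> D" for L J
  proof -
    obtain c where c: "\<And>T. T \<in> A \<Longrightarrow> norm (L T) \<le> c * norm T" using BL_linear_bound[OF L] by blast
    obtain C where C: "\<And>T. T \<in> A \<Longrightarrow> norm (\<Sum>i\<in>J. m i T) \<le> C * norm T" using m[OF J] by blast
    have "norm (L T - (\<Sum>i\<in>J. m i T)) \<le> (c + C) * norm T" if "T \<in> A" for T
      using norm_triangle_ineq4[of "L T" "\<Sum>i\<in>J. m i T"] c[OF that] C[OF that] by (simp add: distrib_right)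
    then show ?thesis by blast
  qed
  let ?o = "\<lambda>L J. opnorm_on A (\<lambda>T. L T - (\<Sum>i\<in>J. m i T))"
  have le: "norm (L T - (\<Sum>i\<in>J. m i T)) \<le> ?o L J" if "L \<in> BL A" "finite J" "J \<subseteq> D" for L J
    using bd[OF that] norm_le_opnorm_on[of "\<lambda>T. L T - (\<Sum>i\<in>J. m i T)" _ T] T by blast
  have "\<forall>\<^sub>F J in finite_subsets_at_top D. norm (M T - N T) \<le> ?o M J + ?o N J"
  proof (rule eventually_finite_subsets_at_top_weakI)
    fix J assume J: "finite J" "J \<subseteq> D"
    have "norm (M T - N T) = norm ((M T - (\<Sum>i\<in>J. m i T)) - (N T - (\<Sum>i\<in>J. m i T)))" by simp
    also have "\<dots> \<le> norm (M T - (\<Sum>i\<in>J. m i T)) + norm (N T - (\<Sum>i\<in>J. m i T))"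
      by (rule norm_triangle_ineq4)
    also have "\<dots> \<le> ?o M J + ?o N J" using J assms by (intro add_mono le) auto
    finally show "norm (M T - N T) \<le> ?o M J + ?o N J" .
  qed
  moreover have "((\<lambda>J. ?o M J + ?o N J) \<longlongrightarrow> 0 + 0) (finite_subsets_at_top D)"
    by (intro tendsto_add lim lim')
  ultimately have "norm (M T - N T) \<le> 0 + 0"
    by (intro tendsto_lowerbound) auto
  then show "M T = N T" by simp
qed (use assms in auto)

lemma M_xi_eq:
  assumes p: "1 \<le> p" "p \<le> 2"
    and \<alpha>: "\<And>i. i \<in> dom \<xi> \<Longrightarrow> \<alpha> i \<in> subunit_p p \<and> \<xi> i = Some (orbit (\<alpha> i))"
    and g: "profile_of (dom \<xi>) \<alpha> \<in> profiles p"
  shows "M_xi A \<xi> = schur A (kernel_of (corr_symbol (profile_of (dom \<xi>) \<alpha>)))"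
proof -
  let ?D = "dom \<xi>" and ?g = "profile_of (dom \<xi>) \<alpha>"
  let ?M = "schur A (kernel_of (corr_symbol ?g))"
  let ?m = "\<lambda>i. orbit_multiplier A (the (\<xi> i))"
  note sq = profiles_square[OF g p(2)]
  have mbf: "multiplier_bound (corr_symbol (fibres K ?g)) (\<Sum>\<^sub>\<infinity>x. (fibres K ?g x)\<^sup>2)" for K
    unfolding corr_symbol_def by (intro multiplier_bound_corr fibres_square_summable sq)
  have m: "?m i = schur A (kernel_of (corr_symbol (fibres {i} ?g)))" if i: "i \<in> ?D" for i
  proof -
    have "(\<lambda>t. (\<alpha> i t)\<^sup>2) summable_on UNIV"
      using subunit_p_square_summable \<alpha>[OF i] p by blast
    from Phi_eq_corr[OF this, of _ i]
    have "Phi (\<lambda>x. complex_of_real (\<alpha> i x)) = corr_symbol (\<lambda>x. if snd x = i then \<alpha> i (fst x) else 0)"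
      by (rule ext)
    also have "(\<lambda>x. if snd x = i then \<alpha> i (fst x) else 0) = fibres {i} ?g"
      using i by (auto simp: fun_eq_iff fibres_def profile_of_def)
    finally show ?thesis
      using \<alpha>[OF i] by (simp add: orbit_multiplier_orbit Phi_multiplier_def)
  qed
  have M: "?M \<in> BL A" by (rule schur_BL[OF multiplier_bound_profile[OF g p(2)]])
  have part: "(\<Sum>i\<in>J. ?m i T) = schur_mult (corr_symbol (fibres J ?g)) T"
    if J: "finite J" "J \<subseteq> ?D" and T: "T \<in> A" for J T
  proof -
    have "(\<Sum>i\<in>J. ?m i T) = (\<Sum>i\<in>J. schur_mult (corr_symbol (fibres {i} ?g)) T)"
      by (rule sum.cong[OF refl]) (simp only: m[OF subsetD[OF J(2)]] schur_eq restrict_apply' T)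
    also have "\<dots> = schur_mult (\<lambda>s. \<Sum>i\<in>J. corr_symbol (fibres {i} ?g) s) T"
      by (rule schur_mult_sum_left[symmetric, OF mbf A_bopD[OF T]])
    also have "(\<lambda>s. \<Sum>i\<in>J. corr_symbol (fibres {i} ?g) s) = corr_symbol (fibres J ?g)"
      by (rule ext) (simp add: corr_symbol_def corr_fibres_finite[OF sq(1) J(1)])
    finally show ?thesis .
  qed
  have lim: "((\<lambda>J. opnorm_on A (\<lambda>T. ?M T - (\<Sum>i\<in>J. ?m i T))) \<longlongrightarrow> 0) (finite_subsets_at_top ?D)"
  proof (rule tendsto_sandwich[OF _ _ tendsto_const])
    show "((\<lambda>J. \<Sum>\<^sub>\<infinity>x. (fibres (- J) ?g x)\<^sup>2) \<longlongrightarrow> 0) (finite_subsets_at_top ?D)"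
      by (rule infsum_square_fibres_tendsto[OF sq(1)]) (simp add: profile_of_def)
    have key: "norm (?M T - (\<Sum>i\<in>J. ?m i T)) \<le> (\<Sum>\<^sub>\<infinity>x. (fibres (- J) ?g x)\<^sup>2) * norm T"
      if J: "finite J" "J \<subseteq> ?D" and T: "T \<in> A" for J T
    proof -
      have "?M T - (\<Sum>i\<in>J. ?m i T) = schur_mult (corr_symbol ?g) T - schur_mult (corr_symbol (fibres J ?g)) T"
        using part[OF J T] T by (simp add: schur_eq)
      also have "\<dots> = schur_mult (\<lambda>s. corr_symbol ?g s - corr_symbol (fibres J ?g) s) T"
        by (rule schur_mult_diff_left[symmetric, OF multiplier_bound_profile[OF g p(2)] mbf A_bopD[OF T]])
      also have "(\<lambda>s. corr_symbol ?g s - corr_symbol (fibres J ?g) s) = corr_symbol (fibres (- J) ?g)"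
      proof (rule ext)
        fix s
        have "?g = fibres (J \<union> - J) ?g" by (auto simp: fibres_def fun_eq_iff)
        then have "corr ?g s = corr (fibres J ?g) s + corr (fibres (- J) ?g) s"
          using corr_fibres_Un[OF sq(1), of J "- J" s] by simp
        then show "corr_symbol ?g s - corr_symbol (fibres J ?g) s = corr_symbol (fibres (- J) ?g) s"
          by (simp add: corr_symbol_def)
      qed
      finally show ?thesis using norm_schur_mult_le[OF mbf A_bopD[OF T]] by simp
    qed
    show "\<forall>\<^sub>F J in finite_subsets_at_top ?D. opnorm_on A (\<lambda>T. ?M T - (\<Sum>i\<in>J. ?m i T))
        \<le> (\<Sum>\<^sub>\<infinity>x. (fibres (- J) ?g x)\<^sup>2)"
      by (intro eventually_finite_subsets_at_top_weakI opnorm_on_le key infsum_nonneg) auto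
    show "\<forall>\<^sub>F J in finite_subsets_at_top ?D. 0 \<le> opnorm_on A (\<lambda>T. ?M T - (\<Sum>i\<in>J. ?m i T))"
      by (intro eventually_finite_subsets_at_top_weakI opnorm_on_nonneg[OF key])
  qed
  have pb: "\<exists>C. \<forall>T\<in>A. norm (\<Sum>i\<in>J. ?m i T) \<le> C * norm T" if "finite J" "J \<subseteq> ?D" for J
    using norm_schur_mult_le[OF mbf[of J] A_bopD] part[OF that] by auto
  show ?thesis
    unfolding M_xi_def
  proof (rule the_equality)
    fix N
    assume N: "N \<in> BL A \<and> ((\<lambda>J. opnorm_on A (\<lambda>T. N T - (\<Sum>i\<in>J. ?m i T))) \<longlongrightarrow> 0) (finite_subsets_at_top ?D)"
    then show "N = ?M" using M_xi_unique[OF _ _ M lim pb] by blast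
  qed (use M lim in blast)
qed

text \<open>
  A collection of orbits becomes a profile by placing the \<open>i\<close>-th function on the \<open>i\<close>-th copy of
  the group. Conversely a profile is the collection of its fibres, indexed by all of \<open>nat\<close>; zero
  fibres are harmless, because they contribute neither mass nor correlation.
\<close>
lemma X_class_eq:
  assumes p: "1 \<le> p" "p \<le> 2"
  shows "X_class A p = (\<lambda>g. schur A (kernel_of (corr_symbol g))) ` profiles p"
proof (intro antisym subsetI)
  fix M assume "M \<in> X_class A p"
  then obtain \<xi> where M: "M = M_xi A \<xi>" and "\<xi> \<in> orbit_collections p"
    by (auto simp: X_class_def)
  then obtain \<alpha> where \<alpha>: "\<forall>i\<in>dom \<xi>. \<alpha> i \<in> subunit_p p \<and> \<xi> i = Some (orbit (\<alpha> i))"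
      "(\<lambda>i. lp_norm p (\<alpha> i) powr p) summable_on dom \<xi>"
      "(\<Sum>\<^sub>\<infinity>i\<in>dom \<xi>. lp_norm p (\<alpha> i) powr p) \<le> 1"
    by (auto simp: orbit_collections_def)
  then have "profile_of (dom \<xi>) \<alpha> \<in> profiles p" using p by (intro profile_of_profiles) auto
  with M_xi_eq[OF p, of \<xi> \<alpha>] \<alpha> M
  show "M \<in> (\<lambda>g. schur A (kernel_of (corr_symbol g))) ` profiles p" by blast
next
  fix M assume "M \<in> (\<lambda>g. schur A (kernel_of (corr_symbol g))) ` profiles p"
  then obtain g :: "'g \<times> nat \<Rightarrow> real"
    where g: "g \<in> profiles p" and M: "M = schur A (kernel_of (corr_symbol g))" by auto
  define \<alpha> where "\<alpha> i t = g (t, i)" for i t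
  define \<xi> where "\<xi> i = Some (orbit (\<alpha> i))" for i
  have dom: "dom \<xi> = UNIV" by (auto simp: \<xi>_def)
  have pg: "profile_of UNIV \<alpha> = g" by (auto simp: profile_of_def \<alpha>_def)
  have g01: "0 \<le> g x" "g x \<le> 1" for x using g unfolding profiles_def by blast+
  have inj: "inj_on (\<lambda>t. (t, i)) F" for i and F :: "'g set" by (auto simp: inj_on_def)
  have fin: "(\<Sum>t\<in>F. \<alpha> i t powr p) \<le> 1" if "finite F" for i F
    using profiles_sum_le[OF g, of "(\<lambda>t. (t, i)) ` F"] that
    by (simp add: sum.reindex[OF inj] o_def \<alpha>_def)
  have abs: "\<bar>\<alpha> i t\<bar> = \<alpha> i t" for i t using g01 by (simp add: \<alpha>_def)
  have s: "(\<lambda>t. \<alpha> i t powr p) summable_on UNIV" "(\<Sum>\<^sub>\<infinity>t. \<alpha> i t powr p) \<le> 1" for i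
    using summable_on_of_bounded_sums[OF _ fin] by auto
  have "\<alpha> i \<in> subunit_p p" for i
  proof -
    have "lp_norm p (\<alpha> i) \<le> 1"
      unfolding lp_norm_def abs using s(2)[of i] p infsum_nonneg[of UNIV "\<lambda>t. \<alpha> i t powr p"]
      by (intro powr_le1) (auto intro: infsum_nonneg)
    then show ?thesis using s(1) g01 by (auto simp: subunit_p_def abs) (auto simp: \<alpha>_def)
  qed
  moreover have J: "(\<Sum>i\<in>J. lp_norm p (\<alpha> i) powr p) \<le> 1" if J: "finite J" for J
  proof -
    have "(\<Sum>i\<in>J. lp_norm p (\<alpha> i) powr p) = (\<Sum>\<^sub>\<infinity>t. \<Sum>i\<in>J. \<alpha> i t powr p)"
      unfolding lp_norm_powr[OF p(1)] abs using J s by (subst infsum_finite_sum(2)) auto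
    also have "\<dots> \<le> 1"
    proof (rule summable_on_of_bounded_sums)
      fix F :: "'g set" assume "finite F"
      then show "(\<Sum>t\<in>F. \<Sum>i\<in>J. \<alpha> i t powr p) \<le> 1"
        using profiles_sum_le[OF g, of "F \<times> J"] J by (simp add: sum.cartesian_product \<alpha>_def case_prod_beta)
    qed (auto intro: sum_nonneg)
    finally show ?thesis .
  qed
  have "(\<lambda>i. lp_norm p (\<alpha> i) powr p) summable_on UNIV" "(\<Sum>\<^sub>\<infinity>i. lp_norm p (\<alpha> i) powr p) \<le> 1"
    using summable_on_of_bounded_sums[OF _ J] by auto
  ultimately have "\<xi> \<in> orbit_collections p"
    unfolding orbit_collections_def mem_Collect_eq dom
    by (intro exI[of _ \<alpha>]) (simp add: \<xi>_def)
  moreover have "M = M_xi A \<xi>"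
    using M_xi_eq[OF p, of \<xi> \<alpha>] g calculation unfolding dom pg M
    using \<open>\<And>i. \<alpha> i \<in> subunit_p p\<close> by (simp add: \<xi>_def)
  ultimately show "M \<in> X_class A p" by (auto simp: X_class_def)
qed

lemma tube_defect_profile:
  assumes "finite F" "g \<in> profiles p" "p \<le> 2"
  shows "tube_defect A F (schur A (kernel_of (corr_symbol g))) = defect F (corr_symbol g)"
  by (rule tube_defect_schur[OF assms(1) multiplier_bound_profile[OF assms(2,3)]])

end

definition single_profile :: "('g \<Rightarrow> real) \<Rightarrow> 'g \<times> nat \<Rightarrow> real" where
  "single_profile f x = (if snd x = 0 then f (fst x) else 0)"

lemma single_profile_profiles:
  fixes f :: "'g \<Rightarrow> real"
  assumes "f \<in> unit_p p" "1 \<le> p"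
  shows "single_profile f \<in> profiles p"
proof -
  have f: "lp_norm p f = 1" "(\<lambda>x. \<bar>f x\<bar> powr p) summable_on UNIV" "f \<in> subunit_p p"
    using assms by (auto simp: unit_p_def subunit_p_def)
  have "profile_of {0} (\<lambda>_. f) \<in> profiles p"
    using assms f by (intro profile_of_profiles) auto
  also have "profile_of {0} (\<lambda>_. f) = single_profile f"
    by (auto simp: profile_of_def single_profile_def)
  finally show ?thesis .
qed

lemma Phi_multiplier_single:
  fixes f :: "'g::group_add \<Rightarrow> real"
  assumes f: "f \<in> unit_p p" and p: "1 \<le> p" "p \<le> 2"
  shows "Phi_multiplier A f = schur A (kernel_of (corr_symbol (single_profile f)))"
proof -
  have "f \<in> subunit_p p" using f by (simp add: unit_p_def subunit_p_def)
  then have "(\<lambda>t. (f t)\<^sup>2) summable_on UNIV" using p(2) by (rule subunit_p_square_summable)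
  from Phi_eq_corr[OF this, of _ 0]
  show ?thesis unfolding Phi_multiplier_def single_profile_def[abs_def] by presburger
qed

section \<open>Compactness of the set of profiles\<close>

text \<open>
  Only finitely many values of a profile exceed a positive bound, so one can repeatedly pick a
  point of largest value among those not yet listed. The \<open>k + 1\<close> values listed up to step \<open>k\<close>
  dominate every later value, and their \<open>p\<close>-th powers have sum at most 1. Points of value 0 fill
  the list if the support is finite.
\<close>
lemma decreasing_enumeration:
  fixes g :: "'g \<times> nat \<Rightarrow> real"
  assumes g: "g \<in> profiles p" and p: "1 \<le> p"
  shows "\<exists>z :: nat \<Rightarrow> 'g \<times> nat. inj z \<and> (\<forall>k x. x \<notin> z ` {..<k} \<longrightarrow> g x powr p \<le> 1 / real (Suc k))"
proof -
  have g0: "0 \<le> g x" for x using g unfolding profiles_def by blast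
  have "\<exists>c. finite Z \<longrightarrow> c \<notin> Z \<and> (\<forall>x. x \<notin> Z \<longrightarrow> g x \<le> g c)" for Z
  proof (cases "finite Z \<and> (\<exists>x. x \<notin> Z \<and> 0 < g x)")
    case True
    then obtain x0 where x0: "x0 \<notin> Z" "0 < g x0" by blast
    \<comment> \<open>the maximum is sought among the finitely many points that are at least as good as \<open>x0\<close>\<close>
    define Y where "Y = {y. y \<notin> Z \<and> g x0 \<le> g y}"
    have "card F \<le> nat \<lfloor>1 / g x0 powr p\<rfloor>" if F: "F \<subseteq> Y" "finite F" for F
    proof -
      have "real (card F) * g x0 powr p = (\<Sum>y\<in>F. g x0 powr p)" by simp
      also have "\<dots> \<le> (\<Sum>y\<in>F. g y powr p)"
        using F x0 p by (intro sum_mono powr_mono2) (auto simp: Y_def)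
      also have "\<dots> \<le> 1" by (rule profiles_sum_le[OF g F(2)])
      finally have "real (card F) \<le> 1 / g x0 powr p" using x0 by (simp add: field_simps)
      then show ?thesis by linarith
    qed
    then have "finite Y" using finite_if_finite_subsets_card_bdd[of Y] by blast
    moreover have "x0 \<in> Y" using x0 by (simp add: Y_def)
    ultimately have "Max (g ` Y) \<in> g ` Y" "\<forall>y\<in>Y. g y \<le> Max (g ` Y)" by (auto intro!: Max_in)
    then obtain c where c: "c \<in> Y" "\<And>y. y \<in> Y \<Longrightarrow> g y \<le> g c" by auto
    have "g x \<le> g c" if "x \<notin> Z" for x
      using c that by (cases "x \<in> Y") (auto simp: Y_def)
    with c(1) show ?thesis unfolding Y_def by blast
  next
    case False
    show ?thesis
    proof (cases "finite Z")
      case True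
      have "infinite (UNIV :: ('g \<times> nat) set)" by (simp add: finite_prod)
      then obtain c where c: "c \<notin> Z" using True ex_new_if_finite by blast
      have "g x \<le> g c" if "x \<notin> Z" for x
        using False True that g0[of c] by (meson not_less order_trans)
      with c show ?thesis by blast
    qed simp
  qed
  then obtain c where c: "\<And>Z. finite Z \<Longrightarrow> c Z \<notin> Z" "\<And>Z x. finite Z \<Longrightarrow> x \<notin> Z \<Longrightarrow> g x \<le> g (c Z)"
    by metis
  \<comment> \<open>the set of points listed before step \<open>n\<close>, and the point listed at step \<open>n\<close>\<close>
  define S where "S = rec_nat {} (\<lambda>_ Z. insert (c Z) Z)"
  define z where "z n = c (S n)" for n
  have S: "S 0 = {}" "S (Suc n) = insert (z n) (S n)" for n by (auto simp: S_def z_def)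
  have Sz: "S n = z ` {..<n}" for n by (induction n) (auto simp: S lessThan_Suc)
  have fin: "finite (S n)" for n by (simp add: Sz)
  have zS: "z n \<notin> S n" for n unfolding z_def by (rule c(1)[OF fin])
  have inj: "inj z"
    by (rule linorder_injI) (metis Sz zS imageI lessThan_iff)
  have max: "g x \<le> g (z n)" if "x \<notin> S n" for x n
    unfolding z_def by (rule c(2)[OF fin that])
  have "g x powr p \<le> 1 / real (Suc k)" if x: "x \<notin> z ` {..<k}" for x k
  proof -
    have "g x \<le> g (z j)" if "j \<le> k" for j
      using x that by (intro max) (auto simp: Sz)
    then have "(\<Sum>j\<le>k. g x powr p) \<le> (\<Sum>j\<le>k. g (z j) powr p)"
      using g0 p by (intro sum_mono powr_mono2) auto
    also have "\<dots> = (\<Sum>y\<in>z ` {..k}. g y powr p)"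
      using inj by (simp add: sum.reindex inj_on_subset)
    also have "\<dots> \<le> 1" by (rule profiles_sum_le[OF g]) simp
    finally show ?thesis by (simp add: field_simps)
  qed
  with inj show ?thesis by blast
qed

text \<open>
  The discarded part \<open>v\<close> satisfies \<open>(v x)\<^sup>2 \<le> g x powr p * e powr ((2 - p) / p)\<close>, which is small
  in the 2-norm because \<open>p < 2\<close>; by Cauchy-Schwarz it changes the correlation by at most twice its
  2-norm. The bound depends on \<open>p\<close> and \<open>e\<close> only, and this uniformity drives the compactness proof.
\<close>
lemma corr_truncate:
  fixes g :: "'g::group_add \<times> nat \<Rightarrow> real"
  assumes g: "g \<in> profiles p" and p: "1 \<le> p" "p < 2"
    and small: "\<And>x. x \<notin> Z \<Longrightarrow> g x powr p \<le> e"
  shows "\<bar>corr g s - corr (\<lambda>x. if x \<in> Z then g x else 0) s\<bar> \<le> 2 * sqrt (e powr ((2 - p) / p))"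
proof -
  let ?t = "e powr ((2 - p) / p)"
  define u where "u x = (if x \<in> Z then g x else 0)" for x
  define v where "v x = (if x \<in> Z then 0 else g x)" for x
  have g0: "0 \<le> g x" for x using g unfolding profiles_def by blast
  have sq: "(\<lambda>x. (g x)\<^sup>2) summable_on UNIV" "(\<Sum>\<^sub>\<infinity>x. (g x)\<^sup>2) \<le> 1"
    using profiles_square[OF g] p by auto
  have v: "(v x)\<^sup>2 \<le> g x powr p * ?t" for x
  proof (cases "x \<in> Z \<or> g x = 0")
    case False
    then have gx: "0 < g x" "x \<notin> Z" using g0[of x] by auto
    have "(v x)\<^sup>2 = g x powr 2" using gx by (simp add: v_def powr_numeral)
    also have "\<dots> = g x powr p * (g x powr p) powr ((2 - p) / p)"
      using p by (simp add: powr_powr flip: powr_add)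
    also have "\<dots> \<le> g x powr p * ?t"
      using p small[OF gx(2)] by (intro mult_left_mono powr_mono2) auto
    finally show ?thesis .
  qed (auto simp: v_def)
  have "(\<Sum>x\<in>F. (v x)\<^sup>2) \<le> ?t" if F: "finite F" for F
  proof -
    have "(\<Sum>x\<in>F. (v x)\<^sup>2) \<le> (\<Sum>x\<in>F. g x powr p) * ?t"
      unfolding sum_distrib_right by (intro sum_mono v)
    also have "\<dots> \<le> 1 * ?t" by (intro mult_right_mono profiles_sum_le[OF g F]) simp
    finally show ?thesis by simp
  qed
  then have vs: "(\<lambda>x. (v x)\<^sup>2) summable_on UNIV" "(\<Sum>\<^sub>\<infinity>x. (v x)\<^sup>2) \<le> ?t"
    using summable_on_of_bounded_sums[of "\<lambda>x. (v x)\<^sup>2" ?t] by auto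
  have "(\<Sum>x\<in>F. (u x)\<^sup>2) \<le> 1" if F: "finite F" for F
  proof -
    have "(\<Sum>x\<in>F. (u x)\<^sup>2) \<le> (\<Sum>x\<in>F. (g x)\<^sup>2)" by (intro sum_mono) (auto simp: u_def)
    also have "\<dots> \<le> (\<Sum>\<^sub>\<infinity>x. (g x)\<^sup>2)" using F sq by (intro finite_sum_le_infsum) auto
    finally show ?thesis using sq by simp
  qed
  then have us: "(\<lambda>x. (u x)\<^sup>2) summable_on UNIV" "(\<Sum>\<^sub>\<infinity>x. (u x)\<^sup>2) \<le> 1"
    using summable_on_of_bounded_sums[of "\<lambda>x. (u x)\<^sup>2" 1] by auto
  have bd: "(\<lambda>x. a x * b x) summable_on UNIV \<and> \<bar>\<Sum>\<^sub>\<infinity>x. a x * b x\<bar> \<le> sqrt ?t"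
    if "(\<lambda>x. (a x)\<^sup>2) summable_on UNIV" "(\<Sum>\<^sub>\<infinity>x. (a x)\<^sup>2) \<le> c"
      "(\<lambda>x. (b x)\<^sup>2) summable_on UNIV" "(\<Sum>\<^sub>\<infinity>x. (b x)\<^sup>2) \<le> d" "c * d = ?t" "0 \<le> c" "0 \<le> d"
    for a b :: "'g \<times> nat \<Rightarrow> real" and c d
  proof -
    note cs = real_Cauchy_Schwarz_infsum[OF that(1,3)]
    have "\<bar>\<Sum>\<^sub>\<infinity>x. a x * b x\<bar> \<le> (\<Sum>\<^sub>\<infinity>x. \<bar>a x * b x\<bar>)"
      using norm_infsum_bound[of "\<lambda>x. a x * b x" UNIV] cs(1) by simp
    also have "\<dots> \<le> sqrt (\<Sum>\<^sub>\<infinity>x. (a x)\<^sup>2) * sqrt (\<Sum>\<^sub>\<infinity>x. (b x)\<^sup>2)" by (rule cs(3))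
    also have "\<dots> \<le> sqrt c * sqrt d"
      using that by (intro mult_mono real_sqrt_le_mono) (auto intro: infsum_nonneg)
    also have "\<dots> = sqrt ?t" using that(5) by (simp flip: real_sqrt_mult)
    finally show ?thesis using cs(2) by blast
  qed
  have gs: "(\<lambda>x. (g (shift s x))\<^sup>2) summable_on UNIV" "(\<Sum>\<^sub>\<infinity>x. (g (shift s x))\<^sup>2) \<le> 1"
    using sq summable_shift[of "\<lambda>x. (g x)\<^sup>2" s] infsum_shift[of "\<lambda>x. (g x)\<^sup>2" s] by auto
  have vss: "(\<lambda>x. (v (shift s x))\<^sup>2) summable_on UNIV" "(\<Sum>\<^sub>\<infinity>x. (v (shift s x))\<^sup>2) \<le> ?t"
    using vs summable_shift[of "\<lambda>x. (v x)\<^sup>2" s] infsum_shift[of "\<lambda>x. (v x)\<^sup>2" s] by auto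
  have b1: "(\<lambda>x. v x * g (shift s x)) summable_on UNIV" "\<bar>\<Sum>\<^sub>\<infinity>x. v x * g (shift s x)\<bar> \<le> sqrt ?t"
    using bd[OF vs gs] by auto
  have b2: "(\<lambda>x. u x * v (shift s x)) summable_on UNIV" "\<bar>\<Sum>\<^sub>\<infinity>x. u x * v (shift s x)\<bar> \<le> sqrt ?t"
    using bd[OF us vss] by auto
  have "g x * g (shift s x) = u x * u (shift s x) + (v x * g (shift s x) + u x * v (shift s x))" for x
    by (auto simp: u_def v_def)
  then have "corr g s = (\<Sum>\<^sub>\<infinity>x. u x * u (shift s x) + (v x * g (shift s x) + u x * v (shift s x)))"
    by (simp add: corr_def)
  also have "\<dots> = corr u s + ((\<Sum>\<^sub>\<infinity>x. v x * g (shift s x)) + (\<Sum>\<^sub>\<infinity>x. u x * v (shift s x)))"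
    unfolding corr_def
    by (subst infsum_add[OF corr_summable[OF us(1)] summable_on_add[OF b1(1) b2(1)]])
      (simp add: infsum_add[OF b1(1) b2(1)])
  finally show ?thesis
    using b1(2) b2(2) unfolding u_def[abs_def] by linarith
qed

lemma corr_finite_enumeration:
  fixes z :: "nat \<Rightarrow> 'g::group_add \<times> nat"
  assumes z: "inj z"
  shows "corr (\<lambda>x. if x \<in> z ` {..<J} then g x else 0) s
    = (\<Sum>j<J. \<Sum>k<J. g (z j) * g (z k) * of_bool (z k = shift s (z j)))"
proof -
  let ?u = "\<lambda>x. if x \<in> z ` {..<J} then g x else 0"
  have inj: "inj_on z {..<J}" using z by (rule inj_on_subset) simp
  have "corr ?u s = (\<Sum>\<^sub>\<infinity>x\<in>z ` {..<J}. ?u x * ?u (shift s x))"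
    unfolding corr_def by (rule infsum_cong_neutral) auto
  also have "\<dots> = (\<Sum>x\<in>z ` {..<J}. ?u x * ?u (shift s x))" by simp
  also have "\<dots> = (\<Sum>j<J. ?u (z j) * ?u (shift s (z j)))"
    by (subst sum.reindex[OF inj]) (simp only: o_def)
  also have "\<dots> = (\<Sum>j<J. \<Sum>k<J. g (z j) * g (z k) * of_bool (z k = shift s (z j)))"
  proof (rule sum.cong[OF refl])
    fix j assume j: "j \<in> {..<J}"
    have "?u y = (\<Sum>x\<in>z ` {..<J}. if x = y then g x else 0)" for y by simp
    also have "\<dots> y = (\<Sum>k<J. g (z k) * of_bool (z k = y))" for y
      by (subst sum.reindex[OF inj]) (rule sum.cong[OF refl], simp add: of_bool_def)
    finally have u: "?u y = (\<Sum>k<J. g (z k) * of_bool (z k = y))" for y .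
    have uj: "?u (z j) = g (z j)" using j by simp
    show "?u (z j) * ?u (shift s (z j))
        = (\<Sum>k<J. g (z j) * g (z k) * of_bool (z k = shift s (z j)))"
      by (subst uj, subst u) (simp only: sum_distrib_left mult.assoc)
  qed
  finally show ?thesis .
qed

lemma tendsto_of_bool_eventually:
  assumes "(\<lambda>n. of_bool (P n) :: real) \<longlonglongrightarrow> l"
  shows "eventually P sequentially \<or> eventually (\<lambda>n. \<not> P n) sequentially"
proof -
  have "\<forall>\<^sub>F n in sequentially. dist (of_bool (P n)) l < 1 / 2"
    using assms by (rule tendstoD) simp
  then obtain N where N: "\<And>n. N \<le> n \<Longrightarrow> dist (of_bool (P n)) l < 1 / 2"
    unfolding eventually_sequentially by blast
  have "P n = P N" if "N \<le> n" for n
    using N[OF that] N[of N] by (auto simp: dist_real_def of_bool_def split: if_splits)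
  then show ?thesis unfolding eventually_sequentially by (cases "P N") auto
qed

text \<open>
  A consistent system of relative positions \<open>R j k s\<close> (point \<open>k\<close> is the translate of point \<open>j\<close> by
  \<open>s\<close>) is realised by points on copies of the group. Points with a relative position form classes;
  each class gets the copy numbered by its least member, which is also taken as origin.
\<close>
lemma relative_position_realization:
  fixes R :: "nat \<Rightarrow> nat \<Rightarrow> 'g::group_add \<Rightarrow> bool"
  assumes refl: "\<And>j. R j j 0" and sym: "\<And>j k s. R j k s \<Longrightarrow> R k j (- s)"
    and trans: "\<And>j k l s t. R j k s \<Longrightarrow> R k l t \<Longrightarrow> R j l (s + t)"
    and unique: "\<And>j k s t. R j k s \<Longrightarrow> R j k t \<Longrightarrow> s = t"
    and separated: "\<And>j k. R j k 0 \<Longrightarrow> j = k"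
  shows "\<exists>w :: nat \<Rightarrow> 'g \<times> nat. inj w \<and> (\<forall>j k s. w k = shift s (w j) \<longleftrightarrow> R j k s)"
proof -
  define rep where "rep k = (LEAST i. \<exists>s. R i k s)" for k
  define pos where "pos k = (SOME s. R (rep k) k s)" for k
  have "\<exists>s. R (rep k) k s" for k
    unfolding rep_def by (rule LeastI[of _ k]) (use refl in blast)
  then have pos: "R (rep k) k (pos k)" for k unfolding pos_def by (rule someI_ex)
  define w where "w k = (pos k, rep k)" for k
  have iff: "w k = shift s (w j) \<longleftrightarrow> R j k s" for j k s
  proof
    assume R: "R j k s"
    have "(\<exists>t. R i j t) \<longleftrightarrow> (\<exists>t. R i k t)" for i using R sym trans by blast
    then have rep: "rep k = rep j" by (simp add: rep_def)
    have "R (rep k) k (pos j + s)" using trans[OF pos R] rep by simp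
    then have "pos k = pos j + s" using unique[OF pos] by blast
    then show "w k = shift s (w j)" by (simp add: w_def shift_def rep)
  next
    assume "w k = shift s (w j)"
    then have e: "pos k = pos j + s" "rep k = rep j" by (auto simp: w_def shift_def)
    have "R (rep j) k (pos j + s)" using pos[of k] e by simp
    from trans[OF sym[OF pos[of j]] this] show "R j k s" by (simp flip: add.assoc)
  qed
  have "inj w"
  proof (rule injI)
    fix j k assume "w j = w k"
    then have "w k = shift 0 (w j)" by (simp add: shift_def)
    then show "j = k" using iff separated by blast
  qed
  with iff show ?thesis by blast
qed

text \<open>
  Sequential compactness of the symbols under pointwise convergence. The limit keeps, for every
  place of the decreasing enumerations, the limit of the values, and it places two points on the
  same copy of the group iff their relative position is eventually constant along the subsequence.
\<close>
lemma profiles_compact: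
  fixes g :: "nat \<Rightarrow> 'g::{group_add, countable} \<times> nat \<Rightarrow> real"
  assumes g: "\<And>n. g n \<in> profiles p" and p: "1 \<le> p" "p < 2"
  shows "\<exists>r h. strict_mono (r :: nat \<Rightarrow> nat) \<and> h \<in> profiles p \<and> (\<forall>s. (\<lambda>n. corr (g (r n)) s) \<longlonglongrightarrow> corr h s)"
proof -
  have g01: "0 \<le> g n x" "g n x \<le> 1" for n x using g[of n] unfolding profiles_def by blast+
  have "\<forall>n. \<exists>z :: nat \<Rightarrow> 'g \<times> nat. inj z \<and> (\<forall>k x. x \<notin> z ` {..<k} \<longrightarrow> g n x powr p \<le> 1 / real (Suc k))"
    using decreasing_enumeration[OF g p(1)] by blast
  then obtain z where z: "\<And>n. inj (z n)"
      "\<And>n k x. x \<notin> z n ` {..<k} \<Longrightarrow> g n x powr p \<le> 1 / real (Suc k)"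
    by metis
  \<comment> \<open>one countable family of bounded sequences: the values, and the truth values of all relative positions\<close>
  define f :: "nat \<Rightarrow> nat + nat \<times> nat \<times> 'g \<Rightarrow> real" where
    "f n i = (case i of Inl k \<Rightarrow> g n (z n k)
      | Inr (j, k, s) \<Rightarrow> of_bool (z n k = shift s (z n j)))" for n i
  have f1: "norm (f n i) \<le> 1" for n i
    using g01 by (auto simp: f_def split: sum.split)
  obtain r where r: "strict_mono (r :: nat \<Rightarrow> nat)"
      "\<And>i. \<exists>l. (\<lambda>n. f (r n) i) \<longlonglongrightarrow> l"
    using function_convergent_subsequence[of UNIV f 1] f1 by (metis UNIV_I countableI_type)
  have "\<forall>k. \<exists>l. (\<lambda>n. g (r n) (z (r n) k)) \<longlonglongrightarrow> l"
    using r(2)[of "Inl _"] by (simp add: f_def)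
  then obtain a where a: "\<And>k. (\<lambda>n. g (r n) (z (r n) k)) \<longlonglongrightarrow> a k" by metis
  \<comment> \<open>a convergent sequence of truth values is eventually constant, so exactly one of two cases occurs\<close>
  define R where "R j k s = (\<forall>\<^sub>F n in sequentially. z (r n) k = shift s (z (r n) j))" for j k s
  have lim_R: "(\<lambda>n. of_bool (z (r n) k = shift s (z (r n) j)) :: real) \<longlonglongrightarrow> of_bool (R j k s)" for j k s
  proof -
    obtain l where l: "(\<lambda>n. of_bool (z (r n) k = shift s (z (r n) j)) :: real) \<longlonglongrightarrow> l"
      using r(2)[of "Inr (j, k, s)"] by (auto simp: f_def)
    have "\<forall>\<^sub>F n in sequentially. (z (r n) k = shift s (z (r n) j)) = R j k s"
    proof (cases "R j k s")
      case True
      then show ?thesis by (simp add: R_def)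
    next
      case False
      with tendsto_of_bool_eventually[OF l] show ?thesis by (auto simp: R_def elim: eventually_mono)
    qed
    then show ?thesis by (intro tendsto_eventually) (auto elim: eventually_mono)
  qed
  have "\<exists>w :: nat \<Rightarrow> 'g \<times> nat. inj w \<and> (\<forall>j k s. w k = shift s (w j) \<longleftrightarrow> R j k s)"
  proof (rule relative_position_realization)
    show "R j j 0" for j by (simp add: R_def shift_def)
    show "R k j (- s)" if "R j k s" for j k s
      using that unfolding R_def by (rule eventually_mono) (simp add: shift_def add.assoc)
    show "R j l (s + t)" if "R j k s" "R k l t" for j k l s t
      using eventually_conj[OF that[unfolded R_def]] unfolding R_def
      by (rule eventually_mono) (simp add: shift_def add.assoc)
    show "s = t" if "R j k s" "R j k t" for j k s t
      using eventually_happens[OF eventually_conj[OF that[unfolded R_def]]]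
      by (auto simp: shift_def)
    show "j = k" if "R j k 0" for j k
      using eventually_happens[OF that[unfolded R_def]] z(1) by (auto simp: shift_def inj_eq)
  qed
  then obtain w :: "nat \<Rightarrow> 'g \<times> nat" where w: "inj w" "\<And>j k s. w k = shift s (w j) \<longleftrightarrow> R j k s"
    by blast
  define h where "h x = (if x \<in> range w then a (inv w x) else 0)" for x
  have hw: "h (w k) = a k" for k using w(1) by (simp add: h_def)
  have a01: "0 \<le> a k" "a k \<le> 1" for k
    using LIMSEQ_le_const[OF a] LIMSEQ_le_const2[OF a] g01 by blast+
  have apow: "(\<lambda>n. g (r n) (z (r n) k) powr p) \<longlonglongrightarrow> a k powr p" for k
    using p g01 by (intro tendsto_powr' a tendsto_const) auto
  have a_small: "a k powr p \<le> 1 / real (Suc k)" for k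
    by (rule LIMSEQ_le_const2[OF apow])
      (intro exI[of _ 0] allI impI z(2), use z(1) in \<open>auto simp: inj_eq\<close>)
  have h: "h \<in> profiles p"
  proof (rule profilesI)
    show "0 \<le> h x" "h x \<le> 1" for x using a01 by (auto simp: h_def)
    fix F :: "('g \<times> nat) set" assume F: "finite F"
    let ?K = "w -` F"
    have K: "finite ?K" using F w(1) by (rule finite_vimageI)
    have "(\<Sum>x\<in>F. h x powr p) = (\<Sum>x\<in>w ` ?K. h x powr p)"
      using F p by (intro sum.mono_neutral_right) (auto simp: h_def)
    also have "\<dots> = (\<Sum>k\<in>?K. a k powr p)"
      by (subst sum.reindex[OF inj_on_subset[OF w(1) subset_UNIV]]) (simp add: hw)
    also have "\<dots> \<le> 1"
    proof (rule LIMSEQ_le_const2)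
      show "(\<lambda>n. \<Sum>k\<in>?K. g (r n) (z (r n) k) powr p) \<longlonglongrightarrow> (\<Sum>k\<in>?K. a k powr p)"
        by (intro tendsto_sum apow)
      have "(\<Sum>k\<in>?K. g (r n) (z (r n) k) powr p) \<le> 1" for n
        using profiles_sum_le[OF g, of "z (r n) ` ?K" "r n"] K z(1)[of "r n"]
        by (simp add: sum.reindex inj_on_subset o_def)
      then show "\<exists>N. \<forall>n\<ge>N. (\<Sum>k\<in>?K. g (r n) (z (r n) k) powr p) \<le> 1" by blast
    qed
    finally show "(\<Sum>x\<in>F. h x powr p) \<le> 1" .
  qed
  have h_small: "h x powr p \<le> 1 / real (Suc J)" if x: "x \<notin> w ` {..<J}" for x J
  proof (cases "x \<in> range w")
    case True
    then obtain k where k: "x = w k" by blast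
    then have "J \<le> k" using x by (metis imageI lessThan_iff not_less)
    have "h x powr p \<le> 1 / real (Suc k)" unfolding k hw by (rule a_small)
    also have "\<dots> \<le> 1 / real (Suc J)" using \<open>J \<le> k\<close> by (simp add: frac_le)
    finally show ?thesis .
  qed (use p in \<open>simp add: h_def\<close>)
  define \<epsilon> where "\<epsilon> J = 2 * sqrt ((1 / real (Suc J)) powr ((2 - p) / p))" for J
  have "(\<lambda>J. (1 / real (Suc J)) powr ((2 - p) / p)) \<longlonglongrightarrow> 0 powr ((2 - p) / p)"
    using p by (intro tendsto_powr' tendsto_const LIMSEQ_Suc[OF lim_1_over_n]) auto
  then have "\<epsilon> \<longlonglongrightarrow> 2 * sqrt 0"
    unfolding \<epsilon>_def[abs_def] by (intro tendsto_intros) simp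
  then have \<epsilon>: "\<epsilon> \<longlonglongrightarrow> 0" by simp
  have "(\<lambda>n. corr (g (r n)) s) \<longlonglongrightarrow> corr h s" for s
  proof (rule LIMSEQ_I)
    fix e :: real assume "0 < e"
    then have "0 < e / 3" by simp
    \<comment> \<open>beyond \<open>J\<close> places the contribution is small uniformly in \<open>n\<close>; the first \<open>J\<close> places give finite sums\<close>
    then obtain J where J: "\<bar>\<epsilon> J\<bar> < e / 3" using LIMSEQ_D[OF \<epsilon>] by fastforce
    define c where "c n = (\<Sum>j<J. \<Sum>k<J. g (r n) (z (r n) j) * g (r n) (z (r n) k)
      * of_bool (z (r n) k = shift s (z (r n) j)))" for n
    define c' where "c' = (\<Sum>j<J. \<Sum>k<J. h (w j) * h (w k) * of_bool (w k = shift s (w j)))"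
    have "c \<longlonglongrightarrow> c'"
      unfolding c_def c'_def hw w(2) by (intro tendsto_intros a lim_R)
    from LIMSEQ_D[OF this \<open>0 < e / 3\<close>] obtain N where N: "\<And>n. N \<le> n \<Longrightarrow> \<bar>c n - c'\<bar> < e / 3"
      by auto
    have cn: "\<bar>corr (g (r n)) s - c n\<bar> \<le> \<epsilon> J" for n
      using corr_truncate[where Z = "z (r n) ` {..<J}" and s = s, OF g p z(2)]
      unfolding corr_finite_enumeration[OF z(1)] c_def \<epsilon>_def .
    have ch: "\<bar>corr h s - c'\<bar> \<le> \<epsilon> J"
      using corr_truncate[where Z = "w ` {..<J}" and s = s, OF h p h_small]
      unfolding corr_finite_enumeration[OF w(1)] c'_def \<epsilon>_def .
    have "norm (corr (g (r n)) s - corr h s) < e" if "N \<le> n" for n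
      using N[OF that] J cn[of n] ch unfolding real_norm_def by linarith
    then show "\<exists>N. \<forall>n\<ge>N. norm (corr (g (r n)) s - corr h s) < e" by blast
  qed
  with r(1) h show ?thesis by blast
qed

lemma exists_minimal_defect:
  fixes A :: "'g::{group_add, countable} op set"
  assumes A: "multiplier_algebra A" and F: "finite F" and p: "1 \<le> p" "p < 2"
  shows "\<exists>h\<in>profiles p. \<forall>g\<in>profiles p.
    multiplier_algebra.defect A F (corr_symbol h) \<le> multiplier_algebra.defect A F (corr_symbol g)"
proof -
  interpret multiplier_algebra A by (rule A)
  let ?d = "\<lambda>g. defect F (corr_symbol g)"
  define m where "m = Inf (?d ` profiles p)"
  have ne: "(\<lambda>_. 0) \<in> (profiles p :: ('g \<times> nat \<Rightarrow> real) set)" by (rule profilesI) auto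
  have bdd: "bdd_below (?d ` profiles p)"
    by (rule bdd_belowI2[of _ 0]) (rule defect_nonneg[OF F])
  have "\<exists>g\<in>profiles p. ?d g < m + 1 / real (Suc n)" for n
    using cInf_lessD[of "?d ` profiles p" "m + 1 / real (Suc n)"] ne unfolding m_def by auto
  then obtain g where g: "\<And>n. g n \<in> profiles p" "\<And>n. ?d (g n) < m + 1 / real (Suc n)" by metis
  obtain r h where r: "strict_mono (r :: nat \<Rightarrow> nat)" and h: "h \<in> profiles p"
      and lim: "\<And>s. (\<lambda>n. corr (g (r n)) s) \<longlonglongrightarrow> corr h s"
    using profiles_compact[of g p, OF g(1) p] by blast
  have "?d h \<le> m + 0 + (\<Sum>s\<in>F. norm (corr h s - corr h s))"
  proof (rule LIMSEQ_le_const)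
    have "(\<lambda>n. 1 / real (Suc (r n))) \<longlonglongrightarrow> 0"
      using LIMSEQ_subseq_LIMSEQ[OF LIMSEQ_Suc[OF lim_1_over_n] r] by (simp add: o_def)
    then show "(\<lambda>n. m + 1 / real (Suc (r n)) + (\<Sum>s\<in>F. norm (corr h s - corr (g (r n)) s)))
        \<longlonglongrightarrow> m + 0 + (\<Sum>s\<in>F. norm (corr h s - corr h s))"
      by (intro tendsto_intros lim)
    have "?d h \<le> m + 1 / real (Suc (r n)) + (\<Sum>s\<in>F. norm (corr h s - corr (g (r n)) s))" for n
      using defect_lipschitz[OF F, of "corr_symbol h" "corr_symbol (g (r n))"] g(2)[of "r n"]
      by (simp add: corr_symbol_def flip: of_real_diff)
    then show "\<exists>N. \<forall>n\<ge>N. ?d h \<le> m + 1 / real (Suc (r n)) + (\<Sum>s\<in>F. norm (corr h s - corr (g (r n)) s))"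
      by blast
  qed
  then have "?d h \<le> m" by simp
  moreover have "m \<le> ?d k" if "k \<in> profiles p" for k
    unfolding m_def using that by (intro cInf_lower bdd) auto
  ultimately show ?thesis using h by (meson order_trans)
qed

section \<open>Folner sets\<close>

text \<open>
  Hall's marriage theorem, by induction on the number of elements. Either all nonempty proper
  subsets have a surplus, and any one element can be matched to any of its neighbours, or some
  such subset is tight, and it can be matched separately from the rest.
\<close>
lemma hall_matching:
  fixes N :: "'a \<Rightarrow> 'b set"
  assumes "finite X" "\<And>x. x \<in> X \<Longrightarrow> finite (N x)" "\<And>Y. Y \<subseteq> X \<Longrightarrow> card Y \<le> card (\<Union>(N ` Y))"
  shows "\<exists>f. inj_on f X \<and> (\<forall>x\<in>X. f x \<in> N x)"
  using assms
proof (induction X arbitrary: N rule: finite_psubset_induct)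
  case (psubset X)
  note fin = psubset.prems(1) and hall = psubset.prems(2)
  have finU: "finite (\<Union>(N ` Y))" if "Y \<subseteq> X" for Y
    using that psubset.hyps fin by (meson finite_UN_I finite_subset subsetD)
  show ?case
  proof (cases "\<forall>Y. Y \<subset> X \<longrightarrow> Y \<noteq> {} \<longrightarrow> card Y < card (\<Union>(N ` Y))")
    case True
    show ?thesis
    proof (cases "X = {}")
      case False
      then obtain x where x: "x \<in> X" by blast
      have "card {x} \<le> card (\<Union>(N ` {x}))" using x by (intro hall) auto
      then have "N x \<noteq> {}" by auto
      then obtain y where y: "y \<in> N x" by blast
      have "\<exists>f. inj_on f (X - {x}) \<and> (\<forall>v\<in>X - {x}. f v \<in> N v - {y})"
      proof (rule psubset.IH)
        fix Y assume Y: "Y \<subseteq> X - {x}"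
        show "card Y \<le> card (\<Union>v\<in>Y. N v - {y})"
        proof (cases "Y = {}")
          case False
          have "card Y < card (\<Union>(N ` Y))" using True False Y x by blast
          moreover have "card (\<Union>v\<in>Y. N v - {y}) = card (\<Union>(N ` Y) - {y})"
            by (rule arg_cong[where f = card]) blast
          moreover have "card (\<Union>(N ` Y)) - 1 \<le> card (\<Union>(N ` Y) - {y})"
            by (simp add: card_Diff_singleton_if)
          ultimately show ?thesis by linarith
        qed simp
      qed (use x fin in auto)
      then obtain f where f: "inj_on f (X - {x})" "\<And>v. v \<in> X - {x} \<Longrightarrow> f v \<in> N v - {y}" by blast
      have "inj_on (f(x := y)) X"
        using f by (auto simp: inj_on_def)
      moreover have "\<forall>v\<in>X. (f(x := y)) v \<in> N v" using f y by auto
      ultimately show ?thesis by blast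
    qed simp
  next
    case False
    then obtain Y where Y: "Y \<subset> X" "Y \<noteq> {}" "\<not> card Y < card (\<Union>(N ` Y))" by blast
    then have eq: "card (\<Union>(N ` Y)) = card Y" using hall[of Y] by auto
    have "\<exists>f. inj_on f Y \<and> (\<forall>v\<in>Y. f v \<in> N v)"
      by (rule psubset.IH) (use Y fin hall in auto)
    then obtain f where f: "inj_on f Y" "\<And>v. v \<in> Y \<Longrightarrow> f v \<in> N v" by blast
    have "\<exists>h. inj_on h (X - Y) \<and> (\<forall>v\<in>X - Y. h v \<in> N v - \<Union>(N ` Y))"
    proof (rule psubset.IH)
      fix Z assume Z: "Z \<subseteq> X - Y"
      have "(\<Union>v\<in>Z. N v - \<Union>(N ` Y)) = \<Union>(N ` (Z \<union> Y)) - \<Union>(N ` Y)" by blast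
      then have "card (\<Union>v\<in>Z. N v - \<Union>(N ` Y)) = card (\<Union>(N ` (Z \<union> Y))) - card (\<Union>(N ` Y))"
        using finU[of Y] Y by (simp add: card_Diff_subset image_Un)
      moreover have "card (Z \<union> Y) \<le> card (\<Union>(N ` (Z \<union> Y)))" using Y Z by (intro hall) auto
      moreover have "card (Z \<union> Y) = card Z + card Y"
        using Y Z psubset.hyps by (intro card_Un_disjoint) (auto intro: finite_subset)
      ultimately show "card Z \<le> card (\<Union>v\<in>Z. N v - \<Union>(N ` Y))" using eq by linarith
    qed (use Y fin in auto)
    then obtain h where h: "inj_on h (X - Y)" "\<And>v. v \<in> X - Y \<Longrightarrow> h v \<in> N v - \<Union>(N ` Y)" by blast
    let ?k = "\<lambda>v. if v \<in> Y then f v else h v"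
    have "inj_on ?k X"
    proof (rule inj_onI)
      fix v w assume vw: "v \<in> X" "w \<in> X" "?k v = ?k w"
      have cross: "f a \<noteq> h b" if "a \<in> Y" "b \<in> X - Y" for a b
        using f(2)[OF that(1)] h(2)[OF that(2)] that(1) by auto
      show "v = w"
        using vw cross[of v w] cross[of w v] inj_onD[OF f(1), of v w] inj_onD[OF h(1), of v w]
        by (cases "v \<in> Y"; cases "w \<in> Y") auto
    qed
    moreover have "\<forall>v\<in>X. ?k v \<in> N v" using f h by auto
    ultimately show ?thesis by blast
  qed
qed

definition sumset :: "'g::group_add set \<Rightarrow> 'g set \<Rightarrow> 'g set" where
  "sumset E B = (\<lambda>(t, s). t + s) ` (E \<times> B)"

lemma sumset_assoc: "sumset (sumset E B) L = sumset E (sumset B L)"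
  unfolding sumset_def by (auto simp: image_iff add.assoc) (metis add.assoc)+

lemma finite_sumset: "finite E \<Longrightarrow> finite B \<Longrightarrow> finite (sumset E B)"
  by (simp add: sumset_def)

text \<open>
  If no finite set is almost invariant, then enlarging by \<open>insert 0 K\<close> multiplies cardinalities by
  at least \<open>1 + e\<close>, and iterating this makes the factor 2.
\<close>
lemma doubling_of_expansion:
  fixes K :: "'g::group_add set"
  assumes K: "finite K" and e: "0 < e"
    and exp: "\<And>E. finite E \<Longrightarrow> E \<noteq> {} \<Longrightarrow> \<exists>s\<in>K. e * real (card E) < real (card {t\<in>E. t + s \<notin> E})"
  shows "\<exists>B :: 'g set. finite B \<and> (\<forall>E. finite E \<longrightarrow> 2 * card E \<le> card (sumset E B))"
proof -
  let ?L = "insert 0 K"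
  have step: "(1 + e) * real (card E) \<le> real (card (sumset E ?L))" if E: "finite E" for E :: "'g set"
  proof (cases "E = {}")
    case False
    then obtain s where s: "s \<in> K" "e * real (card E) < real (card {t\<in>E. t + s \<notin> E})"
      using exp[OF E] by blast
    let ?D = "{t\<in>E. t + s \<notin> E}"
    have mem: "t + u \<in> sumset E ?L" if "t \<in> E" "u \<in> ?L" for t u
      using that by (force simp: sumset_def)
    have "E \<union> (\<lambda>t. t + s) ` ?D \<subseteq> sumset E ?L"
      using mem[of _ 0] mem[of _ s] s by auto
    then have "card (E \<union> (\<lambda>t. t + s) ` ?D) \<le> card (sumset E ?L)"
      using E K by (intro card_mono finite_sumset) auto
    moreover have "card (E \<union> (\<lambda>t. t + s) ` ?D) = card E + card ?D"
      using E by (subst card_Un_disjoint) (auto simp: card_image inj_on_def)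
    ultimately show ?thesis using s(2) by (simp add: algebra_simps)
  qed simp
  define B where "B = rec_nat {0} (\<lambda>_ B. sumset B ?L)"
  have B: "B 0 = {0}" "B (Suc n) = sumset (B n) ?L" for n by (auto simp: B_def)
  have finB: "finite (B n)" for n using K by (induction n) (auto simp: B intro: finite_sumset)
  have grow: "(1 + e) ^ n * real (card E) \<le> real (card (sumset E (B n)))" if E: "finite E" for E n
  proof (induction n)
    case 0
    have "sumset E (B 0) = E" by (force simp: B sumset_def)
    then show ?case by simp
  next
    case (Suc n)
    have "(1 + e) ^ Suc n * real (card E) \<le> (1 + e) * real (card (sumset E (B n)))"
      using Suc e by (simp add: mult.assoc)
    also have "\<dots> \<le> real (card (sumset (sumset E (B n)) ?L))"
      by (rule step) (intro finite_sumset E finB)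
    finally show ?case by (simp add: B sumset_assoc)
  qed
  obtain n where n: "2 < (1 + e) ^ n" using real_arch_pow[of "1 + e" 2] e by auto
  have "2 * card E \<le> card (sumset E (B n))" if E: "finite E" for E
  proof -
    have "2 * real (card E) \<le> (1 + e) ^ n * real (card E)" using n by (intro mult_right_mono) auto
    also have "\<dots> \<le> real (card (sumset E (B n)))" by (rule grow[OF E])
    finally show ?thesis by linarith
  qed
  then show ?thesis using finB by (intro exI[of _ "B n"]) simp
qed

lemma finite_to_nat_less: "finite {x :: 'a::countable. to_nat x < n}"
proof -
  have "{x :: 'a. to_nat x < n} = to_nat -` {..<n}" by auto
  then show ?thesis by (simp add: finite_vimageI)
qed

text \<open>
  On a finite part of the group, Hall's theorem matches every point twice, with all partners
  distinct and within displacement \<open>B\<close>. Along an exhaustion of the group the indicator functions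
  \<open>c x i k\<close> of ``\<open>x + k\<close> is partner number \<open>i\<close> of \<open>x\<close>'' have a pointwise limit along a
  subsequence; the relations that say this are finite sums, and they persist.
\<close>
lemma fractional_two_to_one_matching:
  fixes B :: "'g::{group_add, countable} set"
  assumes B: "finite B" and double: "\<And>E. finite E \<Longrightarrow> 2 * card E \<le> card (sumset E B)"
  shows "\<exists>c :: 'g \<Rightarrow> bool \<Rightarrow> 'g \<Rightarrow> real. (\<forall>x i k. 0 \<le> c x i k \<and> c x i k \<le> 1)
    \<and> (\<forall>x i. (\<Sum>k\<in>B. c x i k) = 1) \<and> (\<forall>y. (\<Sum>i\<in>UNIV. \<Sum>k\<in>B. c (y - k) i k) \<le> 1)"
proof -
  have "\<exists>f. inj_on f (X \<times> (UNIV :: bool set)) \<and> (\<forall>v\<in>X \<times> UNIV. f v \<in> sumset {fst v} B)"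
    if X: "finite X" for X :: "'g set"
  proof (rule hall_matching)
    fix Y assume Y: "Y \<subseteq> X \<times> (UNIV :: bool set)"
    have finY: "finite Y" using finite_subset[OF Y] X by simp
    have "card Y \<le> card (fst ` Y \<times> (UNIV :: bool set))"
      using finY by (intro card_mono) (auto simp: image_iff, force)
    also have "\<dots> = 2 * card (fst ` Y)" by (simp add: card_cartesian_product)
    also have "\<dots> \<le> card (sumset (fst ` Y) B)" using finY by (intro double) simp
    also have "sumset (fst ` Y) B = (\<Union>v\<in>Y. sumset {fst v} B)" by (force simp: sumset_def)
    finally show "card Y \<le> card (\<Union>v\<in>Y. sumset {fst v} B)" .
  qed (use X B in \<open>auto intro: finite_sumset\<close>)
  then obtain \<psi> where \<psi>: "\<And>X. finite X \<Longrightarrow> inj_on (\<psi> X) (X \<times> (UNIV :: bool set))"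
      "\<And>X v. finite X \<Longrightarrow> v \<in> X \<times> UNIV \<Longrightarrow> \<psi> X v \<in> sumset {fst v} B"
    by metis
  define X where "X n = {x :: 'g. to_nat x < n}" for n
  have finX: "finite (X n)" for n unfolding X_def by (rule finite_to_nat_less)
  \<comment> \<open>outside the finite part \<open>X n\<close> there is no matching\<close>
  define P where "P n x i k \<longleftrightarrow> x \<in> X n \<and> \<psi> (X n) (x, i) = x + k" for n x i k
  define f :: "nat \<Rightarrow> 'g \<times> bool \<times> 'g \<Rightarrow> real" where
    "f n v = (case v of (x, i, k) \<Rightarrow> of_bool (P n x i k))" for n v
  have "norm (f n v) \<le> 1" for n v by (auto simp: f_def split: prod.split)
  then obtain r where r: "strict_mono (r :: nat \<Rightarrow> nat)" "\<And>v. \<exists>l. (\<lambda>n. f (r n) v) \<longlonglongrightarrow> l"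
    using function_convergent_subsequence[of UNIV f 1] by (metis UNIV_I countableI_type)
  have "\<forall>x i k. \<exists>l. (\<lambda>n. of_bool (P (r n) x i k) :: real) \<longlonglongrightarrow> l"
    using r(2)[of "(_, _, _)"] by (simp add: f_def)
  then obtain c where c: "\<And>x i k. (\<lambda>n. of_bool (P (r n) x i k) :: real) \<longlonglongrightarrow> c x i k" by metis
  have "0 \<le> c x i k \<and> c x i k \<le> 1" for x i k
    using LIMSEQ_le_const[OF c, of 0] LIMSEQ_le_const2[OF c, of _ _ _ 1] by auto
  moreover have "(\<Sum>k\<in>B. c x i k) = 1" for x i
  proof -
    have "(\<Sum>k\<in>B. of_bool (P (r n) x i k) :: real) = 1" if n: "Suc (to_nat x) \<le> n" for n
    proof -
      have x: "x \<in> X (r n)" using n seq_suble[OF r(1), of n] by (simp add: X_def)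
      then have "\<psi> (X (r n)) (x, i) \<in> sumset {x} B" using \<psi>(2)[OF finX, of "(x, i)"] by auto
      then obtain k where k: "k \<in> B" "\<psi> (X (r n)) (x, i) = x + k" by (auto simp: sumset_def)
      have "P (r n) x i k' \<longleftrightarrow> k' = k" for k' using x k by (auto simp: P_def)
      then show ?thesis using k B by (simp add: of_bool_def)
    qed
    then have "(\<lambda>n. \<Sum>k\<in>B. of_bool (P (r n) x i k) :: real) \<longlonglongrightarrow> 1"
      by (intro tendsto_eventually) (auto simp: eventually_sequentially)
    moreover have "(\<lambda>n. \<Sum>k\<in>B. of_bool (P (r n) x i k) :: real) \<longlonglongrightarrow> (\<Sum>k\<in>B. c x i k)"
      by (intro tendsto_sum c)
    ultimately show ?thesis by (rule LIMSEQ_unique[symmetric])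
  qed
  moreover have "(\<Sum>i\<in>UNIV. \<Sum>k\<in>B. c (y - k) i k) \<le> 1" for y
  proof (rule LIMSEQ_le_const2)
    show "(\<lambda>n. \<Sum>i\<in>UNIV. \<Sum>k\<in>B. of_bool (P (r n) (y - k) i k) :: real)
        \<longlonglongrightarrow> (\<Sum>i\<in>UNIV. \<Sum>k\<in>B. c (y - k) i k)"
      by (intro tendsto_sum c)
    have "(\<Sum>i\<in>UNIV. \<Sum>k\<in>B. of_bool (P n (y - k) i k) :: real) \<le> 1" for n
    proof -
      let ?Q = "{v \<in> (UNIV :: bool set) \<times> B. P n (y - snd v) (fst v) (snd v)}"
      have "v = w" if "v \<in> ?Q" "w \<in> ?Q" for v w
      proof -
        have "\<psi> (X n) (y - snd v, fst v) = y" "\<psi> (X n) (y - snd w, fst w) = y"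
          "y - snd v \<in> X n" "y - snd w \<in> X n"
          using that by (auto simp: P_def)
        then have "(y - snd v, fst v) = (y - snd w, fst w)"
          using inj_onD[OF \<psi>(1)[OF finX[of n]], of "(y - snd v, fst v)" "(y - snd w, fst w)"] by auto
        then show ?thesis
          by (metis Pair_inject add_left_cancel diff_conv_add_uminus neg_equal_iff_equal prod_eqI)
      qed
      then have "card ?Q \<le> 1" using B by (intro card_le_Suc0_iff_eq[THEN iffD2, simplified One_nat_def[symmetric]]) auto
      moreover have "(\<Sum>i\<in>UNIV. \<Sum>k\<in>B. of_bool (P n (y - k) i k) :: real)
          = (\<Sum>v\<in>UNIV \<times> B. of_bool (P n (y - snd v) (fst v) (snd v)))"
        by (simp add: sum.cartesian_product case_prod_beta)
      moreover have "\<dots> = real (card ?Q)"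
        using B by (simp add: Int_def)
      ultimately show ?thesis by linarith
    qed
    then show "\<exists>N. \<forall>n\<ge>N. (\<Sum>i\<in>UNIV. \<Sum>k\<in>B. of_bool (P (r n) (y - k) i k) :: real) \<le> 1" by blast
  qed
  ultimately show ?thesis by (intro exI[of _ c]) blast
qed

text \<open>
  The mean is needed on real functions only. Inversion turns left into right invariance, which is
  the one that the displacements \<open>x + k\<close> need.
\<close>
lemma amenable_imp_right_invariant_mean:
  assumes "amenable TYPE('g::group_add)"
  obtains \<mu> :: "('g::group_add \<Rightarrow> real) \<Rightarrow> real" where
    "\<And>f g. bounded (range f) \<Longrightarrow> bounded (range g) \<Longrightarrow> \<mu> (\<lambda>x. f x + g x) = \<mu> f + \<mu> g"
    "\<And>f. bounded (range f) \<Longrightarrow> (\<And>x. 0 \<le> f x) \<Longrightarrow> 0 \<le> \<mu> f"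
    "\<mu> (\<lambda>_. 1) = 1"
    "\<And>f s. bounded (range f) \<Longrightarrow> \<mu> (\<lambda>x. f (x + s)) = \<mu> f"
proof -
  obtain m :: "('g \<Rightarrow> complex) \<Rightarrow> complex" where m: "is_mean m"
      and inv: "\<And>s f. bounded (range f) \<Longrightarrow> m (\<lambda>x. f (- s + x)) = m f"
    using assms by (auto simp: amenable_def)
  define h where "h f x = complex_of_real (f (- x))" for f and x :: 'g
  have hb: "bounded (range (h f))" if f: "bounded (range f)" for f
  proof -
    obtain b where "\<And>x. \<bar>f x\<bar> \<le> b" using f by (auto simp: bounded_iff)
    then show ?thesis by (auto simp: bounded_iff h_def)
  qed
  define \<mu> where "\<mu> f = Re (m (h f))" for f
  have "\<mu> (\<lambda>x. f x + g x) = \<mu> f + \<mu> g" if "bounded (range f)" "bounded (range g)" for f g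
  proof -
    have "h (\<lambda>x. f x + g x) = (\<lambda>x. h f x + h g x)"
      by (rule ext) (simp add: h_def)
    then show ?thesis using m hb[OF that(1)] hb[OF that(2)] by (simp add: \<mu>_def is_mean_def)
  qed
  moreover have "0 \<le> \<mu> f" if "bounded (range f)" "\<And>x. 0 \<le> f x" for f
  proof -
    have "range (h f) \<subseteq> \<real>\<^sub>\<ge>\<^sub>0" using that(2) by (auto simp: h_def)
    then have "m (h f) \<in> \<real>\<^sub>\<ge>\<^sub>0" using m hb[OF that(1)] by (simp add: is_mean_def)
    then show ?thesis by (auto simp: \<mu>_def complex_nonneg_Reals_iff)
  qed
  moreover have "\<mu> (\<lambda>_. 1) = 1"
    using m by (simp add: \<mu>_def h_def[abs_def] is_mean_def)
  moreover have "\<mu> (\<lambda>x. f (x + s)) = \<mu> f" if "bounded (range f)" for f s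
  proof -
    have "h (\<lambda>x. f (x + s)) = (\<lambda>x. h f (- s + x))"
      by (rule ext) (simp add: h_def minus_add)
    then show ?thesis using inv[OF hb[OF that]] by (simp add: \<mu>_def)
  qed
  ultimately show thesis by (rule that)
qed

text \<open>
  Integrating a fractional two-to-one matching in two ways is contradictory. Summed over the
  displacements it is 1 for each of the two partners, so its total mean is 2. Moving each term by
  its displacement does not change the mean, and afterwards the sum is at most 1 everywhere.
\<close>
lemma amenable_imp_Folner:
  fixes K :: "'g::{group_add, countable} set"
  assumes am: "amenable TYPE('g)" and K: "finite K" and e: "0 < e"
  shows "\<exists>E :: 'g set. finite E \<and> E \<noteq> {} \<and> (\<forall>s\<in>K. real (card {t\<in>E. t + s \<notin> E}) \<le> e * real (card E))"
proof (rule ccontr)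
  assume "\<not> ?thesis"
  then have "\<exists>s\<in>K. e * real (card E) < real (card {t\<in>E. t + s \<notin> E})"
    if "finite E" "E \<noteq> {}" for E using that by (meson not_less)
  from doubling_of_expansion[OF K e this] obtain B :: "'g set" where B: "finite B"
      "\<And>E. finite E \<Longrightarrow> 2 * card E \<le> card (sumset E B)" by blast
  from fractional_two_to_one_matching[OF B] obtain c :: "'g \<Rightarrow> bool \<Rightarrow> 'g \<Rightarrow> real"
    where c: "\<And>x i k. 0 \<le> c x i k \<and> c x i k \<le> 1" "\<And>x i. (\<Sum>k\<in>B. c x i k) = 1"
      "\<And>y. (\<Sum>i\<in>UNIV. \<Sum>k\<in>B. c (y - k) i k) \<le> 1" by blast
  obtain \<mu> :: "('g \<Rightarrow> real) \<Rightarrow> real" where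
      add: "\<And>f g. bounded (range f) \<Longrightarrow> bounded (range g) \<Longrightarrow> \<mu> (\<lambda>x. f x + g x) = \<mu> f + \<mu> g"
    and pos: "\<And>f. bounded (range f) \<Longrightarrow> (\<And>x. 0 \<le> f x) \<Longrightarrow> 0 \<le> \<mu> f" and one: "\<mu> (\<lambda>_. 1) = 1"
    and inv: "\<And>f s. bounded (range f) \<Longrightarrow> \<mu> (\<lambda>x. f (x + s)) = \<mu> f"
    by (fact amenable_imp_right_invariant_mean[OF am])
  have const: "bounded (range (\<lambda>x :: 'g. r :: real))" for r by (auto simp: bounded_iff)
  have zero: "\<mu> (\<lambda>_. 0) = 0" using add[OF const[of 0] const[of 0]] by simp
  have sum: "bounded (range (\<lambda>x. \<Sum>i\<in>I. f i x)) \<and> \<mu> (\<lambda>x. \<Sum>i\<in>I. f i x) = (\<Sum>i\<in>I. \<mu> (f i))"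
    if "finite I" "\<And>i. bounded (range (f i))" for I :: "'i set" and f
    using that(1)
  proof (induction I)
    case empty
    show ?case using zero const[of 0] by simp
  next
    case (insert i I)
    then show ?case using add[OF that(2)] bounded_plus_comp[OF that(2)] by simp
  qed
  have cb: "bounded (range (\<lambda>x. c (x - k) i k))" "bounded (range (\<lambda>x. c x i k))" for i k
    using c(1) by (auto simp: bounded_iff intro!: exI[of _ 1])
  let ?h = "\<lambda>v x. c (x - snd v) (fst v) (snd v)"
  have invk: "\<mu> (\<lambda>x. c (x - k) i k) = \<mu> (\<lambda>x. c x i k)" for i k
    using inv[of "\<lambda>x. c x i k" "- k"] cb(2) by simp
  have "2 = (\<Sum>i\<in>(UNIV :: bool set). \<mu> (\<lambda>x. \<Sum>k\<in>B. c x i k))" by (simp add: c(2) one)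
  also have "\<dots> = (\<Sum>i\<in>UNIV. \<Sum>k\<in>B. \<mu> (\<lambda>x. c x i k))"
    using sum[OF B(1) cb(2)] by simp
  also have "\<dots> = (\<Sum>i\<in>UNIV. \<Sum>k\<in>B. \<mu> (\<lambda>x. c (x - k) i k))"
    by (simp add: invk)
  also have "\<dots> = (\<Sum>v\<in>UNIV \<times> B. \<mu> (?h v))"
    by (simp add: sum.cartesian_product case_prod_beta)
  also have "\<dots> = \<mu> (\<lambda>x. \<Sum>v\<in>UNIV \<times> B. ?h v x)"
    using sum[of "UNIV \<times> B" ?h] B(1) cb(1) by simp
  finally have two: "2 = \<mu> (\<lambda>x. \<Sum>v\<in>UNIV \<times> B. ?h v x)" .
  let ?S = "\<lambda>x. \<Sum>v\<in>UNIV \<times> B. ?h v x"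
  have S1: "?S x \<le> 1" for x using c(3)[of x] by (simp add: sum.cartesian_product case_prod_beta)
  have S0: "0 \<le> ?S x" for x using c(1) by (intro sum_nonneg) auto
  have Sb: "bounded (range ?S)" "bounded (range (\<lambda>x. 1 - ?S x))"
    using S0 S1 by (auto simp: bounded_iff intro!: exI[of _ 1])
  have "\<mu> (\<lambda>x. ?S x + (1 - ?S x)) = \<mu> ?S + \<mu> (\<lambda>x. 1 - ?S x)" by (rule add[OF Sb])
  moreover have "0 \<le> \<mu> (\<lambda>x. 1 - ?S x)" using S1 by (intro pos[OF Sb(2)]) simp
  ultimately show False using two one by simp
qed

text \<open>
  The normalised indicator function of a finite set. Its correlation at exponent 2 is the
  proportion of points of the set that remain in it after translation.
\<close>
lemma Folner_unit_p:
  fixes E :: "'g::group_add set"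
  assumes E: "finite E" "E \<noteq> {}" and p: "1 \<le> p"
  defines "f \<equiv> \<lambda>t. if t \<in> E then real (card E) powr (- 1 / p) else 0"
  shows "f \<in> unit_p p"
    and "corr (single_profile f) s = real (card {t\<in>E. t + s \<in> E}) * real (card E) powr (- 2 / p)"
proof -
  let ?n = "real (card E)"
  have n: "1 \<le> ?n" using E by (simp add: Suc_le_eq card_gt_0_iff)
  have "?n powr (- 1 / p) \<le> ?n powr 0" using n p by (intro powr_mono) auto
  then have le1: "?n powr (- 1 / p) \<le> 1" using n by simp
  have "(?n powr (- 1 / p)) powr p = ?n powr (- 1)" using p by (simp only: powr_powr) simp
  then have "(?n powr (- 1 / p)) powr p = 1 / ?n" using n by (simp only: powr_minus_divide) simp
  then have fp: "\<bar>f t\<bar> powr p = (if t \<in> E then 1 / ?n else 0)" for t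
    using p by (simp only: f_def) simp
  have hs: "((\<lambda>t. \<bar>f t\<bar> powr p) has_sum 1) UNIV"
  proof (rule has_sum_finite_neutralI[OF E(1)])
    show "1 = (\<Sum>t\<in>E. \<bar>f t\<bar> powr p)" using n by (simp add: fp)
  qed (auto simp: fp)
  have "lp_norm p f = 1" unfolding lp_norm_def using infsumI[OF hs] by simp
  moreover have "(\<lambda>t. \<bar>f t\<bar> powr p) summable_on UNIV" using hs by (rule has_sum_imp_summable)
  ultimately show "f \<in> unit_p p" using le1 by (auto simp: unit_p_def f_def)
  have inj: "inj_on (\<lambda>t :: 'g. (t, 0 :: nat)) E" by (simp add: inj_on_def)
  let ?g = "single_profile f"
  have "corr ?g s = (\<Sum>\<^sub>\<infinity>x\<in>(\<lambda>t. (t, 0)) ` E. ?g x * ?g (shift s x))"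
    unfolding corr_def by (rule infsum_cong_neutral) (auto simp: single_profile_def f_def image_iff)
  also have "\<dots> = (\<Sum>t\<in>E. f t * f (t + s))"
    using E by (simp add: sum.reindex[OF inj] single_profile_def shift_def)
  also have "\<dots> = (\<Sum>t\<in>E. if t + s \<in> E then ?n powr (- 2 / p) else 0)"
    by (intro sum.cong) (auto simp: f_def simp flip: powr_add)
  also have "\<dots> = real (card {t\<in>E. t + s \<in> E}) * ?n powr (- 2 / p)"
    using E by (simp flip: sum.inter_filter)
  finally show "corr ?g s = real (card {t\<in>E. t + s \<in> E}) * ?n powr (- 2 / p)" .
qed

lemma at_2_within_eq: "at (2::real) within {1..<2} = at_left 2"
  by (rule at_within_nhd[of _ "{1<..}"]) auto

text \<open>
  At the excluded exponent 2 a Folner set would do directly; nearby exponents do by continuity of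
  the correlation in the exponent.
\<close>
lemma amenable_imp_unit_p:
  fixes F :: "'g::{group_add, countable} set"
  assumes am: "amenable TYPE('g)" and F: "finite F" and e: "0 < e"
  shows "\<forall>\<^sub>F p in at 2 within {1..<2}. \<exists>f\<in>unit_p p. \<forall>s\<in>F. \<bar>1 - corr (single_profile f) s\<bar> < e"
proof -
  have "0 < e / 2" using e by simp
  from amenable_imp_Folner[OF am F this] obtain E :: "'g set" where E: "finite E" "E \<noteq> {}"
    and Fol: "\<And>s. s \<in> F \<Longrightarrow> real (card {t\<in>E. t + s \<notin> E}) \<le> e / 2 * real (card E)" by blast
  let ?n = "real (card E)" and ?N = "\<lambda>s. real (card {t\<in>E. t + s \<in> E})"
  have n: "0 < ?n" using E by (simp add: card_gt_0_iff)
  have ev: "\<forall>\<^sub>F p in at 2 within {1..<2}. \<bar>1 - ?N s * ?n powr (- 2 / p)\<bar> < e" if s: "s \<in> F" for s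
  proof -
    have "card {t\<in>E. t + s \<in> E} + card {t\<in>E. t + s \<notin> E} = card ({t\<in>E. t + s \<in> E} \<union> {t\<in>E. t + s \<notin> E})"
      using E by (intro card_Un_disjoint[symmetric]) auto
    also have "{t\<in>E. t + s \<in> E} \<union> {t\<in>E. t + s \<notin> E} = E" by blast
    finally have "?N s + real (card {t\<in>E. t + s \<notin> E}) = ?n" by linarith
    then have "\<bar>1 - ?N s / ?n\<bar> \<le> e / 2"
      using Fol[OF s] n by (simp add: abs_le_iff field_simps)
    then have "\<bar>1 - ?N s * ?n powr (- 2 / 2)\<bar> < e" using e n by (simp add: powr_minus_divide)
    moreover have "((\<lambda>p. \<bar>1 - ?N s * ?n powr (- 2 / p)\<bar>) \<longlongrightarrow> \<bar>1 - ?N s * ?n powr (- 2 / 2)\<bar>)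
        (at 2 within {1..<2})"
      using n by (intro tendsto_intros) auto
    ultimately show ?thesis by (rule order_tendstoD(2)[rotated])
  qed
  have "\<forall>\<^sub>F p in at 2 within {1..<2}. \<forall>s\<in>F. \<bar>1 - ?N s * ?n powr (- 2 / p)\<bar> < e"
    using F ev by (intro eventually_ball_finite) auto
  moreover have "\<forall>\<^sub>F p :: real in at 2 within {1..<2}. p \<in> {1..<2}"
    by (simp add: eventually_at_filter)
  ultimately show ?thesis
  proof eventually_elim
    case (elim p)
    then show ?case
      using Folner_unit_p[OF E, of p]
      by (intro bexI[of _ "\<lambda>t. if t \<in> E then real (card E) powr (- 1 / p) else 0"]) auto
  qed
qed

section \<open>Invariant means from almost invariant profiles\<close>

text \<open>
  Tychonoff's theorem for a product of discs. Every property of means that is closed under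
  pointwise convergence, such as additivity, passes from the members of the sequence to the
  cluster point.
\<close>
lemma pointwise_bounded_cluster_point:
  fixes M :: "nat \<Rightarrow> 'a \<Rightarrow> complex"
  assumes "\<And>n h. cmod (M n h) \<le> B h"
  shows "\<exists>m. \<forall>C. closed C \<longrightarrow> (\<forall>\<^sub>F n in sequentially. M n \<in> C) \<longrightarrow> m \<in> C"
proof -
  let ?K = "PiE UNIV (\<lambda>h. cball (0 :: complex) (B h))"
  have "compactin (product_topology (\<lambda>_ :: 'a. euclidean :: complex topology) UNIV) ?K"
    by (subst compactin_PiE) simp
  then have "compact ?K" by (simp add: euclidean_product_topology)
  moreover have "\<forall>\<^sub>F f in filtermap M sequentially. f \<in> ?K"
    using assms by (simp add: eventually_filtermap PiE_UNIV_domain)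
  moreover have "filtermap M sequentially \<noteq> bot" by (simp add: filtermap_bot_iff)
  ultimately obtain m where m: "inf (nhds m) (filtermap M sequentially) \<noteq> bot"
    unfolding compact_filter by blast
  have "m \<in> C" if C: "closed C" "\<forall>\<^sub>F n in sequentially. M n \<in> C" for C
  proof (rule ccontr)
    assume "m \<notin> C"
    then have "\<forall>\<^sub>F f in nhds m. f \<in> - C" using C(1) by (intro eventually_nhds_in_open) auto
    moreover have "\<forall>\<^sub>F f in filtermap M sequentially. f \<in> C" using C(2) by (simp add: eventually_filtermap)
    ultimately have "\<forall>\<^sub>F f in inf (nhds m) (filtermap M sequentially). False"
      unfolding eventually_inf by blast
    with m show False by (simp add: trivial_limit_def)
  qed
  then show ?thesis by blast
qed

text \<open>
  The density \<open>g\<^sup>2\<close> is almost invariant under right translation. Inversion makes the functional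
  almost invariant under left translation, as amenability demands.
\<close>
definition profile_functional :: "('g::group_add \<times> nat \<Rightarrow> real) \<Rightarrow> ('g \<Rightarrow> complex) \<Rightarrow> complex" where
  "profile_functional g h = (\<Sum>\<^sub>\<infinity>x. of_real ((g x)\<^sup>2) * h (- fst x))"

lemma profile_functional_bounds:
  fixes g :: "'g::group_add \<times> nat \<Rightarrow> real"
  assumes sq: "(\<lambda>x. (g x)\<^sup>2) summable_on UNIV" "(\<Sum>\<^sub>\<infinity>x. (g x)\<^sup>2) \<le> 1"
    and h: "\<And>t. cmod (h t) \<le> b"
  shows "(\<lambda>x. of_real ((g x)\<^sup>2) * h (- fst x)) summable_on UNIV" "cmod (profile_functional g h) \<le> b"
proof -
  have b0: "0 \<le> b" using h[of 0] by (meson norm_ge_zero order_trans)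
  have le: "norm (of_real ((g x)\<^sup>2) * h (- fst x)) \<le> (g x)\<^sup>2 * b" for x
    unfolding norm_mult using h by (intro mult_mono) (auto simp: norm_power)
  have bs: "(\<lambda>x. (g x)\<^sup>2 * b) summable_on UNIV" using sq(1) by (rule summable_on_cmult_left)
  have s: "(\<lambda>x. norm (of_real ((g x)\<^sup>2) * h (- fst x))) summable_on UNIV"
    by (rule summable_on_comparison_test[OF bs le]) simp
  then show "(\<lambda>x. of_real ((g x)\<^sup>2) * h (- fst x)) summable_on UNIV" by (rule abs_summable_summable)
  have "cmod (profile_functional g h) \<le> (\<Sum>\<^sub>\<infinity>x. norm (of_real ((g x)\<^sup>2) * h (- fst x)))"
    unfolding profile_functional_def by (rule norm_infsum_bound[OF s])
  also have "\<dots> \<le> (\<Sum>\<^sub>\<infinity>x. (g x)\<^sup>2 * b)" by (rule infsum_mono[OF s bs le])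
  also have "\<dots> = (\<Sum>\<^sub>\<infinity>x. (g x)\<^sup>2) * b" by (rule infsum_cmult_left')
  also have "\<dots> \<le> 1 * b" using sq b0 by (intro mult_right_mono)
  finally show "cmod (profile_functional g h) \<le> b" by simp
qed

text \<open>
  The two sums differ by the integral of a bounded function against the difference of \<open>g\<^sup>2\<close> and
  its translate, which factors as difference times sum of \<open>g\<close> and its translate. The square of the
  2-norm of the difference is \<open>2 * (\<Sum>x. (g x)\<^sup>2) - 2 * corr g s \<le> 2 * e\<close>, that of the sum is at
  most 4.
\<close>
lemma profile_functional_translate:
  fixes g :: "'g::group_add \<times> nat \<Rightarrow> real"
  assumes sq: "(\<lambda>x. (g x)\<^sup>2) summable_on UNIV" "(\<Sum>\<^sub>\<infinity>x. (g x)\<^sup>2) \<le> 1"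
    and h: "\<And>t. cmod (h t) \<le> b" and e: "\<bar>1 - corr g s\<bar> \<le> e"
  shows "cmod (profile_functional g h - profile_functional g (\<lambda>t. h (- s + t))) \<le> b * (2 * sqrt (2 * e))"
proof -
  have b0: "0 \<le> b" using h[of 0] by (meson norm_ge_zero order_trans)
  let ?k = "\<lambda>x. h (- (fst x + s))"
  have gs: "(\<lambda>x. (g (shift s x))\<^sup>2) summable_on UNIV" "(\<Sum>\<^sub>\<infinity>x. (g (shift s x))\<^sup>2) = (\<Sum>\<^sub>\<infinity>x. (g x)\<^sup>2)"
    using sq summable_shift[of "\<lambda>x. (g x)\<^sup>2" s] infsum_shift[of "\<lambda>x. (g x)\<^sup>2" s] by auto
  note cs = corr_summable[OF sq(1), of s]
  have s1: "(\<lambda>x. of_real ((g (shift s x))\<^sup>2) * ?k x) summable_on UNIV"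
    using profile_functional_bounds(1)[OF sq h] summable_shift[of "\<lambda>x. of_real ((g x)\<^sup>2) * h (- fst x)" s]
    by (simp add: shift_def)
  have s2: "(\<lambda>x. of_real ((g x)\<^sup>2) * ?k x) summable_on UNIV"
    using profile_functional_bounds(1)[OF sq, of "\<lambda>t. h (- s + t)" b] h by (simp add: minus_add)
  have w1: "profile_functional g h = (\<Sum>\<^sub>\<infinity>x. of_real ((g (shift s x))\<^sup>2) * ?k x)"
    unfolding profile_functional_def
    using infsum_shift[of "\<lambda>x. of_real ((g x)\<^sup>2) * h (- fst x)" s] by (simp add: shift_def)
  have w2: "profile_functional g (\<lambda>t. h (- s + t)) = (\<Sum>\<^sub>\<infinity>x. of_real ((g x)\<^sup>2) * ?k x)"
    unfolding profile_functional_def by (simp add: minus_add)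
  let ?d = "\<lambda>x. g (shift s x) - g x" and ?a = "\<lambda>x. g (shift s x) + g x"
  have exp: "(?d x)\<^sup>2 = ((g (shift s x))\<^sup>2 + (g x)\<^sup>2) + (- 2) * (g x * g (shift s x))"
    "(?a x)\<^sup>2 = ((g (shift s x))\<^sup>2 + (g x)\<^sup>2) + 2 * (g x * g (shift s x))" for x
    by (auto simp: power2_eq_square algebra_simps)
  have sums: "(\<lambda>x. (g (shift s x))\<^sup>2 + (g x)\<^sup>2) summable_on UNIV"
    "(\<lambda>x. c * (g x * g (shift s x))) summable_on UNIV" for c
    using gs sq cs by (auto intro: summable_on_add summable_on_cmult_right)
  have d: "(\<lambda>x. (?d x)\<^sup>2) summable_on UNIV" and a: "(\<lambda>x. (?a x)\<^sup>2) summable_on UNIV"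
    unfolding exp by (intro summable_on_add sums)+
  have tot: "(\<Sum>\<^sub>\<infinity>x. ((g (shift s x))\<^sup>2 + (g x)\<^sup>2) + c * (g x * g (shift s x)))
      = 2 * (\<Sum>\<^sub>\<infinity>x. (g x)\<^sup>2) + c * corr g s" for c
    using infsum_add[OF sums(1) sums(2)[of c]] infsum_add[OF gs(1) sq(1)] gs(2)
    by (simp add: infsum_cmult_right' corr_def)
  have dle: "(\<Sum>\<^sub>\<infinity>x. (?d x)\<^sup>2) \<le> 2 * e"
    unfolding exp tot using sq(2) e by linarith
  have ale: "(\<Sum>\<^sub>\<infinity>x. (?a x)\<^sup>2) \<le> 4"
  proof -
    have "0 \<le> (\<Sum>\<^sub>\<infinity>x. (?d x)\<^sup>2)" by (rule infsum_nonneg) simp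
    then have "corr g s \<le> (\<Sum>\<^sub>\<infinity>x. (g x)\<^sup>2)" unfolding exp tot by simp
    then show ?thesis unfolding exp tot using sq(2) by simp
  qed
  have CS: "(\<lambda>x. \<bar>?d x * ?a x\<bar>) summable_on UNIV" "(\<Sum>\<^sub>\<infinity>x. \<bar>?d x * ?a x\<bar>) \<le> sqrt (2 * e) * sqrt 4"
  proof -
    show "(\<lambda>x. \<bar>?d x * ?a x\<bar>) summable_on UNIV" by (rule real_Cauchy_Schwarz_infsum(1)[OF d a])
    have "(\<Sum>\<^sub>\<infinity>x. \<bar>?d x * ?a x\<bar>) \<le> sqrt (\<Sum>\<^sub>\<infinity>x. (?d x)\<^sup>2) * sqrt (\<Sum>\<^sub>\<infinity>x. (?a x)\<^sup>2)"
      by (rule real_Cauchy_Schwarz_infsum(3)[OF d a])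
    also have "\<dots> \<le> sqrt (2 * e) * sqrt 4"
      using dle ale e by (intro mult_mono real_sqrt_le_mono) (auto intro: infsum_nonneg)
    finally show "(\<Sum>\<^sub>\<infinity>x. \<bar>?d x * ?a x\<bar>) \<le> sqrt (2 * e) * sqrt 4" .
  qed
  have le: "norm (of_real ((g (shift s x))\<^sup>2) * ?k x - of_real ((g x)\<^sup>2) * ?k x) \<le> b * \<bar>?d x * ?a x\<bar>" for x
  proof -
    have "of_real ((g (shift s x))\<^sup>2) * ?k x - of_real ((g x)\<^sup>2) * ?k x = of_real (?d x * ?a x) * ?k x"
      by (simp add: power2_eq_square algebra_simps)
    then show ?thesis using h[of "- (fst x + s)"]
      by (simp add: norm_mult abs_mult mult.commute[of b] mult_left_mono del: of_real_mult of_real_diff of_real_add)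
  qed
  have bs: "(\<lambda>x. b * \<bar>?d x * ?a x\<bar>) summable_on UNIV" using CS(1) by (rule summable_on_cmult_right)
  have ns: "(\<lambda>x. norm (of_real ((g (shift s x))\<^sup>2) * ?k x - of_real ((g x)\<^sup>2) * ?k x)) summable_on UNIV"
    by (rule summable_on_comparison_test[OF bs le]) simp
  have "profile_functional g h - profile_functional g (\<lambda>t. h (- s + t))
      = (\<Sum>\<^sub>\<infinity>x. of_real ((g (shift s x))\<^sup>2) * ?k x - of_real ((g x)\<^sup>2) * ?k x)"
    unfolding w1 w2
    using infsum_add[OF s1 summable_on_uminus[THEN iffD2, OF s2]] by (simp add: infsum_uminus)
  also have "cmod \<dots> \<le> (\<Sum>\<^sub>\<infinity>x. norm (of_real ((g (shift s x))\<^sup>2) * ?k x - of_real ((g x)\<^sup>2) * ?k x))"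
    by (rule norm_infsum_bound[OF ns])
  also have "\<dots> \<le> (\<Sum>\<^sub>\<infinity>x. b * \<bar>?d x * ?a x\<bar>)" by (rule infsum_mono[OF ns bs le])
  also have "\<dots> = b * (\<Sum>\<^sub>\<infinity>x. \<bar>?d x * ?a x\<bar>)" by (rule infsum_cmult_right')
  also have "\<dots> \<le> b * (sqrt (2 * e) * sqrt 4)" using CS(2) b0 by (rule mult_left_mono)
  finally show ?thesis by (simp add: mult.commute)
qed

text \<open>
  Countability of the group allows an exhaustion by finite sets, so that a sequence of functionals
  suffices. The neutral element is added to every set because \<open>corr g 0\<close> is the total mass of the
  density, which must tend to 1.
\<close>
lemma almost_invariant_profiles_imp_amenable:
  assumes "\<And>(F :: 'g::{group_add, countable} set) e. finite F \<Longrightarrow> 0 < e \<Longrightarrow>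
    \<exists>p g. p \<le> 2 \<and> g \<in> profiles p \<and> (\<forall>s\<in>F. \<bar>1 - corr g s\<bar> < e)"
  shows "amenable TYPE('g)"
proof -
  let ?F = "\<lambda>n. insert 0 {x :: 'g. to_nat x < n}"
  have fin: "finite (?F n)" for n by (simp add: finite_to_nat_less)
  have "\<forall>n. \<exists>g :: 'g \<times> nat \<Rightarrow> real. (\<lambda>x. (g x)\<^sup>2) summable_on UNIV \<and> (\<Sum>\<^sub>\<infinity>x. (g x)\<^sup>2) \<le> 1
      \<and> (\<forall>s\<in>?F n. \<bar>1 - corr g s\<bar> < 1 / real (Suc n))"
  proof
    fix n
    obtain p g where "p \<le> 2" "g \<in> profiles p" "\<forall>s\<in>?F n. \<bar>1 - corr g s\<bar> < 1 / real (Suc n)"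
      using assms[OF fin[of n], of "1 / real (Suc n)"] by auto
    then show "\<exists>g :: 'g \<times> nat \<Rightarrow> real. (\<lambda>x. (g x)\<^sup>2) summable_on UNIV \<and> (\<Sum>\<^sub>\<infinity>x. (g x)\<^sup>2) \<le> 1
      \<and> (\<forall>s\<in>?F n. \<bar>1 - corr g s\<bar> < 1 / real (Suc n))"
      using profiles_square[of g p] by blast
  qed
  then obtain g :: "nat \<Rightarrow> 'g \<times> nat \<Rightarrow> real" where
    g: "\<And>n. (\<lambda>x. (g n x)\<^sup>2) summable_on UNIV" "\<And>n. (\<Sum>\<^sub>\<infinity>x. (g n x)\<^sup>2) \<le> 1"
    and inv: "\<And>n s. s \<in> ?F n \<Longrightarrow> \<bar>1 - corr (g n) s\<bar> < 1 / real (Suc n)" by metis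
  define b where "b h = (SOME b. \<forall>t. cmod (h t) \<le> b)" for h :: "'g \<Rightarrow> complex"
  have b: "cmod (h t) \<le> b h" if "bounded (range h)" for h t
  proof -
    have "\<exists>b. \<forall>t. cmod (h t) \<le> b" using that by (auto simp: bounded_iff)
    then have "\<forall>t. cmod (h t) \<le> b h" unfolding b_def by (rule someI_ex)
    then show ?thesis by blast
  qed
  have ws: "(\<lambda>x. of_real ((g n x)\<^sup>2) * h (- fst x)) summable_on UNIV" if "bounded (range h)"
    for n and h :: "'g \<Rightarrow> complex"
    by (rule profile_functional_bounds(1)[where h = h and b = "b h", OF g b[OF that]])
  define M where "M n h = (if bounded (range h) then profile_functional (g n) h else 0)" for n h
  have "cmod (M n h) \<le> (if bounded (range h) then b h else 0)" for n h
    using profile_functional_bounds(2)[where g = "g n" and h = h and b = "b h", OF g b] by (simp add: M_def)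
  from pointwise_bounded_cluster_point[of M, OF this]
  obtain m where m: "\<And>C. closed C \<Longrightarrow> (\<forall>\<^sub>F n in sequentially. M n \<in> C) \<Longrightarrow> m \<in> C" by blast
  have small: "\<forall>\<^sub>F n in sequentially. c * (2 * sqrt (2 * (1 / real (Suc n)))) \<le> e" if "0 < e" for c e :: real
  proof -
    have "(\<lambda>n. c * (2 * sqrt (2 * (1 / real (Suc n))))) \<longlonglongrightarrow> c * (2 * sqrt (2 * 0))"
      by (intro tendsto_intros LIMSEQ_Suc[OF lim_1_over_n])
    then have "\<forall>\<^sub>F n in sequentially. c * (2 * sqrt (2 * (1 / real (Suc n)))) < e"
      using that by (intro order_tendstoD) auto
    then show ?thesis by (rule eventually_mono) simp
  qed
  have "is_mean m"
    unfolding is_mean_def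
  proof (intro conjI allI impI)
    fix f h :: "'g \<Rightarrow> complex" assume f: "bounded (range f)" and h: "bounded (range h)"
    have fh: "bounded (range (\<lambda>x. f x + h x))" using f h by (rule bounded_plus_comp)
    have "m \<in> {m. m (\<lambda>x. f x + h x) = m f + m h}"
    proof (rule m)
      show "closed {m :: ('g \<Rightarrow> complex) \<Rightarrow> complex. m (\<lambda>x. f x + h x) = m f + m h}"
        by (intro closed_Collect_eq continuous_intros continuous_on_product_coordinates)
      have "M n (\<lambda>x. f x + h x) = M n f + M n h" for n
        using f h fh infsum_add[OF ws[OF f] ws[OF h], of n n]
        by (simp add: M_def profile_functional_def distrib_left)
      then show "\<forall>\<^sub>F n in sequentially. M n \<in> {m. m (\<lambda>x. f x + h x) = m f + m h}" by simp
    qed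
    then show "m (\<lambda>x. f x + h x) = m f + m h" by simp
  next
    fix c and f :: "'g \<Rightarrow> complex" assume f: "bounded (range f)"
    have cf: "bounded (range (\<lambda>x. c * f x))"
      using b[OF f] by (auto simp: bounded_iff norm_mult intro!: exI[of _ "cmod c * b f"] mult_left_mono)
    have "m \<in> {m. m (\<lambda>x. c * f x) = c * m f}"
    proof (rule m)
      show "closed {m :: ('g \<Rightarrow> complex) \<Rightarrow> complex. m (\<lambda>x. c * f x) = c * m f}"
        by (intro closed_Collect_eq continuous_intros continuous_on_product_coordinates)
      have "M n (\<lambda>x. c * f x) = c * M n f" for n
        using f cf by (simp add: M_def profile_functional_def mult.left_commute infsum_cmult_right')
      then show "\<forall>\<^sub>F n in sequentially. M n \<in> {m. m (\<lambda>x. c * f x) = c * m f}" by simp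
    qed
    then show "m (\<lambda>x. c * f x) = c * m f" by simp
  next
    fix f :: "'g \<Rightarrow> complex" assume f: "bounded (range f)" "range f \<subseteq> \<real>\<^sub>\<ge>\<^sub>0"
    have "m \<in> (\<lambda>m. m f) -` \<real>\<^sub>\<ge>\<^sub>0"
    proof (rule m)
      show "closed ((\<lambda>m :: ('g \<Rightarrow> complex) \<Rightarrow> complex. m f) -` \<real>\<^sub>\<ge>\<^sub>0)"
        by (intro closed_vimage closed_nonneg_Reals_complex continuous_on_product_coordinates)
      have "M n f \<in> \<real>\<^sub>\<ge>\<^sub>0" for n
      proof -
        have "of_real ((g n x)\<^sup>2) * f (- fst x) \<in> \<real>\<^sub>\<ge>\<^sub>0" for x
        proof (rule nonneg_Reals_mult_I)
          show "complex_of_real ((g n x)\<^sup>2) \<in> \<real>\<^sub>\<ge>\<^sub>0" by (simp only: nonneg_Reals_of_real_iff zero_le_power2)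
        qed (use f(2) in auto)
        then have "0 \<le> of_real ((g n x)\<^sup>2) * f (- fst x)" for x
          by (auto simp: complex_nonneg_Reals_iff less_eq_complex_def)
        then have "0 \<le> profile_functional (g n) f"
          unfolding profile_functional_def by (intro infsum_nonneg_complex ws[OF f(1)])
        then have "0 \<le> M n f" using f(1) by (simp add: M_def)
        then show ?thesis by (auto simp: complex_nonneg_Reals_iff less_eq_complex_def)
      qed
      then show "\<forall>\<^sub>F n in sequentially. M n \<in> (\<lambda>m. m f) -` \<real>\<^sub>\<ge>\<^sub>0" by simp
    qed
    then show "m f \<in> \<real>\<^sub>\<ge>\<^sub>0" by simp
  next
    have "cmod (m (\<lambda>_. 1) - 1) \<le> e" if e: "0 < e" for e
    proof -
      have "m \<in> {m. cmod (m (\<lambda>_. 1) - 1) \<le> e}"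
      proof (rule m)
        show "closed {m :: ('g \<Rightarrow> complex) \<Rightarrow> complex. cmod (m (\<lambda>_. 1) - 1) \<le> e}"
          by (intro closed_Collect_le continuous_intros continuous_on_product_coordinates)
        have "\<forall>\<^sub>F n in sequentially. 1 / real (Suc n) < e"
          using e by (intro order_tendstoD[OF LIMSEQ_Suc[OF lim_1_over_n]]) auto
        then show "\<forall>\<^sub>F n in sequentially. M n \<in> {m. cmod (m (\<lambda>_. 1) - 1) \<le> e}"
        proof eventually_elim
          case (elim n)
          have "M n (\<lambda>_. 1) = (\<Sum>\<^sub>\<infinity>x. complex_of_real ((g n x)\<^sup>2))"
            by (simp add: M_def profile_functional_def del: of_real_power)
          also have "\<dots> = of_real (\<Sum>\<^sub>\<infinity>x. (g n x)\<^sup>2)"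
            by (intro infsumI has_sum_of_real has_sum_infsum g)
          also have "(\<Sum>\<^sub>\<infinity>x. (g n x)\<^sup>2) = corr (g n) 0"
            by (simp add: corr_def shift_def power2_eq_square)
          finally have "cmod (M n (\<lambda>_. 1) - 1) = \<bar>1 - corr (g n) 0\<bar>"
            by (metis abs_minus_commute norm_of_real of_real_1 of_real_diff)
          then show ?case using inv[of 0 n] elim by simp
        qed
      qed
      then show ?thesis by simp
    qed
    then have "cmod (m (\<lambda>_. 1) - 1) \<le> 0" by (metis add_0 field_le_epsilon)
    then show "m (\<lambda>_. 1) = 1" by simp
  qed
  moreover have "m (\<lambda>x. f (- s + x)) = m f" if f: "bounded (range f)" for s f
  proof -
    have fs: "bounded (range (\<lambda>x. f (- s + x)))" using b[OF f] by (auto simp: bounded_iff)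
    have "cmod (m f - m (\<lambda>x. f (- s + x))) \<le> e" if e: "0 < e" for e
    proof -
      have "m \<in> {m. cmod (m f - m (\<lambda>x. f (- s + x))) \<le> e}"
      proof (rule m)
        show "closed {m :: ('g \<Rightarrow> complex) \<Rightarrow> complex. cmod (m f - m (\<lambda>x. f (- s + x))) \<le> e}"
          by (intro closed_Collect_le continuous_intros continuous_on_product_coordinates)
        show "\<forall>\<^sub>F n in sequentially. M n \<in> {m. cmod (m f - m (\<lambda>x. f (- s + x))) \<le> e}"
          using small[OF e, of "b f"] eventually_gt_at_top[of "to_nat s"]
        proof eventually_elim
          case (elim n)
          have "cmod (profile_functional (g n) f - profile_functional (g n) (\<lambda>t. f (- s + t)))
              \<le> b f * (2 * sqrt (2 * (1 / real (Suc n))))"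
            using inv[of s n] elim(2) by (intro profile_functional_translate g b[OF f]) auto
          then show ?case using elim(1) f fs by (simp add: M_def)
        qed
      qed
      then show ?thesis by simp
    qed
    then have "cmod (m f - m (\<lambda>x. f (- s + x))) \<le> 0" by (metis add_0 field_le_epsilon)
    then show ?thesis by simp
  qed
  ultimately show ?thesis unfolding amenable_def by blast
qed

section \<open>The strong operator topology\<close>

context multiplier_algebra begin

lemma identity_BL: "identity_on A \<in> BL A"
  by (auto simp: BL_def identity_on_def add_A cscale_A intro!: exI[of _ 1])

lemma openin_SOT:
  "M \<in> BL A \<Longrightarrow> T \<in> A \<Longrightarrow> 0 < e \<Longrightarrow> openin (SOT A) {N \<in> BL A. norm (N T - M T) < e}"
  unfolding SOT_def openin_topology_generated_by_iff by (rule generate_topology_on.Basis) blast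

lemma topspace_SOT: "topspace (SOT A) = BL A"
proof
  show "topspace (SOT A) \<subseteq> BL A" by (auto simp: SOT_def)
  show "BL A \<subseteq> topspace (SOT A)"
  proof
    fix M assume M: "M \<in> BL A"
    have "M \<in> {N \<in> BL A. norm (N 0 - M 0) < 1}" using M by simp
    then show "M \<in> topspace (SOT A)" using openin_subset[OF openin_SOT[OF M zero_A zero_less_one]] by blast
  qed
qed

text \<open>
  Convergence has to be tested on the subbase only, as finite intersections and unions preserve
  it.
\<close>
lemma limitin_SOT:
  assumes M: "M \<in> BL A" and X: "\<And>n. X n \<in> BL A"
    and conv: "\<And>T. T \<in> A \<Longrightarrow> (\<lambda>n. norm (X n T - M T)) \<longlonglongrightarrow> 0"
  shows "limitin (SOT A) X M sequentially"
  unfolding limitin_def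
proof (intro conjI allI impI)
  show "M \<in> topspace (SOT A)" using M by (simp add: topspace_SOT)
  fix U assume U: "openin (SOT A) U \<and> M \<in> U"
  then have "generate_topology_on {{N \<in> BL A. norm (N T - M T) < e} | M T e. M \<in> BL A \<and> T \<in> A \<and> 0 < e} U"
    unfolding SOT_def openin_topology_generated_by_iff by blast
  moreover have "M \<in> U" using U by blast
  ultimately show "\<forall>\<^sub>F n in sequentially. X n \<in> U"
  proof induction
    case Empty
    then show ?case by simp
  next
    case (Int a b)
    then show ?case by (auto intro: eventually_conj)
  next
    case (UN K)
    then obtain k where "k \<in> K" "M \<in> k" by blast
    with UN have "\<forall>\<^sub>F n in sequentially. X n \<in> k" by blast
    then show ?case by (rule eventually_mono) (use \<open>k \<in> K\<close> in blast)
  next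
    case (Basis s)
    then obtain N T e where s: "s = {L \<in> BL A. norm (L T - N T) < e}" "T \<in> A" by blast
    have lt: "norm (M T - N T) < e" using Basis(2) s by simp
    have "\<forall>\<^sub>F n in sequentially. norm (X n T - M T) < e - norm (M T - N T)"
      using conv[OF s(2)] lt by (intro order_tendstoD) auto
    then show ?case
    proof eventually_elim
      case (elim n)
      have "norm (X n T - N T) \<le> norm (X n T - M T) + norm (M T - N T)"
        using norm_triangle_ineq[of "X n T - M T" "M T - N T"] by simp
      with elim X[of n] show ?case by (simp add: s(1))
    qed
  qed
qed

text \<open>
  On an operator of finite propagation, only finitely many values of the symbol matter. Since all
  the multipliers are contractions, convergence extends from these operators to their closure.
\<close>
lemma profiles_limitin_identity:
  assumes g: "\<And>n. g n \<in> profiles (p n)" and p: "\<And>n. p n \<le> 2"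
    and lim: "\<And>s. (\<lambda>n. corr (g n) s) \<longlonglongrightarrow> 1"
  shows "limitin (SOT A) (\<lambda>n. schur A (kernel_of (corr_symbol (g n)))) (identity_on A) sequentially"
proof (rule limitin_SOT)
  note mb = multiplier_bound_profile[OF g p]
  show "identity_on A \<in> BL A" by (rule identity_BL)
  show "schur A (kernel_of (corr_symbol (g n))) \<in> BL A" for n by (rule schur_BL[OF mb])
  fix T assume T: "T \<in> A"
  have "(\<lambda>n. norm (schur_mult (corr_symbol (g n)) T - T)) \<longlonglongrightarrow> 0"
  proof (rule LIMSEQ_I)
    fix e :: real assume "0 < e"
    then obtain S where S: "S \<in> A" "finite_propagation S" "norm (S - T) < e / 3"
      using finite_propagation_dense[OF T, of "e / 3"] by auto
    then obtain K where K: "finite K" "{(x, y). entry S x y \<noteq> 0} \<subseteq> tube K"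
      unfolding finite_propagation_def by blast
    note Sb = A_bopD[OF S(1)] and Tb = A_bopD[OF T]
    have "(\<lambda>n. (\<Sum>s\<in>K. cmod (corr_symbol (g n) s - 1)) * norm S) \<longlonglongrightarrow> (\<Sum>s\<in>K. cmod (of_real 1 - 1)) * norm S"
      unfolding corr_symbol_def by (intro tendsto_intros lim)
    then have "\<forall>\<^sub>F n in sequentially. (\<Sum>s\<in>K. cmod (corr_symbol (g n) s - 1)) * norm S < e / 3"
      using \<open>0 < e\<close> by (intro order_tendstoD) auto
    then obtain N where N: "\<And>n. N \<le> n \<Longrightarrow> (\<Sum>s\<in>K. cmod (corr_symbol (g n) s - 1)) * norm S < e / 3"
      unfolding eventually_sequentially by blast
    have "norm (schur_mult (corr_symbol (g n)) T - T) < e" if n: "N \<le> n" for n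
    proof -
      have "schur_mult (\<lambda>s. indicator K s * (corr_symbol (g n) s - 1)) S = schur_mult (corr_symbol (g n)) S - S"
      proof (rule schur_mult_eqI)
        show "schur_mult (corr_symbol (g n)) S - S \<in> bop" by (intro bop_diff schur_mult_bop[OF mb] Sb)
        fix x y
        have "entry S x y = 0 \<or> x - y \<in> K" using K(2) by (auto simp: tube_def)
        then show "entry (schur_mult (corr_symbol (g n)) S - S) x y
            = indicator K (x - y) * (corr_symbol (g n) (x - y) - 1) * entry S x y"
          by (auto simp: entry_simps entry_schur_mult[OF mb Sb] algebra_simps)
      qed
      then have 1: "norm (schur_mult (corr_symbol (g n)) S - S) < e / 3"
        using norm_schur_mult_le[OF multiplier_bound_on_finite[OF K(1), of "\<lambda>s. corr_symbol (g n) s - 1"] Sb] N[OF n]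
        by simp
      have 2: "norm (schur_mult (corr_symbol (g n)) T - schur_mult (corr_symbol (g n)) S) \<le> norm (S - T)"
        using norm_schur_mult_le[OF mb[of n] bop_diff[OF Tb Sb]]
        by (simp add: schur_mult_diff_right[OF mb Tb Sb] norm_minus_commute)
      have "schur_mult (corr_symbol (g n)) T - T
          = (schur_mult (corr_symbol (g n)) T - schur_mult (corr_symbol (g n)) S) + (schur_mult (corr_symbol (g n)) S - S) + (S - T)" by simp
      also have "norm \<dots> \<le> norm (schur_mult (corr_symbol (g n)) T - schur_mult (corr_symbol (g n)) S)
          + norm (schur_mult (corr_symbol (g n)) S - S) + norm (S - T)"
        by (rule order_trans[OF norm_triangle_ineq add_right_mono[OF norm_triangle_ineq]])
      finally show ?thesis using 1 2 S(3) by linarith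
    qed
    then show "\<exists>N. \<forall>n\<ge>N. norm (norm (schur_mult (corr_symbol (g n)) T - T) - 0) < e" by auto
  qed
  then show "(\<lambda>n. norm (schur A (kernel_of (corr_symbol (g n))) T - identity_on A T)) \<longlonglongrightarrow> 0"
    using T by (simp add: schur_eq identity_on_def)
qed

text \<open>
  The seminorms at the operators \<open>left_regular s\<close> detect the values \<open>corr g s\<close>. Including the
  neutral element keeps the family of neighbourhoods nonempty.
\<close>
lemma identity_in_closure_imp_profiles:
  fixes F :: "'g set"
  assumes cl: "identity_on A \<in> SOT A closure_of (\<Union>p\<in>{1..<2}. S_class A p)"
    and F: "finite F" and e: "0 < e"
  shows "\<exists>p g. p \<le> 2 \<and> g \<in> profiles p \<and> (\<forall>s\<in>F. \<bar>1 - corr g s\<bar> < e)"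
proof -
  let ?V = "\<lambda>s. {N \<in> BL A. norm (N (left_regular s) - identity_on A (left_regular s)) < e}"
  let ?U = "\<Inter>(?V ` insert 0 F)"
  have "openin (SOT A) ?U"
    using F e by (intro openin_Inter) (auto intro: openin_SOT identity_BL left_regular_A)
  moreover have "identity_on A \<in> ?U" using identity_BL e by auto
  ultimately obtain M where M: "M \<in> (\<Union>p\<in>{1..<2}. S_class A p)" "M \<in> ?U"
    using cl unfolding in_closure_of by blast
  then obtain p f where p: "1 \<le> p" "p < 2" and f: "f \<in> unit_p p" and Mf: "M = Phi_multiplier A f"
    by (auto simp: S_class_def)
  let ?g = "single_profile f"
  have g: "?g \<in> profiles p" by (rule single_profile_profiles[OF f p(1)])
  have Mg: "M = schur A (kernel_of (corr_symbol ?g))"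
    unfolding Mf using p by (intro Phi_multiplier_single[OF f]) auto
  have mb: "multiplier_bound (corr_symbol ?g) 1" using p by (intro multiplier_bound_profile[OF g]) simp
  have "\<bar>1 - corr ?g s\<bar> < e" if s: "s \<in> F" for s
  proof -
    have "corr_symbol ?g s - 1 = entry (M (left_regular s) - identity_on A (left_regular s)) s 0"
      by (simp add: Mg schur_eq left_regular_A identity_on_def entry_simps
          entry_schur_mult[OF mb left_regular_bop] entry_left_regular)
    then have "cmod (corr_symbol ?g s - 1) \<le> norm (M (left_regular s) - identity_on A (left_regular s))"
      by (metis cmod_entry_le)
    also have "\<dots> < e" using M(2) s by blast
    also have "cmod (corr_symbol ?g s - 1) = \<bar>1 - corr ?g s\<bar>"
      unfolding corr_symbol_def by (metis abs_minus_commute norm_of_real of_real_1 of_real_diff)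
    finally show ?thesis .
  qed
  then show ?thesis using g p by (intro exI[of _ p] exI[of _ ?g]) auto
qed

lemma X_class_defect:
  assumes F: "finite F" and p: "1 \<le> p" "p < 2" and M: "M \<in> X_class A p"
  shows "\<exists>g\<in>profiles p. M = schur A (kernel_of (corr_symbol g)) \<and> tube_defect A F M = defect F (corr_symbol g)"
  using M p tube_defect_profile[OF F] by (auto simp: X_class_eq)

lemma tube_defect_nonneg:
  "finite F \<Longrightarrow> 1 \<le> p \<Longrightarrow> p < 2 \<Longrightarrow> M \<in> X_class A p \<Longrightarrow> 0 \<le> tube_defect A F M"
  using X_class_defect defect_nonneg by metis

lemma X_class_nonempty: "1 \<le> p \<Longrightarrow> p < 2 \<Longrightarrow> X_class A p \<noteq> {}"
proof -
  have "(\<lambda>_. 0) \<in> (profiles p :: ('g \<times> nat \<Rightarrow> real) set)" by (rule profilesI) auto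
  then show "1 \<le> p \<Longrightarrow> p < 2 \<Longrightarrow> X_class A p \<noteq> {}" by (auto simp: X_class_eq)
qed

lemma min_defect_nonneg:
  "finite F \<Longrightarrow> 1 \<le> p \<Longrightarrow> p < 2 \<Longrightarrow> 0 \<le> min_defect A F p"
  unfolding min_defect_def
  by (intro cINF_greatest X_class_nonempty tube_defect_nonneg) auto

lemma min_defect_le:
  assumes "finite F" "1 \<le> p" "p < 2" "g \<in> profiles p"
  shows "min_defect A F p \<le> (\<Sum>s\<in>F. \<bar>1 - corr g s\<bar>)"
proof -
  have "min_defect A F p \<le> tube_defect A F (schur A (kernel_of (corr_symbol g)))"
    unfolding min_defect_def
    using assms by (intro cINF_lower bdd_belowI2[of _ 0] tube_defect_nonneg) (auto simp: X_class_eq)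
  also have "\<dots> = defect F (corr_symbol g)" using assms by (intro tube_defect_profile) auto
  also have "\<dots> \<le> (\<Sum>s\<in>F. cmod (1 - corr_symbol g s))" by (rule defect_le[OF assms(1)])
  also have "\<dots> = (\<Sum>s\<in>F. \<bar>1 - corr g s\<bar>)"
    unfolding corr_symbol_def by (metis norm_of_real of_real_1 of_real_diff)
  finally show ?thesis .
qed

lemma profile_of_small_defect:
  assumes F: "finite F" and p: "1 \<le> p" "p < 2" and M: "M \<in> X_class A p" and e: "tube_defect A F M < e"
  shows "\<exists>g\<in>profiles p. M = schur A (kernel_of (corr_symbol g)) \<and> (\<forall>s\<in>F. \<bar>1 - corr g s\<bar> < e)"
proof -
  obtain g where g: "g \<in> profiles p" "M = schur A (kernel_of (corr_symbol g))"
    "tube_defect A F M = defect F (corr_symbol g)" using X_class_defect[OF F p M] by blast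
  have "\<bar>1 - corr g s\<bar> < e" if "s \<in> F" for s
  proof -
    have "\<bar>1 - corr g s\<bar> = cmod (1 - corr_symbol g s)"
      unfolding corr_symbol_def by (metis norm_of_real of_real_1 of_real_diff)
    then show ?thesis using le_defect[OF F that, of "corr_symbol g"] g(3) e by simp
  qed
  with g show ?thesis by blast
qed

end

section \<open>Amenability and the minimal defect\<close>

lemma eventually_exponent_range: "\<forall>\<^sub>F p :: real in at 2 within {1..<2}. p \<in> {1..<2}"
  by (simp add: eventually_at_filter)

lemma at_2_within_nontrivial: "at (2::real) within {1..<2} \<noteq> bot"
  unfolding at_2_within_eq by simp

lemma min_defect_tendsto_0:
  fixes A :: "'g::{group_add, countable} op set"
  assumes A: "multiplier_algebra A" and am: "amenable TYPE('g)" and F: "finite F"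
  shows "(min_defect A F \<longlongrightarrow> 0) (at 2 within {1..<2})"
proof (rule tendstoI)
  interpret multiplier_algebra A by (rule A)
  fix e :: real assume e: "0 < e"
  let ?e = "e / (real (card F) + 1)"
  have "0 < ?e" using e by simp
  from amenable_imp_unit_p[OF am F this] eventually_exponent_range
  show "\<forall>\<^sub>F p in at 2 within {1..<2}. dist (min_defect A F p) 0 < e"
  proof eventually_elim
    case (elim p)
    then obtain f where f: "f \<in> unit_p p" "\<And>s. s \<in> F \<Longrightarrow> \<bar>1 - corr (single_profile f) s\<bar> < ?e" by blast
    have p: "1 \<le> p" "p < 2" using elim by auto
    have "min_defect A F p \<le> (\<Sum>s\<in>F. \<bar>1 - corr (single_profile f) s\<bar>)"
      by (rule min_defect_le[OF F p single_profile_profiles[OF f(1) p(1)]])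
    also have "\<dots> \<le> (\<Sum>s\<in>F. ?e)" using f(2) by (intro sum_mono less_imp_le)
    also have "\<dots> < e" using e by (simp add: field_simps)
    finally show ?case using min_defect_nonneg[OF F p] by simp
  qed
qed

theorem theorem1p5:
  fixes A :: "'g::{group_add, countable} op set"
  assumes "A = reduced_group_Cstar \<or> A = uniform_Roe_algebra"
  shows
    "(\<forall>F p. finite F \<longrightarrow> p \<in> {1..<2} \<longrightarrow> (\<exists>M. is_minimizer A F p M))
     \<and> (amenable TYPE('g) \<longleftrightarrow> identity_on A \<in> SOT A closure_of (\<Union>p\<in>{1..<2}. S_class A p))
     \<and> (amenable TYPE('g) \<longleftrightarrow>
          (\<forall>F. finite F \<longrightarrow> (min_defect A F \<longlongrightarrow> 0) (at 2 within {1..<2})))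
     \<and> (amenable TYPE('g) \<longrightarrow>
          (\<forall>F :: nat \<Rightarrow> 'g set. (\<forall>n. finite (F n)) \<longrightarrow> incseq F \<longrightarrow> (\<Union>n. F n) = UNIV \<longrightarrow>
             (\<exists>p :: nat \<Rightarrow> real. (\<forall>n. p n \<in> {1..<2}) \<and>
                (\<forall>M. (\<forall>n. is_minimizer A (F n) (p n) (M n)) \<longrightarrow>
                   limitin (SOT A) M (identity_on A) sequentially))))"
proof -
  have A: "multiplier_algebra A"
    using assms multiplier_algebra_reduced multiplier_algebra_Roe by blast
  then interpret multiplier_algebra A .
  have corr_lim: "(\<lambda>n. corr (g n) s) \<longlonglongrightarrow> 1"
    if small: "\<And>n. \<forall>s\<in>F n. \<bar>1 - corr (g n) s\<bar> < 1 / real (Suc n)" and F: "incseq F" "(\<Union>n. F n) = UNIV"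
    for F :: "nat \<Rightarrow> 'g set" and g :: "nat \<Rightarrow> 'g \<times> nat \<Rightarrow> real" and s
  proof -
    obtain N where N: "s \<in> F N" using F(2) by blast
    have "\<forall>\<^sub>F n in sequentially. norm (corr (g n) s - 1) \<le> 1 / real (Suc n)"
      using eventually_ge_at_top[of N]
    proof eventually_elim
      case (elim n)
      then have "s \<in> F n" using N incseqD[OF F(1)] by blast
      then show ?case using small[of n] by (simp add: abs_minus_commute less_imp_le)
    qed
    then have "(\<lambda>n. corr (g n) s - 1) \<longlonglongrightarrow> 0"
      by (rule Lim_null_comparison[OF _ LIMSEQ_Suc[OF lim_1_over_n]])
    then show ?thesis by (rule LIM_zero_cancel)
  qed
  have ex_min: "\<exists>M. is_minimizer A F p M" if F: "finite F" and p: "p \<in> {1..<2}" for F p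
  proof -
    have p': "1 \<le> p" "p < 2" using p by auto
    obtain h where h: "h \<in> profiles p" "\<forall>g\<in>profiles p. defect F (corr_symbol h) \<le> defect F (corr_symbol g)"
      using exists_minimal_defect[OF A F p'] by blast
    let ?M = "schur A (kernel_of (corr_symbol h))"
    have hX: "?M \<in> X_class A p" using h p' by (auto simp: X_class_eq)
    have "tube_defect A F ?M = defect F (corr_symbol h)" using h p' F by (intro tube_defect_profile) auto
    then have "\<not> tube_defect A F N < tube_defect A F ?M" if "N \<in> X_class A p" for N
      using X_class_defect[OF F p' that] h(2) by (metis not_less)
    then have "is_minimizer A F p ?M" using hX by (auto simp: is_minimizer_def is_arg_min_def)
    then show ?thesis by blast
  qed
  have closure: "identity_on A \<in> SOT A closure_of (\<Union>p\<in>{1..<2}. S_class A p)"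
    if am: "amenable TYPE('g)"
  proof -
    let ?F = "\<lambda>n. {x :: 'g. to_nat x < n}"
    have fin: "finite (?F n)" for n by (rule finite_to_nat_less)
    have "\<exists>p f. p \<in> {1..<2} \<and> f \<in> unit_p p \<and> (\<forall>s\<in>?F n. \<bar>1 - corr (single_profile f) s\<bar> < 1 / real (Suc n))"
      for n
    proof -
      have "0 < 1 / real (Suc n)" by simp
      from eventually_happens'[OF at_2_within_nontrivial
          eventually_conj[OF amenable_imp_unit_p[OF am fin[of n] this] eventually_exponent_range]]
      show ?thesis by blast
    qed
    then obtain p f where pf: "\<And>n. p n \<in> {1..<2}" "\<And>n. f n \<in> unit_p (p n)"
      "\<And>n. \<forall>s\<in>?F n. \<bar>1 - corr (single_profile (f n)) s\<bar> < 1 / real (Suc n)" by metis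
    have p: "1 \<le> p n" "p n \<le> 2" for n using pf(1)[of n] by auto
    have lim: "limitin (SOT A) (\<lambda>n. schur A (kernel_of (corr_symbol (single_profile (f n)))))
        (identity_on A) sequentially"
    proof (rule profiles_limitin_identity[of _ p])
      show "(\<lambda>n. corr (single_profile (f n)) s) \<longlonglongrightarrow> 1" for s
        by (rule corr_lim[of ?F]) (use pf(3) in \<open>auto simp: incseq_def\<close>)
    qed (use p pf in \<open>auto intro: single_profile_profiles\<close>)
    have inS: "schur A (kernel_of (corr_symbol (single_profile (f n)))) \<in> (\<Union>p\<in>{1..<2}. S_class A p)" for n
    proof -
      have "schur A (kernel_of (corr_symbol (single_profile (f n)))) \<in> S_class A (p n)"
        unfolding S_class_def
        using Phi_multiplier_single[where A = A and f = "f n" and p = "p n", OF pf(2) p] pf(2)[of n]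
        by (metis (mono_tags, lifting) mem_Collect_eq)
      then show ?thesis using pf(1)[of n] by blast
    qed
    show ?thesis
      unfolding in_closure_of
    proof (intro conjI allI impI)
      show "identity_on A \<in> topspace (SOT A)" by (simp add: topspace_SOT identity_BL)
      fix U assume "identity_on A \<in> U \<and> openin (SOT A) U"
      then have "\<forall>\<^sub>F n in sequentially. schur A (kernel_of (corr_symbol (single_profile (f n)))) \<in> U"
        using lim unfolding limitin_def by blast
      from eventually_happens'[OF sequentially_bot this]
      show "\<exists>M. M \<in> (\<Union>p\<in>{1..<2}. S_class A p) \<and> M \<in> U" using inS by blast
    qed
  qed
  have closure': "amenable TYPE('g)" if "identity_on A \<in> SOT A closure_of (\<Union>p\<in>{1..<2}. S_class A p)"
    by (rule almost_invariant_profiles_imp_amenable) (rule identity_in_closure_imp_profiles[OF that])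
  have defect': "amenable TYPE('g)"
    if lim: "\<forall>F. finite F \<longrightarrow> (min_defect A F \<longlongrightarrow> 0) (at 2 within {1..<2})"
  proof (rule almost_invariant_profiles_imp_amenable)
    fix F :: "'g set" and e :: real assume F: "finite F" and e: "0 < e"
    have "\<forall>\<^sub>F p in at 2 within {1..<2}. min_defect A F p < e"
      using lim F e by (intro order_tendstoD) auto
    from eventually_happens'[OF at_2_within_nontrivial eventually_conj[OF this eventually_exponent_range]]
    obtain p where p: "min_defect A F p < e" "1 \<le> p" "p < 2" by auto
    then obtain M where M: "M \<in> X_class A p" "tube_defect A F M < e"
      using cInf_lessD[of "tube_defect A F ` X_class A p" e] X_class_nonempty
      unfolding min_defect_def by auto
    from profile_of_small_defect[OF F p(2,3) M] p(3)
    show "\<exists>p g. p \<le> 2 \<and> g \<in> profiles p \<and> (\<forall>s\<in>F. \<bar>1 - corr g s\<bar> < e)" by (meson less_imp_le)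
  qed
  have exhaustion: "\<exists>p :: nat \<Rightarrow> real. (\<forall>n. p n \<in> {1..<2}) \<and>
      (\<forall>M. (\<forall>n. is_minimizer A (F n) (p n) (M n)) \<longrightarrow> limitin (SOT A) M (identity_on A) sequentially)"
    if am: "amenable TYPE('g)" and fin: "\<And>n. finite (F n)" and F: "incseq F" "(\<Union>n. F n) = UNIV"
    for F :: "nat \<Rightarrow> 'g set"
  proof -
    \<comment> \<open>the defect of every minimizer on \<open>F n\<close> is then below \<open>1 / (n + 1)\<close>, and so the symbols tend to 1 pointwise\<close>
    have "\<exists>p. p \<in> {1..<2} \<and> min_defect A (F n) p < 1 / real (Suc n)" for n
    proof -
      have "\<forall>\<^sub>F p in at 2 within {1..<2}. min_defect A (F n) p < 1 / real (Suc n)"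
        using min_defect_tendsto_0[OF A am fin[of n]] by (intro order_tendstoD) auto
      from eventually_happens'[OF at_2_within_nontrivial eventually_conj[OF this eventually_exponent_range]]
      show ?thesis by blast
    qed
    then obtain p where p: "\<And>n. p n \<in> {1..<2}" "\<And>n. min_defect A (F n) (p n) < 1 / real (Suc n)" by metis
    have p': "1 \<le> p n" "p n < 2" for n using p(1)[of n] by auto
    have "limitin (SOT A) M (identity_on A) sequentially" if M: "\<forall>n. is_minimizer A (F n) (p n) (M n)" for M
    proof -
      have MX: "M n \<in> X_class A (p n)" for n using M by (auto simp: is_minimizer_def is_arg_min_def)
      have "tube_defect A (F n) (M n) \<le> min_defect A (F n) (p n)" for n
        unfolding min_defect_def
        using M X_class_nonempty[OF p'] by (intro cINF_greatest) (auto simp: is_minimizer_def is_arg_min_def not_less)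
      then have "tube_defect A (F n) (M n) < 1 / real (Suc n)" for n using p(2) by (rule order.strict_trans1)
      from profile_of_small_defect[OF fin p' MX this]
      obtain g where g: "\<And>n. g n \<in> profiles (p n)" "\<And>n. M n = schur A (kernel_of (corr_symbol (g n)))"
        "\<And>n. \<forall>s\<in>F n. \<bar>1 - corr (g n) s\<bar> < 1 / real (Suc n)" by metis
      have "M = (\<lambda>n. schur A (kernel_of (corr_symbol (g n))))" using g(2) by (rule ext)
      then show ?thesis
        using profiles_limitin_identity[of g p, OF g(1) less_imp_le[OF p'(2)] corr_lim[OF g(3) F]] by simp
    qed
    with p(1) show ?thesis by blast
  qed
  show ?thesis
    using ex_min closure closure' min_defect_tendsto_0[OF A] defect' exhaustion by (intro conjI) blast+
qed

end
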